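(* Let $p\in(1,2)$ with Hölder conjugate $p'$, let $\rho>2/p'$, and let $q\in L^p_\rho(\mathbb{R}^2)$ be real-valued. If $k\in\mathbb{C}\setminus\{0\}$ is such that $k$ and $-k$ are not exceptional points of $q$, then $\mathbf{t}(k)=\overline{\mathbf{t}(-k)}$.
   Context: Points of $\mathbb{R}^2$ are identified with complex numbers $x=x_1+ix_2$; $\partial_x=\frac12(\partial_{x_1}-i\partial_{x_2})$, $\overline{\partial}_x=\frac12(\partial_{x_1}+i\partial_{x_2})$, and $dm$ is Lebesgue measure. $L^p_\rho(\mathbb{R}^2)$ is the space of measurable $f$ with $(1+|\cdot|^2)^{\rho/2}f\in L^p(\mathbb{R}^2)$. For $p\in(1,2)$, $\tilde p$ is the Sobolev conjugate, $1/\tilde p=1/p-1/2$. A point $k\in\mathbb{C}\setminus\{0\}$ is an exceptional point of $q$ if $\overline{\partial}_x(\partial_x+ik)h=qh$ has a nonzero solution $h\in W^{1,\tilde p}(\mathbb{R}^2)$. For non-exceptional $k\ne0$, $\mu(\cdot,k)$ is the unique solution of $\overline{\partial}_x(\partial_x+ik)\mu=q\mu$ with $\mu(\cdot,k)-1\in W^{1,\tilde p}(\mathbb{R}^2)$, and the scattering data of $q$ is $\mathbf{t}(k)=\int_{\mathbb{R}^2}e_k(x)q(x)\mu(x,k)\,dm(x)$, where $e_k(x)=\exp(i(kx+\overline{k}\,\overline{x}))$. *)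

theory Defs
  imports "HOL-Analysis.Analysis"
begin

text \<open>
  Points of the plane are complex numbers, with coordinate directions \<open>1\<close> and \<open>\<i>\<close>; the measure
  \<open>lebesgue :: complex measure\<close> is two-dimensional Lebesgue measure. Elements of \<open>L\<^sup>p\<close> and of
  Sobolev spaces are represented by functions, so that equality of elements is equality almost
  everywhere.
\<close>

definition Lp_space :: "real \<Rightarrow> (complex \<Rightarrow> complex) set" where
  "Lp_space p = {f. f \<in> borel_measurable lebesgue \<and> integrable lebesgue (\<lambda>x. norm (f x) powr p)}"

definition weighted_Lp :: "real \<Rightarrow> real \<Rightarrow> (complex \<Rightarrow> complex) set" where
  "weighted_Lp p \<rho> = {f. f \<in> borel_measurable lebesgue \<and>
     (\<lambda>x. complex_of_real ((1 + (norm x)\<^sup>2) powr (\<rho> / 2)) * f x) \<in> Lp_space p}"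

definition locally_integrable :: "(complex \<Rightarrow> complex) \<Rightarrow> bool" where
  "locally_integrable f \<longleftrightarrow> (\<forall>K. compact K \<longrightarrow> set_integrable lebesgue K f)"

definition sobolev_conj :: "real \<Rightarrow> real" where
  "sobolev_conj p = 1 / (1 / p - 1 / 2)"

definition partial :: "complex \<Rightarrow> (complex \<Rightarrow> complex) \<Rightarrow> complex \<Rightarrow> complex" where
  "partial e \<phi> x = frechet_derivative \<phi> (at x) e"

text \<open>Here \<open>differentiable\<close> is real differentiability, so this is \<open>C\<^sup>n\<close> on the real plane.\<close>

primrec Cn :: "nat \<Rightarrow> (complex \<Rightarrow> complex) set" where
  "Cn 0 = {\<phi>. continuous_on UNIV \<phi>}"
| "Cn (Suc n) = {\<phi>. (\<forall>x. \<phi> differentiable (at x)) \<and> partial 1 \<phi> \<in> Cn n \<and> partial \<i> \<phi> \<in> Cn n}"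

definition test_functions :: "(complex \<Rightarrow> complex) set" where
  "test_functions = {\<phi>. (\<forall>n. \<phi> \<in> Cn n) \<and> compact (closure {x. \<phi> x \<noteq> 0})}"

text \<open>
  Distributions are functionals to be evaluated at test functions only; their values
  elsewhere are irrelevant. The functional \<open>distr_of f\<close> is meaningful for locally integrable \<open>f\<close>.
\<close>

type_synonym distribution = "(complex \<Rightarrow> complex) \<Rightarrow> complex"

definition distr_of :: "(complex \<Rightarrow> complex) \<Rightarrow> distribution" where
  "distr_of f = (\<lambda>\<phi>. \<integral>x. f x * \<phi> x \<partial>lebesgue)"

definition distr_partial :: "complex \<Rightarrow> distribution \<Rightarrow> distribution" where
  "distr_partial e T = (\<lambda>\<phi>. - T (partial e \<phi>))"

definition distr_del :: "distribution \<Rightarrow> distribution" where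
  "distr_del T = (\<lambda>\<phi>. (distr_partial 1 T \<phi> - \<i> * distr_partial \<i> T \<phi>) / 2)"

definition distr_delbar :: "distribution \<Rightarrow> distribution" where
  "distr_delbar T = (\<lambda>\<phi>. (distr_partial 1 T \<phi> + \<i> * distr_partial \<i> T \<phi>) / 2)"

definition W1 :: "real \<Rightarrow> (complex \<Rightarrow> complex) set" where
  "W1 s = {f \<in> Lp_space s. \<forall>e \<in> {1, \<i>}. \<exists>g \<in> Lp_space s.
     \<forall>\<phi> \<in> test_functions. distr_partial e (distr_of f) \<phi> = distr_of g \<phi>}"

text \<open>
  The equation \<open>\<partial>\<close>bar\<open>\<^sub>x (\<partial>\<^sub>x + i k) h = q h\<close> in the sense of distributions. Local integrability
  makes both sides meaningful; for \<open>q\<close> in \<open>L\<^sup>p\<close> and \<open>h\<close> (or \<open>h - 1\<close>) in \<open>W\<^sup>1\<^sup>,\<^sup>s\<close> with \<open>p \<ge> 1\<close>, \<open>s > 2\<close>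
  it is automatic, since \<open>h\<close> is then essentially bounded.
\<close>

definition solves_eq :: "(complex \<Rightarrow> complex) \<Rightarrow> complex \<Rightarrow> (complex \<Rightarrow> complex) \<Rightarrow> bool" where
  "solves_eq q k h \<longleftrightarrow> locally_integrable h \<and> locally_integrable (\<lambda>x. q x * h x) \<and>
     (\<forall>\<phi> \<in> test_functions.
        distr_delbar (\<lambda>\<psi>. distr_del (distr_of h) \<psi> + \<i> * k * distr_of h \<psi>) \<phi>
          = distr_of (\<lambda>x. q x * h x) \<phi>)"

definition exceptional_point :: "real \<Rightarrow> (complex \<Rightarrow> complex) \<Rightarrow> complex \<Rightarrow> bool" where
  "exceptional_point p q k \<longleftrightarrow> k \<noteq> 0 \<and>
     (\<exists>h \<in> W1 (sobolev_conj p). solves_eq q k h \<and> \<not> (AE x in lebesgue. h x = 0))"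

definition is_mu :: "real \<Rightarrow> (complex \<Rightarrow> complex) \<Rightarrow> complex \<Rightarrow> (complex \<Rightarrow> complex) \<Rightarrow> bool" where
  "is_mu p q k \<mu> \<longleftrightarrow> (\<lambda>x. \<mu> x - 1) \<in> W1 (sobolev_conj p) \<and> solves_eq q k \<mu>"

text \<open>
  For non-exceptional \<open>k\<close> the solution is unique as an element of a space of classes, i.e. up to
  equality almost everywhere, so \<open>SOME\<close> (and not \<open>THE\<close>) picks a representative of it.
\<close>

definition mu :: "real \<Rightarrow> (complex \<Rightarrow> complex) \<Rightarrow> complex \<Rightarrow> (complex \<Rightarrow> complex)" where
  "mu p q k = (SOME \<mu>. is_mu p q k \<mu>)"

definition e_osc :: "complex \<Rightarrow> complex \<Rightarrow> complex" where
  "e_osc k x = exp (\<i> * (k * x + cnj k * cnj x))"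

definition scattering_data :: "real \<Rightarrow> (complex \<Rightarrow> complex) \<Rightarrow> complex \<Rightarrow> complex" where
  "scattering_data p q k = (\<integral>x. e_osc k x * q x * mu p q k x \<partial>lebesgue)"

end

theory Submission
  imports Defs "HOL-Complex_Analysis.Complex_Analysis" "HOL-Real_Asymp.Real_Asymp"
begin

text \<open>
  The operator \<open>\<partial>\<close>bar\<open>(\<partial> + i k)\<close> has an explicit fundamental solution \<open>G\<^sub>k\<close> that decays at infinity
  (\<open>faddeev_green\<close>), and the conjugate of \<open>G\<^sub>-\<^sub>k(-z)\<close> is \<open>e\<^sub>k(z) G\<^sub>k(z)\<close>
  (\<open>faddeev_green_symmetry\<close>). The symmetry of the scattering data is this symmetry of the kernel:
  suppose that \<open>m\<close> and \<open>n\<close> are bounded and satisfy \<open>m = 1 + G\<^sub>k * (q m)\<close> and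
  \<open>n = 1 + G\<^sub>-\<^sub>k * (q n)\<close>, and let \<open>n'\<close> be the conjugate of \<open>n\<close>. As \<open>q\<close> is real,
  the identity for the kernels and Fubini's theorem turn
  \<open>\<integral> e\<^sub>k q n' (m - 1)\<close> into \<open>\<integral> e\<^sub>k q m (n' - 1)\<close>, so that \<open>\<integral> e\<^sub>k q m = \<integral> e\<^sub>k q n'\<close>
  (\<open>lippmann_schwinger_reciprocity\<close>).

  What remains is that the distributional solution \<open>\<mu>(\<cdot>, k)\<close> is such an \<open>m\<close>. For a bounded solution \<open>m\<close> of
  \<open>m = c + G\<^sub>k * (q m)\<close>, the function \<open>m - c\<close> lies in \<open>W\<^sup>1\<^sup>,\<^sup>s\<close> with \<open>s\<close> the Sobolev conjugate of \<open>p\<close>,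
  and \<open>m\<close> solves the differential equation (\<open>integral_equation_imp_solution\<close>): the first derivatives of
  \<open>G\<^sub>k\<close> are combinations of \<open>G\<^sub>k\<close>, \<open>1 / (\<pi> z)\<close> and \<open>e\<^sub>-\<^sub>k(z) / (\<pi> z\<close>bar\<open>)\<close>, all three are
  \<open>O(1 / |z|)\<close>, and convolution with \<open>1 / |z|\<close> maps \<open>L\<^sup>p\<close> to \<open>L\<^sup>s\<close> by the Hardy-Littlewood-Sobolev
  inequality; the equation itself follows from the Cauchy-Pompeiu formula. With \<open>c = 0\<close> this shows that,
  for non-exceptional \<open>k\<close>, the homogeneous integral equation has only the zero solution. Since
  \<open>v \<mapsto> G\<^sub>k * (q v)\<close> is compact on the bounded continuous functions, the Fredholm alternative yields a
  solution \<open>m\<close> for \<open>c = 1\<close>. Then \<open>m\<close> is one of the functions that define \<open>\<mu>(\<cdot>, k)\<close>, and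
  any two of these agree almost everywhere because \<open>k\<close> is not exceptional.
\<close>

section \<open>Integrals of powers of the modulus in the plane\<close>

lemma nn_integral_lborel_shift:
  fixes h :: "complex \<Rightarrow> ennreal"
  assumes [measurable]: "h \<in> borel_measurable borel"
  shows "(\<integral>\<^sup>+x. h (x - y) \<partial>lborel) = (\<integral>\<^sup>+z. h z \<partial>lborel)"
proof -
  have "(\<integral>\<^sup>+z. h z \<partial>lborel) = (\<integral>\<^sup>+z. h z \<partial>(distr lborel borel ((+) (- y))))"
    by (simp add: lborel_distr_plus)
  also have "\<dots> = (\<integral>\<^sup>+x. h (x - y) \<partial>lborel)"
    by (subst nn_integral_distr) (auto simp: o_def)
  finally show ?thesis ..
qed

text \<open>
  With \<open>c = |z|\<close> and Fubini's theorem this reduces integrals of powers of \<open>|z|\<close> to areas of discs.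
\<close>

lemma powr_eq_nn_integral_tail:
  fixes a c :: real
  assumes "a > 0" "c > 0"
  shows "ennreal (c powr - a) = (\<integral>\<^sup>+r. ennreal (a * r powr (- a - 1)) * indicator {c..} r \<partial>lborel)"
proof -
  have "((\<lambda>r. r powr (- a - 1)) has_integral - (c powr (- a - 1 + 1)) / (- a - 1 + 1)) {c..}"
    using assms by (intro has_integral_powr_to_inf) auto
  then have "((\<lambda>r. a * r powr (- a - 1)) has_integral a * (- (c powr (- a - 1 + 1)) / (- a - 1 + 1))) {c..}"
    by (rule has_integral_mult_right)
  then have "integral\<^sup>N lborel (\<lambda>r. indicator {c..} r * (a * r powr (- a - 1)))
      = ennreal (a * (- (c powr (- a - 1 + 1)) / (- a - 1 + 1)))"
    using assms by (intro nn_integral_has_integral_lebesgue) auto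
  also have "a * (- (c powr (- a - 1 + 1)) / (- a - 1 + 1)) = c powr - a"
    using assms by simp
  finally show ?thesis
    by (simp add: ennreal_mult' ennreal_indicator mult.commute)
qed

lemma nn_integral_powr_from_0:
  fixes a c :: real
  assumes "a > -1" "c \<ge> 0"
  shows "(\<integral>\<^sup>+r. ennreal (r powr a) * indicator {0..c} r \<partial>lborel) = ennreal (c powr (a + 1) / (a + 1))"
proof -
  have "integral\<^sup>N lborel (\<lambda>r. indicator {0..c} r * (r powr a)) = ennreal (c powr (a + 1) / (a + 1))"
    using has_integral_powr_from_0[OF assms] by (intro nn_integral_has_integral_lebesgue) auto
  then show ?thesis
    by (simp add: ennreal_mult' ennreal_indicator mult.commute)
qed

lemma nn_integral_norm_powr_layers:
  fixes A :: "complex set"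
  assumes [measurable]: "A \<in> sets borel" and "a > 0"
  shows "(\<integral>\<^sup>+z. ennreal (norm z powr - a) * indicator A z \<partial>lborel)
    = (\<integral>\<^sup>+r. ennreal (a * r powr (- a - 1)) * emeasure lborel (A \<inter> cball 0 r) * indicator {0..} r \<partial>lborel)"
proof -
  let ?k = "\<lambda>r::real. ennreal (a * r powr (- a - 1))"
  have "(\<integral>\<^sup>+z. ennreal (norm z powr - a) * indicator A z \<partial>lborel)
    = (\<integral>\<^sup>+z. (\<integral>\<^sup>+r. ?k r * indicator {norm z..} r * indicator A z \<partial>lborel) \<partial>lborel)"
  proof (rule nn_integral_cong_AE)
    have "AE z in lborel. z \<noteq> (0::complex)"
      by (rule AE_lborel_singleton)
    then show "AE z in lborel. ennreal (norm (z::complex) powr - a) * indicator A z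
        = (\<integral>\<^sup>+r. ?k r * indicator {norm z..} r * indicator A z \<partial>lborel)"
    proof eventually_elim
      case (elim z)
      then show ?case
        using assms(2) by (subst powr_eq_nn_integral_tail) (auto simp: nn_integral_multc)
    qed
  qed
  also have "\<dots> = (\<integral>\<^sup>+r. (\<integral>\<^sup>+z. ?k r * indicator {norm z..} r * indicator A z \<partial>lborel) \<partial>lborel)"
    by (rule lborel_pair.Fubini') (simp add: indicator_def case_prod_unfold, measurable)
  also have "\<dots> = (\<integral>\<^sup>+r. ?k r * emeasure lborel (A \<inter> cball 0 r) * indicator {0..} r \<partial>lborel)"
  proof (rule nn_integral_cong)
    fix r :: real
    have "(\<integral>\<^sup>+z. ?k r * indicator {norm z..} r * indicator A z \<partial>lborel)
       = (\<integral>\<^sup>+z. ?k r * indicator (A \<inter> cball 0 r) z \<partial>lborel)"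
      by (intro nn_integral_cong) (auto simp: indicator_def)
    also have "\<dots> = ?k r * emeasure lborel (A \<inter> cball 0 r)"
      by (subst nn_integral_cmult) (auto intro!: borel_measurable_indicator)
    also have "\<dots> = ?k r * emeasure lborel (A \<inter> cball 0 r) * indicator {0..} r"
      by (cases "r < 0") (auto simp: indicator_def)
    finally show "(\<integral>\<^sup>+z. ?k r * indicator {norm z..} r * indicator A z \<partial>lborel) = \<dots>" .
  qed
  finally show ?thesis .
qed

lemma emeasure_cball_complex: "r \<ge> 0 \<Longrightarrow> emeasure lborel (cball (0::complex) r) = ennreal (pi * r\<^sup>2)"
  using emeasure_cball[of r "0::complex"] by (simp add: unit_ball_vol_2)

lemma nn_integral_norm_powr_near:
  fixes a R :: real
  assumes "0 < a" "a < 2" "R > 0"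
  shows "(\<integral>\<^sup>+z. ennreal (norm z powr - a) * indicator (ball (0::complex) R) z \<partial>lborel)
    \<le> ennreal (2 * pi / (2 - a) * R powr (2 - a))"
proof -
  have "(\<integral>\<^sup>+z. ennreal (norm z powr - a) * indicator (ball (0::complex) R) z \<partial>lborel)
    = (\<integral>\<^sup>+r. ennreal (a * r powr (- a - 1)) * emeasure lborel (ball 0 R \<inter> cball (0::complex) r) * indicator {0..} r \<partial>lborel)"
    using assms by (intro nn_integral_norm_powr_layers) auto
  also have "\<dots> \<le> (\<integral>\<^sup>+r. ennreal (a * pi) * (ennreal (r powr (1 - a)) * indicator {0..R} r)
      + ennreal (pi * R\<^sup>2) * (ennreal (a * r powr (- a - 1)) * indicator {R..} r) \<partial>lborel)"
  proof (rule nn_integral_mono)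
    fix r :: real
    consider "r \<le> 0" | "0 < r" "r \<le> R" | "R < r" by linarith
    then show "ennreal (a * r powr (- a - 1)) * emeasure lborel (ball 0 R \<inter> cball (0::complex) r) * indicator {0..} r
      \<le> ennreal (a * pi) * (ennreal (r powr (1 - a)) * indicator {0..R} r)
        + ennreal (pi * R\<^sup>2) * (ennreal (a * r powr (- a - 1)) * indicator {R..} r)"
    proof cases
      case 1
      then show ?thesis by (cases "r = 0") auto
    next
      case 2
      have "emeasure lborel (ball 0 R \<inter> cball (0::complex) r) \<le> ennreal (pi * r\<^sup>2)"
        using 2 by (subst emeasure_cball_complex[symmetric]) (auto intro!: emeasure_mono)
      then have "ennreal (a * r powr (- a - 1)) * emeasure lborel (ball 0 R \<inter> cball (0::complex) r)
          \<le> ennreal (a * r powr (- a - 1)) * ennreal (pi * r\<^sup>2)"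
        by (rule mult_left_mono) simp
      also have "\<dots> = ennreal (a * pi) * ennreal (r powr (1 - a))"
      proof -
        have "r powr (- a - 1) * r\<^sup>2 = r powr (- a - 1) * r powr 2"
          using 2 by (simp add: powr_numeral)
        also have "\<dots> = r powr (1 - a)"
          by (simp flip: powr_add)
        finally have "a * r powr (- a - 1) * (pi * r\<^sup>2) = a * pi * r powr (1 - a)"
          by (simp add: algebra_simps)
        then show ?thesis
          using 2 assms by (simp flip: ennreal_mult)
      qed
      finally show ?thesis
        using 2 by (simp add: indicator_def add_increasing2)
    next
      case 3
      have "emeasure lborel (ball 0 R \<inter> cball (0::complex) r) \<le> ennreal (pi * R\<^sup>2)"
        using 3 assms by (subst emeasure_cball_complex[symmetric]) (auto intro!: emeasure_mono)
      then show ?thesis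
        using 3 assms mult_left_mono[of "emeasure lborel (ball 0 R \<inter> cball (0::complex) r)" "ennreal (pi * R\<^sup>2)" "ennreal (a * r powr (- a - 1))"]
        by (simp add: indicator_def mult.commute[of "ennreal (pi * R\<^sup>2)"])
    qed
  qed
  also have "\<dots> = ennreal (a * pi) * ennreal (R powr (2 - a) / (2 - a)) + ennreal (pi * R\<^sup>2) * ennreal (R powr - a)"
    using assms nn_integral_powr_from_0[of "1 - a" R] powr_eq_nn_integral_tail[of a R]
    by (simp add: nn_integral_add nn_integral_cmult)
  also have "\<dots> = ennreal (2 * pi / (2 - a) * R powr (2 - a))"
  proof -
    have "R\<^sup>2 * R powr - a = R powr 2 * R powr - a"
      using assms by (simp add: powr_numeral)
    also have "\<dots> = R powr (2 - a)"
      by (simp flip: powr_add)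
    finally have "a * pi * (R powr (2 - a) / (2 - a)) + pi * R\<^sup>2 * R powr - a = 2 * pi / (2 - a) * R powr (2 - a)"
      using assms by (simp add: divide_simps) (simp add: algebra_simps)
    then show ?thesis
      using assms by (simp flip: ennreal_mult ennreal_plus)
  qed
  finally show ?thesis .
qed

lemma nn_integral_norm_powr_far:
  fixes a R :: real
  assumes "a > 2" "R > 0"
  shows "(\<integral>\<^sup>+z. ennreal (norm z powr - a) * indicator (- ball (0::complex) R) z \<partial>lborel)
    \<le> ennreal (a * pi / (a - 2) * R powr (2 - a))"
proof -
  have "(\<integral>\<^sup>+z. ennreal (norm z powr - a) * indicator (- ball (0::complex) R) z \<partial>lborel)
    = (\<integral>\<^sup>+r. ennreal (a * r powr (- a - 1)) * emeasure lborel (- ball 0 R \<inter> cball (0::complex) r) * indicator {0..} r \<partial>lborel)"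
    using assms by (intro nn_integral_norm_powr_layers) auto
  also have "\<dots> \<le> (\<integral>\<^sup>+r. ennreal (a * pi / (a - 2)) * (ennreal ((a - 2) * r powr (- (a - 2) - 1)) * indicator {R..} r) \<partial>lborel)"
  proof (rule nn_integral_mono)
    fix r :: real
    show "ennreal (a * r powr (- a - 1)) * emeasure lborel (- ball 0 R \<inter> cball (0::complex) r) * indicator {0..} r
      \<le> ennreal (a * pi / (a - 2)) * (ennreal ((a - 2) * r powr (- (a - 2) - 1)) * indicator {R..} r)"
    proof (cases "r < R")
      case True
      then have "- ball 0 R \<inter> cball (0::complex) r = {}" by auto
      then show ?thesis by simp
    next
      case False
      then have "emeasure lborel (- ball 0 R \<inter> cball (0::complex) r) \<le> ennreal (pi * r\<^sup>2)"
        using assms by (subst emeasure_cball_complex[symmetric]) (auto intro!: emeasure_mono)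
      then have "ennreal (a * r powr (- a - 1)) * emeasure lborel (- ball 0 R \<inter> cball (0::complex) r)
          \<le> ennreal (a * r powr (- a - 1)) * ennreal (pi * r\<^sup>2)"
        by (rule mult_left_mono) simp
      also have "\<dots> = ennreal (a * pi / (a - 2)) * ennreal ((a - 2) * r powr (- (a - 2) - 1))"
      proof -
        have "r powr (- a - 1) * r\<^sup>2 = r powr (- a - 1) * r powr 2"
          using False assms by (simp add: powr_numeral)
        also have "\<dots> = r powr (- (a - 2) - 1)"
          by (simp flip: powr_add)
        finally have "a * pi * (r powr (- a - 1) * r\<^sup>2) = a * pi * r powr (- (a - 2) - 1)"
          by (rule arg_cong)
        then have "a * r powr (- a - 1) * (pi * r\<^sup>2) = a * pi / (a - 2) * ((a - 2) * r powr (- (a - 2) - 1))"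
          using assms by (simp add: mult_ac)
        then show ?thesis
          using False assms by (simp flip: ennreal_mult)
      qed
      finally show ?thesis
        using False assms by (simp add: indicator_def)
    qed
  qed
  also have "\<dots> = ennreal (a * pi / (a - 2)) * ennreal (R powr - (a - 2))"
    using assms powr_eq_nn_integral_tail[of "a - 2" R] by (simp add: nn_integral_cmult)
  also have "\<dots> = ennreal (a * pi / (a - 2) * R powr (2 - a))"
    using assms by (simp flip: ennreal_mult)
  finally show ?thesis .
qed

lemma nn_integral_norm_shift_near:
  fixes a R :: real and y :: complex
  assumes "0 < a" "a < 2" "R > 0"
  shows "(\<integral>\<^sup>+x. ennreal (norm (x - y) powr - a) * indicator (ball y R) x \<partial>lborel)
    \<le> ennreal (2 * pi / (2 - a) * R powr (2 - a))"
proof -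
  have "(\<integral>\<^sup>+x. ennreal (norm (x - y) powr - a) * indicator (ball y R) x \<partial>lborel)
     = (\<integral>\<^sup>+x. ennreal (norm (x - y) powr - a) * indicator (ball 0 R) (x - y) \<partial>lborel)"
    by (intro nn_integral_cong) (auto simp: indicator_def dist_norm norm_minus_commute)
  also have "\<dots> = (\<integral>\<^sup>+z. ennreal (norm z powr - a) * indicator (ball (0::complex) R) z \<partial>lborel)"
    by (rule nn_integral_lborel_shift) (intro borel_measurable_times_ennreal borel_measurable_indicator, auto)
  finally show ?thesis
    using nn_integral_norm_powr_near[OF assms] by simp
qed

lemma nn_integral_norm_shift_far:
  fixes a R :: real and y :: complex
  assumes "a > 2" "R > 0"
  shows "(\<integral>\<^sup>+x. ennreal (norm (x - y) powr - a) * indicator (- ball y R) x \<partial>lborel)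
    \<le> ennreal (a * pi / (a - 2) * R powr (2 - a))"
proof -
  have "(\<integral>\<^sup>+x. ennreal (norm (x - y) powr - a) * indicator (- ball y R) x \<partial>lborel)
     = (\<integral>\<^sup>+x. ennreal (norm (x - y) powr - a) * indicator (- ball 0 R) (x - y) \<partial>lborel)"
    by (intro nn_integral_cong) (auto simp: indicator_def dist_norm norm_minus_commute)
  also have "\<dots> = (\<integral>\<^sup>+z. ennreal (norm z powr - a) * indicator (- ball (0::complex) R) z \<partial>lborel)"
    by (rule nn_integral_lborel_shift) (intro borel_measurable_times_ennreal borel_measurable_indicator, auto)
  finally show ?thesis
    using nn_integral_norm_powr_far[OF assms] by simp
qed

section \<open>The Hardy-Littlewood-Sobolev inequality\<close>

text \<open>
  Convolution with \<open>1 / |z|\<close> maps \<open>L\<^sup>p\<close> to \<open>L\<^sup>q\<close>. The proof bounds the distribution function of \<open>g\<close>.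
  At the level \<open>t\<close> the kernel is cut at a radius \<open>R t\<close> and the density at a height \<open>s t\<close>. The radius is such
  that the part of the kernel outside the disc contributes at most \<open>t / 4\<close>, by Young's inequality; the height
  is such that the values of \<open>f\<close> below it contribute at most \<open>t / 4\<close> inside the disc. So where
  \<open>g \<ge> t\<close>, the values of \<open>f\<close> above \<open>s t\<close>, seen through the integrable kernel on the disc, contribute at
  least \<open>t / 2\<close>, and Markov's inequality bounds the measure of that set. Integrated in \<open>t\<close>
  with the weight \<open>q t\<^sup>q\<^sup>-\<^sup>1\<close>, the powers combine to exactly \<open>f\<^sup>p\<close>.
\<close>

theorem hardy_littlewood_sobolev_plane:
  fixes f g :: "complex \<Rightarrow> real" and p q :: real
  assumes [measurable]: "f \<in> borel_measurable borel" "g \<in> borel_measurable borel"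
    and f0: "\<And>x. f x \<ge> 0" and g0: "\<And>x. g x \<ge> 0"
    and p: "1 < p" "p < 2" and q: "1 / q = 1 / p - 1 / 2"
    and fin: "(\<integral>\<^sup>+x. ennreal (f x powr p) \<partial>lborel) < \<infinity>"
    and le: "\<And>x. ennreal (g x) \<le> (\<integral>\<^sup>+y. ennreal (f y / norm (x - y)) \<partial>lborel)"
  shows "(\<integral>\<^sup>+x. ennreal (g x powr q) \<partial>lborel) < \<infinity>"
proof -
  have q2: "q > 2"
  proof -
    have "1 / q < 1 / 2" "1 / q > 0"
      using p by (auto simp: q field_simps)
    then show ?thesis
      by (simp add: field_simps split: if_splits)
  qed
  have p_eq: "p = 2 * q / (q + 2)"
    using q p q2 by (simp add: field_simps)
  define p' where "p' = p / (p - 1)"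
  have p'2: "p' > 2"
    using p by (simp add: p'_def field_simps)
  have conj: "1 / p + 1 / p' = 1"
    using p by (simp add: p'_def field_simps)
  obtain N where N: "N \<ge> 0" "(\<integral>\<^sup>+x. ennreal (f x powr p) \<partial>lborel) = ennreal N"
    using fin by (metis ennreal_cases infinity_ennreal_def less_irrefl)
  have exponent: "(2 - p') / p' = - 2 / q"
  proof -
    have "(2 - p') / p' = 2 * (1 / p') - 1"
      using p'2 by (simp add: field_simps)
    also have "1 / p' = 1 - 1 / p"
      using conj by simp
    also have "2 * (1 - 1 / p) - 1 = - 2 * (1 / q)"
      unfolding q by simp
    finally show ?thesis
      by simp
  qed
  define A where "A = N + p' * pi / (p' - 2) + 1"
  have A: "A > 0"
    using N p'2 by (simp add: A_def add_nonneg_pos)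

  have far: "(\<integral>\<^sup>+y. ennreal (f y / norm (x - y)) * indicator (- ball x R) y \<partial>lborel)
      \<le> ennreal (A * R powr (- 2 / q))" if R: "R > 0" for x R
  proof -
    \<comment> \<open>the parameter that balances the two terms of Young's inequality\<close>
    define l where "l = R powr ((2 - p') / (p * p'))"
    have l: "l > 0"
      using R by (simp add: l_def)
    have e1: "l powr p = R powr (- 2 / q)"
    proof -
      have "(2 - p') / (p * p') * p = - 2 / q"
        unfolding exponent[symmetric] using p by simp
      then show ?thesis
        by (simp add: l_def powr_powr)
    qed
    have e2: "l powr - p' * R powr (2 - p') = R powr (- 2 / q)"
    proof -
      have "(2 - p') / (p * p') * (- p') + (2 - p') = (2 - p') * (1 - 1 / p)"
        using p p'2 by (simp add: field_simps)
      also have "1 - 1 / p = 1 / p'"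
        using conj by simp
      also have "(2 - p') * (1 / p') = - 2 / q"
        unfolding exponent[symmetric] by simp
      finally show ?thesis
        by (simp add: l_def powr_powr flip: powr_add)
    qed
    have pt: "ennreal (f y / norm (x - y)) * indicator (- ball x R) y
        \<le> ennreal (l powr p) * ennreal (f y powr p)
          + ennreal (l powr - p') * (ennreal (norm (y - x) powr - p') * indicator (- ball x R) y)" for y
    proof (cases "y \<in> ball x R")
      case False
      then have y: "norm (y - x) > 0"
        using R by (auto simp: dist_norm norm_minus_commute)
      have "(l * f y) * (1 / (l * norm (y - x)))
          \<le> (l * f y) powr p / p + (1 / (l * norm (y - x))) powr p' / p'"
        using p p'2 conj l f0 y by (intro Youngs_inequality) auto
      also have "\<dots> \<le> (l * f y) powr p / 1 + (1 / (l * norm (y - x))) powr p' / 1"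
        using p p'2 by (intro add_mono divide_left_mono) auto
      also have "\<dots> = l powr p * f y powr p + l powr - p' * norm (y - x) powr - p'"
        using l f0 y by (simp add: powr_mult powr_divide powr_minus_divide)
      finally show ?thesis
        using False l by (simp add: norm_minus_commute flip: ennreal_mult ennreal_plus)
    qed (auto)
    have "(\<integral>\<^sup>+y. ennreal (f y / norm (x - y)) * indicator (- ball x R) y \<partial>lborel)
        \<le> (\<integral>\<^sup>+y. ennreal (l powr p) * ennreal (f y powr p)
          + ennreal (l powr - p') * (ennreal (norm (y - x) powr - p') * indicator (- ball x R) y) \<partial>lborel)"
      by (rule nn_integral_mono) (rule pt)
    also have "\<dots> = ennreal (l powr p) * ennreal N
        + ennreal (l powr - p') * (\<integral>\<^sup>+y. ennreal (norm (y - x) powr - p') * indicator (- ball x R) y \<partial>lborel)"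
      by (subst nn_integral_add) (auto simp: nn_integral_cmult N intro!: borel_measurable_times_ennreal borel_measurable_indicator)
    also have "\<dots> \<le> ennreal (l powr p) * ennreal N
        + ennreal (l powr - p') * ennreal (p' * pi / (p' - 2) * R powr (2 - p'))"
      using p'2 R by (intro add_left_mono mult_left_mono nn_integral_norm_shift_far) auto
    also have "\<dots> = ennreal (l powr p * N + p' * pi / (p' - 2) * (l powr - p' * R powr (2 - p')))"
      using N p'2 by (simp add: mult_ac flip: ennreal_mult ennreal_plus)
    also have "\<dots> \<le> ennreal (A * R powr (- 2 / q))"
      unfolding e1 e2 by (intro ennreal_leI) (simp add: A_def algebra_simps)
    finally show ?thesis .
  qed

  \<comment> \<open>\<open>R\<close> solves \<open>A R\<^sup>-\<^sup>2\<^sup>/\<^sup>q = t / 4\<close>, and \<open>s\<close> solves \<open>2 \<pi> R s = t / 4\<close>\<close>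
  define R where "R t = (4 * A / t) powr (q / 2)" for t
  define s where "s t = t / (8 * pi * R t)" for t
  have Rpos: "R t > 0" if "t > 0" for t
    using that A by (simp add: R_def)
  have far_t: "A * R t powr (- 2 / q) = t / 4" if "t > 0" for t
    using that A q2 by (simp add: R_def powr_powr powr_minus_divide)

  have level: "ennreal (t / 2) \<le> (\<integral>\<^sup>+y. ennreal (f y * indicator {s t<..} (f y)) * ennreal (norm (x - y) powr -1) * indicator (ball x (R t)) y \<partial>lborel)"
    (is "_ \<le> ?J") if t: "t > 0" "t \<le> g x" for t x
  proof -
    have "(\<integral>\<^sup>+y. ennreal (s t) * (ennreal (norm (y - x) powr -1) * indicator (ball x (R t)) y) \<partial>lborel)
       \<le> ennreal (s t) * ennreal (2 * pi / (2 - 1) * R t powr (2 - 1))"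
    proof (subst nn_integral_cmult)
      show "ennreal (s t) * (\<integral>\<^sup>+y. ennreal (norm (y - x) powr -1) * indicator (ball x (R t)) y \<partial>lborel)
          \<le> ennreal (s t) * ennreal (2 * pi / (2 - 1) * R t powr (2 - 1))"
        using Rpos[OF t(1)] by (intro mult_left_mono nn_integral_norm_shift_near) auto
    qed (auto intro!: borel_measurable_times_ennreal borel_measurable_indicator)
    also have "\<dots> = ennreal (t / 4)"
      using Rpos[OF t(1)] t by (simp add: s_def flip: ennreal_mult)
    finally have small: "(\<integral>\<^sup>+y. ennreal (s t) * (ennreal (norm (y - x) powr -1) * indicator (ball x (R t)) y) \<partial>lborel) \<le> ennreal (t / 4)" .
    have m1: "(\<lambda>y. ennreal (f y / norm (x - y)) * indicator (- ball x (R t)) y) \<in> borel_measurable lborel"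
      by (intro borel_measurable_times_ennreal borel_measurable_indicator) auto
    have m2: "(\<lambda>y. ennreal (s t) * (ennreal (norm (y - x) powr -1) * indicator (ball x (R t)) y)) \<in> borel_measurable lborel"
      by (intro borel_measurable_times_ennreal borel_measurable_indicator) auto
    have m3: "(\<lambda>y. ennreal (f y * indicator {s t<..} (f y)) * ennreal (norm (x - y) powr -1) * indicator (ball x (R t)) y) \<in> borel_measurable lborel"
      by (intro borel_measurable_times_ennreal borel_measurable_indicator) auto
    have "ennreal t \<le> ennreal (g x)"
      using t by (intro ennreal_leI)
    also have "\<dots> \<le> (\<integral>\<^sup>+y. ennreal (f y / norm (x - y)) \<partial>lborel)"
      by (rule le)
    also have "\<dots> \<le> (\<integral>\<^sup>+y. ennreal (f y / norm (x - y)) * indicator (- ball x (R t)) y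
        + (ennreal (s t) * (ennreal (norm (y - x) powr -1) * indicator (ball x (R t)) y)
        + ennreal (f y * indicator {s t<..} (f y)) * ennreal (norm (x - y) powr -1) * indicator (ball x (R t)) y) \<partial>lborel)"
    proof (rule nn_integral_mono)
      fix y :: complex
      have "ennreal (f y / norm (x - y)) \<le> ennreal (s t) * ennreal (norm (y - x) powr -1)" if "f y \<le> s t"
        using that f0[of y] by (simp add: norm_minus_commute powr_minus_divide divide_right_mono flip: ennreal_mult'' )
      moreover have "ennreal (f y / norm (x - y)) = ennreal (f y) * ennreal (norm (x - y) powr -1)"
        using f0[of y] by (simp add: powr_minus_divide flip: ennreal_mult)
      ultimately show "ennreal (f y / norm (x - y)) \<le> ennreal (f y / norm (x - y)) * indicator (- ball x (R t)) y
        + (ennreal (s t) * (ennreal (norm (y - x) powr -1) * indicator (ball x (R t)) y)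
        + ennreal (f y * indicator {s t<..} (f y)) * ennreal (norm (x - y) powr -1) * indicator (ball x (R t)) y)"
        by (cases "y \<in> ball x (R t)"; cases "f y \<le> s t") (auto simp: add_increasing)
    qed
    also have "\<dots> = (\<integral>\<^sup>+y. ennreal (f y / norm (x - y)) * indicator (- ball x (R t)) y \<partial>lborel)
        + ((\<integral>\<^sup>+y. ennreal (s t) * (ennreal (norm (y - x) powr -1) * indicator (ball x (R t)) y) \<partial>lborel) + ?J)"
      by (subst nn_integral_add[OF m1 borel_measurable_add[OF m2 m3]], subst nn_integral_add[OF m2 m3]) (rule refl)
    also have "\<dots> \<le> ennreal (t / 4) + (ennreal (t / 4) + ?J)"
      using far[OF Rpos[OF t(1)], of x] small unfolding far_t[OF t(1)] by (intro add_mono order_refl) auto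
    also have "\<dots> = ennreal (t / 2) + ?J"
      using t by (simp add: add.assoc[symmetric] flip: ennreal_plus)
    finally have "ennreal (t / 2) + ennreal (t / 2) \<le> ennreal (t / 2) + ?J"
      using t by (simp flip: ennreal_plus)
    then show ?thesis
      by (simp add: ennreal_add_left_cancel_le)
  qed

  have dist_fun: "ennreal (t / 2) * emeasure lborel {x. t \<le> g x}
      \<le> ennreal (2 * pi * R t) * (\<integral>\<^sup>+y. ennreal (f y * indicator {s t<..} (f y)) \<partial>lborel)" if t: "t > 0" for t
  proof -
    have "ennreal (t / 2) * emeasure lborel {x. t \<le> g x} = (\<integral>\<^sup>+x. ennreal (t / 2) * indicator {x. t \<le> g x} x \<partial>lborel)"
      by (simp add: nn_integral_cmult_indicator)
    also have "\<dots> \<le> (\<integral>\<^sup>+x. (\<integral>\<^sup>+y. ennreal (f y * indicator {s t<..} (f y)) * (ennreal (norm (x - y) powr -1) * indicator (ball y (R t)) x) \<partial>lborel) \<partial>lborel)"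
    proof (rule nn_integral_mono)
      fix x :: complex
      have "(\<integral>\<^sup>+y. ennreal (f y * indicator {s t<..} (f y)) * ennreal (norm (x - y) powr -1) * indicator (ball x (R t)) y \<partial>lborel)
        = (\<integral>\<^sup>+y. ennreal (f y * indicator {s t<..} (f y)) * (ennreal (norm (x - y) powr -1) * indicator (ball y (R t)) x) \<partial>lborel)"
        by (intro nn_integral_cong) (auto simp: indicator_def dist_commute)
      then show "ennreal (t / 2) * indicator {x. t \<le> g x} x \<le> (\<integral>\<^sup>+y. ennreal (f y * indicator {s t<..} (f y)) * (ennreal (norm (x - y) powr -1) * indicator (ball y (R t)) x) \<partial>lborel)"
        using level[OF t, of x] by (auto simp: indicator_def)
    qed
    also have "\<dots> = (\<integral>\<^sup>+y. (\<integral>\<^sup>+x. ennreal (f y * indicator {s t<..} (f y)) * (ennreal (norm (x - y) powr -1) * indicator (ball y (R t)) x) \<partial>lborel) \<partial>lborel)"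
      by (rule lborel_pair.Fubini') (simp add: indicator_def case_prod_unfold, measurable)
    also have "\<dots> \<le> (\<integral>\<^sup>+y. ennreal (f y * indicator {s t<..} (f y)) * ennreal (2 * pi * R t) \<partial>lborel)"
    proof (rule nn_integral_mono)
      fix y :: complex
      have "(\<integral>\<^sup>+x. ennreal (norm (x - y) powr -1) * indicator (ball y (R t)) x \<partial>lborel) \<le> ennreal (2 * pi * R t)"
        using nn_integral_norm_shift_near[of 1 "R t" y] Rpos[OF t] by simp
      then show "(\<integral>\<^sup>+x. ennreal (f y * indicator {s t<..} (f y)) * (ennreal (norm (x - y) powr -1) * indicator (ball y (R t)) x) \<partial>lborel) \<le> ennreal (f y * indicator {s t<..} (f y)) * ennreal (2 * pi * R t)"
        by (subst nn_integral_cmult) (auto intro!: mult_left_mono borel_measurable_times_ennreal borel_measurable_indicator)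
    qed
    also have "\<dots> = ennreal (2 * pi * R t) * (\<integral>\<^sup>+y. ennreal (f y * indicator {s t<..} (f y)) \<partial>lborel)"
      by (subst nn_integral_multc) (auto simp: mult.commute)
    finally show ?thesis .
  qed

  define B where "B = (4 * A) powr (q / 2)"
  have B: "B > 0" using A by (simp add: B_def)
  have R_B: "R t = B * t powr - (q / 2)" if "t > 0" for t
    using that A by (simp add: R_def B_def powr_divide powr_minus_divide)
  \<comment> \<open>the values \<open>v\<close> that exceed the height \<open>s t\<close> are those with \<open>t\<close> below \<open>\<tau> v\<close>\<close>
  define \<tau> where "\<tau> v = (8 * pi * B * v) powr (1 / (1 + q / 2))" for v
  have s_less: "t \<le> \<tau> v" if "t > 0" "s t < v" "v > 0" for t v
  proof -
    have "s t = t * t powr (q / 2) / (8 * pi * B)"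
      using that B by (simp add: s_def R_B powr_minus_divide)
    also have "t * t powr (q / 2) = t powr (1 + q / 2)"
      using that by (simp add: powr_add)
    finally have "t powr (1 + q / 2) = 8 * pi * B * s t"
      using B by simp
    also have "\<dots> \<le> 8 * pi * B * v"
      using that B by (intro mult_left_mono) auto
    finally have "(t powr (1 + q / 2)) powr (1 / (1 + q / 2)) \<le> \<tau> v"
      unfolding \<tau>_def using q2 by (intro powr_mono2) auto
    then show ?thesis
      using that q2 by (simp add: powr_powr)
  qed
  define D where "D = 4 * pi * B * q"
  define C where "C = D * (8 * pi * B) powr ((q / 2 - 1) / (1 + q / 2)) / (q / 2 - 1)"

  have "(\<integral>\<^sup>+x. ennreal (g x powr q) \<partial>lborel)
     = (\<integral>\<^sup>+x. (\<integral>\<^sup>+t. ennreal (q * t powr (q - 1)) * indicator {0..g x} t \<partial>lborel) \<partial>lborel)"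
  proof (rule nn_integral_cong)
    fix x :: complex
    have "(\<integral>\<^sup>+t. ennreal (q * t powr (q - 1)) * indicator {0..g x} t \<partial>lborel)
       = (\<integral>\<^sup>+t. ennreal q * (ennreal (t powr (q - 1)) * indicator {0..g x} t) \<partial>lborel)"
      using q2 by (intro nn_integral_cong) (auto simp: ennreal_mult' mult_ac)
    also have "\<dots> = ennreal q * ennreal (g x powr q / q)"
      using nn_integral_powr_from_0[of "q - 1" "g x"] q2 g0 by (simp add: nn_integral_cmult)
    also have "\<dots> = ennreal (g x powr q)"
      using q2 by (simp flip: ennreal_mult)
    finally show "ennreal (g x powr q) = (\<integral>\<^sup>+t. ennreal (q * t powr (q - 1)) * indicator {0..g x} t \<partial>lborel)" ..
  qed
  also have "\<dots> = (\<integral>\<^sup>+t. (\<integral>\<^sup>+x. ennreal (q * t powr (q - 1)) * indicator {0..g x} t \<partial>lborel) \<partial>lborel)"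
    by (rule lborel_pair.Fubini') (simp add: indicator_def case_prod_unfold, measurable)
  also have "\<dots> \<le> (\<integral>\<^sup>+t. (\<integral>\<^sup>+y. ennreal (f y) * (ennreal D * (ennreal (t powr (q / 2 - 2)) * indicator {0..\<tau> (f y)} t)) \<partial>lborel) \<partial>lborel)"
  proof (rule nn_integral_mono)
    fix t :: real
    show "(\<integral>\<^sup>+x. ennreal (q * t powr (q - 1)) * indicator {0..g x} t \<partial>lborel)
      \<le> (\<integral>\<^sup>+y. ennreal (f y) * (ennreal D * (ennreal (t powr (q / 2 - 2)) * indicator {0..\<tau> (f y)} t)) \<partial>lborel)"
    proof (cases "t > 0")
      case False
      then have "(\<integral>\<^sup>+x. ennreal (q * t powr (q - 1)) * indicator {0..g x} t \<partial>lborel) = (\<integral>\<^sup>+x. 0 \<partial>(lborel :: complex measure))"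
        by (intro nn_integral_cong) (cases "t = 0", auto)
      then show ?thesis by simp
    next
      case True
      have "(\<integral>\<^sup>+x. ennreal (q * t powr (q - 1)) * indicator {0..g x} t \<partial>lborel)
          = (\<integral>\<^sup>+x. ennreal (q * t powr (q - 1)) * indicator {x. t \<le> g x} x \<partial>lborel)"
        using True by (intro nn_integral_cong) (auto simp: indicator_def)
      also have "\<dots> = ennreal (q * t powr (q - 1)) * emeasure lborel {x. t \<le> g x}"
        by (simp add: nn_integral_cmult_indicator)
      also have "\<dots> = ennreal (2 * q * t powr (q - 2)) * (ennreal (t / 2) * emeasure lborel {x. t \<le> g x})"
      proof -
        have "q * t powr (q - 1) = 2 * q * t powr (q - 2) * (t / 2)"
          using True powr_add[of t "q - 2" 1] by simp
        then show ?thesis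
          using True q2 by (simp only: mult.assoc[symmetric]) (simp flip: ennreal_mult)
      qed
      also have "\<dots> \<le> ennreal (2 * q * t powr (q - 2)) * (ennreal (2 * pi * R t) * (\<integral>\<^sup>+y. ennreal (f y * indicator {s t<..} (f y)) \<partial>lborel))"
        by (intro mult_left_mono dist_fun True) auto
      also have "\<dots> = ennreal (D * t powr (q / 2 - 2)) * (\<integral>\<^sup>+y. ennreal (f y * indicator {s t<..} (f y)) \<partial>lborel)"
      proof -
        have "t powr (q - 2) * t powr - (q / 2) = t powr (q / 2 - 2)"
          by (simp flip: powr_add)
        then have "2 * q * t powr (q - 2) * (2 * pi * R t) = D * t powr (q / 2 - 2)"
          using True by (simp add: R_B D_def)
        then show ?thesis
          using True q2 Rpos[OF True] by (simp add: mult.assoc[symmetric] flip: ennreal_mult)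
      qed
      also have "\<dots> = (\<integral>\<^sup>+y. ennreal (D * t powr (q / 2 - 2)) * ennreal (f y * indicator {s t<..} (f y)) \<partial>lborel)"
        by (subst nn_integral_cmult) auto
      also have "\<dots> \<le> (\<integral>\<^sup>+y. ennreal (f y) * (ennreal D * (ennreal (t powr (q / 2 - 2)) * indicator {0..\<tau> (f y)} t)) \<partial>lborel)"
      proof (rule nn_integral_mono)
        fix y :: complex
        show "ennreal (D * t powr (q / 2 - 2)) * ennreal (f y * indicator {s t<..} (f y))
          \<le> ennreal (f y) * (ennreal D * (ennreal (t powr (q / 2 - 2)) * indicator {0..\<tau> (f y)} t))"
        proof (cases "s t < f y \<and> f y > 0")
          case f: True
          then have "t \<le> \<tau> (f y)"
            using s_less[OF True] by auto
          then show ?thesis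
            using f True B q2 by (simp add: D_def ennreal_mult mult_ac)
        next
          case False
          then have "f y * indicator {s t<..} (f y) = 0"
            using f0[of y] by (auto simp: indicator_def)
          then show ?thesis by (simp only: ennreal_0 mult_zero_right zero_le)
        qed
      qed
      finally show ?thesis .
    qed
  qed
  also have "\<dots> = (\<integral>\<^sup>+y. (\<integral>\<^sup>+t. ennreal (f y) * (ennreal D * (ennreal (t powr (q / 2 - 2)) * indicator {0..\<tau> (f y)} t)) \<partial>lborel) \<partial>lborel)"
    by (rule lborel_pair.Fubini') (simp add: indicator_def case_prod_unfold \<tau>_def, measurable)
  also have "\<dots> = (\<integral>\<^sup>+y. ennreal C * ennreal (f y powr p) \<partial>lborel)"
  proof (rule nn_integral_cong)
    fix y :: complex
    have "(\<integral>\<^sup>+t. ennreal (f y) * (ennreal D * (ennreal (t powr (q / 2 - 2)) * indicator {0..\<tau> (f y)} t)) \<partial>lborel)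
      = ennreal (f y) * (ennreal D * ennreal (\<tau> (f y) powr (q / 2 - 1) / (q / 2 - 1)))"
      using nn_integral_powr_from_0[of "q / 2 - 2" "\<tau> (f y)"] q2
      by (subst nn_integral_cmult, simp, subst nn_integral_cmult) (auto simp: \<tau>_def)
    also have "\<dots> = ennreal (f y * (D * (\<tau> (f y) powr (q / 2 - 1) / (q / 2 - 1))))"
      using f0[of y] B q2 by (simp add: D_def flip: ennreal_mult)
    also have "f y * (D * (\<tau> (f y) powr (q / 2 - 1) / (q / 2 - 1))) = C * f y powr p"
    proof (cases "f y = 0")
      case False
      then have fy: "f y > 0" using f0[of y] by simp
      define e where "e = (q / 2 - 1) / (1 + q / 2)"
      have "\<tau> (f y) powr (q / 2 - 1) = (8 * pi * B * f y) powr e"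
        by (simp add: \<tau>_def powr_powr e_def)
      also have "\<dots> = (8 * pi * B) powr e * f y powr e"
        using B fy by (simp add: powr_mult)
      finally have "f y * (D * (\<tau> (f y) powr (q / 2 - 1) / (q / 2 - 1))) = C * (f y powr 1 * f y powr e)"
        using fy by (simp add: C_def e_def)
      also have "f y powr 1 * f y powr e = f y powr p"
      proof -
        have "1 + e = p"
          using q2 by (simp add: p_eq e_def field_simps)
        then show ?thesis
          by (simp only: powr_add[symmetric])
      qed
      finally show ?thesis .
    qed (use p in simp)
    finally show "(\<integral>\<^sup>+t. ennreal (f y) * (ennreal D * (ennreal (t powr (q / 2 - 2)) * indicator {0..\<tau> (f y)} t)) \<partial>lborel)
       = ennreal C * ennreal (f y powr p)"
      using B q2 by (simp add: C_def D_def flip: ennreal_mult)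
  qed
  also have "\<dots> = ennreal C * ennreal N"
    by (simp add: nn_integral_cmult N)
  also have "\<dots> < \<infinity>"
    by (simp add: ennreal_mult_less_top)
  finally show ?thesis .
qed

section \<open>The Fredholm alternative for compact operators\<close>

text \<open>
  Riesz's lemma: a substitute for orthogonal projection in a normed space.
\<close>

lemma riesz_almost_orthogonal:
  fixes M N :: "'a::real_normed_vector set"
  assumes "subspace M" "closed M" "subspace N" "M \<subset> N"
  shows "\<exists>x\<in>N. norm x = 1 \<and> (\<forall>m\<in>M. norm (x - m) \<ge> 1/2)"
proof -
  obtain v where v: "v \<in> N" "v \<notin> M"
    using assms(4) by blast
  have ne: "M \<noteq> {}"
    using subspace_0[OF assms(1)] by blast
  define d where "d = infdist v M"
  have d: "d > 0"
    using v(2) assms(2) ne in_closed_iff_infdist_zero[OF assms(2) ne] infdist_nonneg[of v M]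
    unfolding d_def by (metis less_eq_real_def)
  have "\<exists>m\<in>M. dist v m < 2 * d"
  proof (rule ccontr)
    assume "\<not> ?thesis"
    then have "2 * d \<le> infdist v M"
      using ne unfolding infdist_notempty[OF ne] by (intro cINF_greatest) (auto simp: not_less)
    then show False
      using d by (simp add: d_def)
  qed
  then obtain m where m: "m \<in> M" "norm (v - m) < 2 * d"
    by (auto simp: dist_norm)
  define c where "c = norm (v - m)"
  have c: "c > 0" "c < 2 * d"
    using m v by (auto simp: c_def)
  let ?x = "(1 / c) *\<^sub>R (v - m)"
  have "?x \<in> N"
    using v m assms by (auto intro!: subspace_scale subspace_diff)
  moreover have "norm ?x = 1"
    using c by (simp add: c_def)
  moreover have "norm (?x - w) \<ge> 1/2" if w: "w \<in> M" for w
  proof -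
    have "m + c *\<^sub>R w \<in> M"
      using w m assms(1) by (auto intro!: subspace_add subspace_scale)
    then have "d \<le> norm (v - (m + c *\<^sub>R w))"
      unfolding d_def dist_norm[symmetric] by (rule infdist_le)
    also have "v - (m + c *\<^sub>R w) = c *\<^sub>R (?x - w)"
      using c by (simp add: algebra_simps)
    also have "norm \<dots> = c * norm (?x - w)"
      using c by simp
    also have "\<dots> \<le> (2 * d) * norm (?x - w)"
      using c by (intro mult_right_mono) auto
    finally show ?thesis
      using d by simp
  qed
  ultimately show ?thesis
    by blast
qed

text \<open>
  Unit vectors on which \<open>1 - K\<close> tends to zero would, by compactness, accumulate at a unit
  vector in the kernel of \<open>1 - K\<close>.
\<close>

lemma compact_perturbation_bounded_below:
  fixes K :: "'a::banach \<Rightarrow> 'a"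
  assumes lin: "bounded_linear K"
    and cpt: "\<And>x::nat \<Rightarrow> 'a. (\<And>n. norm (x n) \<le> 1) \<Longrightarrow>
                \<exists>r l. strict_mono r \<and> (\<lambda>n. K (x (r n))) \<longlonglongrightarrow> l"
    and inj: "\<And>x. K x = x \<Longrightarrow> x = 0"
  shows "\<exists>c>0. \<forall>x. norm (x - K x) \<ge> c * norm x"
proof (rule ccontr)
  interpret bounded_linear K by (fact lin)
  assume neg: "\<not> ?thesis"
  have "\<exists>x. norm x = 1 \<and> norm (x - K x) < inverse (real (Suc n))" for n
  proof -
    have "inverse (real (Suc n)) > 0"
      by simp
    then obtain x where x: "norm (x - K x) < inverse (real (Suc n)) * norm x"
      using neg by (meson not_le)
    then have nz: "x \<noteq> 0"
      by (auto simp: zero)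
    let ?y = "(1 / norm x) *\<^sub>R x"
    have "?y - K ?y = (1 / norm x) *\<^sub>R (x - K x)"
      by (simp add: scaleR algebra_simps)
    then have "norm (?y - K ?y) = norm (x - K x) / norm x"
      by simp
    also have "\<dots> < inverse (real (Suc n))"
      using x nz by (simp add: pos_divide_less_eq)
    finally show ?thesis
      using nz by (intro exI[of _ ?y]) simp
  qed
  then obtain x where x: "\<And>n. norm (x n) = 1"
      "\<And>n. norm (x n - K (x n)) < inverse (real (Suc n))"
    by metis
  then obtain r l where r: "strict_mono r" and l: "(\<lambda>n. K (x (r n))) \<longlonglongrightarrow> l"
    using cpt[of x] by auto
  have "(\<lambda>n. x n - K (x n)) \<longlonglongrightarrow> 0"
    by (rule Lim_null_comparison[OF _ LIMSEQ_inverse_real_of_nat])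
      (use x(2) in \<open>auto intro!: always_eventually less_imp_le\<close>)
  then have "(\<lambda>n. x (r n) - K (x (r n))) \<longlonglongrightarrow> 0"
    using LIMSEQ_subseq_LIMSEQ[OF _ r] by (auto simp: o_def)
  from tendsto_add[OF this l] have xl: "(\<lambda>n. x (r n)) \<longlonglongrightarrow> l"
    by simp
  then have "(\<lambda>n. K (x (r n))) \<longlonglongrightarrow> K l"
    by (rule tendsto)
  then have "K l = l"
    using l LIMSEQ_unique by blast
  moreover have "norm l = 1"
    using tendsto_norm[OF xl] x(1) by (simp add: LIMSEQ_const_iff)
  ultimately show False
    using inj[of l] by auto
qed

text \<open>
  If \<open>S = 1 - K\<close> is injective but not onto, the ranges of its powers decrease strictly, and they are closed
  because \<open>S\<close> is bounded below. Riesz's lemma picks a unit vector in each range that keeps the distance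
  \<open>1/2\<close> from the next one; \<open>K\<close> keeps these vectors \<open>1/2\<close> apart, so it is not compact.
\<close>

theorem riesz_fredholm_alternative:
  fixes K :: "'a::banach \<Rightarrow> 'a"
  assumes lin: "bounded_linear K"
    and cpt: "\<And>x::nat \<Rightarrow> 'a. (\<And>n. norm (x n) \<le> 1) \<Longrightarrow>
                \<exists>r l. strict_mono r \<and> (\<lambda>n. K (x (r n))) \<longlonglongrightarrow> l"
    and inj: "\<And>x. K x = x \<Longrightarrow> x = 0"
  shows "\<exists>x. x - K x = y"
proof (rule ccontr)
  assume ny: "\<nexists>x. x - K x = y"
  interpret K: bounded_linear K by (fact lin)
  define S where "S = (\<lambda>x. x - K x)"
  interpret S: bounded_linear S
    unfolding S_def by (intro bounded_linear_sub bounded_linear_ident lin)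
  obtain c where c: "c > 0" "\<And>x. norm (S x) \<ge> c * norm x"
    using compact_perturbation_bounded_below[OF assms] unfolding S_def by blast
  have injS: "inj S"
  proof (rule injI)
    fix a b assume "S a = S b"
    then show "a = b"
      using c(2)[of "a - b"] c(1) by (simp add: S.diff mult_le_0_iff)
  qed
  define M where "M n = (S ^^ n) ` UNIV" for n
  have M_Suc: "M (Suc n) = S ` M n" for n
    by (auto simp: M_def image_image)
  have sub: "subspace (M n)" for n
  proof (induction n)
    case (Suc n)
    then show ?case
      unfolding M_Suc by (rule linear_subspace_image[OF S.linear_axioms])
  qed (simp add: M_def)
  have clo: "closed (M n)" for n
  proof (induction n)
    case (Suc n)
    then have "complete (M n)"
      by (simp add: complete_eq_closed)
    then have "complete (S ` M n)"
      by (intro complete_isometric_image[OF c(1) sub S.bounded_linear_axioms])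
        (use c in \<open>auto simp: mult.commute\<close>)
    then show ?case
      by (simp add: complete_eq_closed M_Suc)
  qed (simp add: M_def)
  have dec: "M (Suc n) \<subseteq> M n" for n
  proof
    fix x assume "x \<in> M (Suc n)"
    then show "x \<in> M n"
      by (auto simp: M_def funpow_swap1)
  qed
  have decr: "M m \<subseteq> M n" if "n \<le> m" for m n
    using that by (induction rule: dec_induct) (use dec in auto)
  have strict: "M (Suc n) \<subset> M n" for n
  proof (induction n)
    case 0
    have "y \<in> M 0" "y \<notin> M (Suc 0)"
      using ny by (auto simp: M_def S_def)
    with dec[of 0] show ?case
      by blast
  next
    case (Suc n)
    then show ?case
      unfolding M_Suc[of "Suc n"] M_Suc[of n]
      using inj_image_subset_iff[OF injS] M_Suc by (metis less_le_not_le)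
  qed
  have "\<exists>x. x \<in> M n \<and> norm x = 1 \<and> (\<forall>m\<in>M (Suc n). norm (x - m) \<ge> 1/2)" for n
    using riesz_almost_orthogonal[OF sub clo sub strict] by blast
  then obtain x where x: "\<And>n. x n \<in> M n" "\<And>n. norm (x n) = 1"
      "\<And>n m. m \<in> M (Suc n) \<Longrightarrow> norm (x n - m) \<ge> 1/2"
    by metis
  have sep: "norm (K (x n) - K (x m)) \<ge> 1/2" if "n < m" for n m
  proof -
    have "S (x n) \<in> M (Suc n)" "S (x m) \<in> M (Suc n)" "x m \<in> M (Suc n)"
      using x(1) decr[of "Suc n" m] decr[of "Suc n" "Suc m"] that unfolding M_Suc[symmetric]
      by (auto simp: M_Suc)
    then have "S (x n) + x m - S (x m) \<in> M (Suc n)"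
      using sub by (intro subspace_diff subspace_add)
    from x(3)[OF this] show ?thesis
      by (simp add: S_def algebra_simps)
  qed
  obtain r l where r: "strict_mono r" and l: "(\<lambda>n. K (x (r n))) \<longlonglongrightarrow> l"
    using cpt[of x] x(2) by auto
  from LIMSEQ_imp_Cauchy[OF l] obtain N
    where N: "\<And>m n. m \<ge> N \<Longrightarrow> n \<ge> N \<Longrightarrow> norm (K (x (r m)) - K (x (r n))) < 1/2"
    unfolding Cauchy_def dist_norm by (metis half_gt_zero_iff zero_less_one)
  have "norm (K (x (r N)) - K (x (r (Suc N)))) \<ge> 1/2"
    using r by (intro sep) (auto simp: strict_mono_def)
  with N[of N "Suc N"] show False
    by simp
qed

section \<open>The Faddeev Green function\<close>

text \<open>
  Up to a constant, \<open>E\<close> is the entire function \<open>E\<^sub>1(z) + log z\<close>. The integrand has a removable singularity at the origin.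
\<close>

lemma entire_exponential_integral_exists:
  "\<exists>E. \<forall>z::complex. (E has_field_derivative (if z = 0 then 1 else (1 - exp (- z)) / z)) (at z)"
proof -
  let ?f = "\<lambda>z::complex. if z = 0 then 1 else (1 - exp (- z)) / z"
  have diff: "?f field_differentiable at z" if "z \<noteq> 0" for z
  proof -
    have "((\<lambda>z. (1 - exp (- z)) / z) has_field_derivative
        (exp (- z) * z - (1 - exp (- z)) * 1) / (z * z)) (at z)"
      using that by (auto intro!: derivative_eq_intros)
    moreover have "eventually (\<lambda>w. w \<in> - {0}) (nhds z)"
      using that by (intro eventually_nhds_in_open) auto
    then have ev: "eventually (\<lambda>w. ?f w = (1 - exp (- w)) / w) (nhds z)"
      by eventually_elim auto
    ultimately show ?thesis
      using DERIV_cong_ev[OF refl ev refl] unfolding field_differentiable_def by blast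
  qed
  have "((\<lambda>z. 1 - exp (- z)) has_field_derivative 1) (at (0::complex))"
    by (auto intro!: derivative_eq_intros)
  then have lim: "((\<lambda>z::complex. (1 - exp (- z)) / z) \<longlongrightarrow> 1) (at 0)"
    by (simp add: has_field_derivative_iff)
  have "isCont ?f 0"
    unfolding isCont_def by (rule Lim_transform_eventually[OF lim[THEN tendsto_cong_limit]])
      (auto simp: eventually_at_filter)
  then have "isCont ?f z" for z
    using diff[THEN field_differentiable_imp_continuous_at, of z] by (cases "z = 0") auto
  then have "continuous_on UNIV ?f"
    by (simp add: continuous_on_eq_continuous_at)
  then obtain g where g: "\<And>x. x \<in> UNIV \<Longrightarrow> (g has_field_derivative ?f x) (at x)"
    by (rule holomorphic_convex_primitive[of UNIV "{0}" ?f, rotated 2]) (use diff in auto)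
  show ?thesis
    by (intro exI[of _ g] allI) (rule g, rule UNIV_I)
qed

definition Ein :: "complex \<Rightarrow> complex" where
  "Ein = (SOME E. \<forall>z. (E has_field_derivative (if z = 0 then 1 else (1 - exp (- z)) / z)) (at z))"

lemma Ein_has_field_derivative:
  "(Ein has_field_derivative (if z = 0 then 1 else (1 - exp (- z)) / z)) (at z)"
  using someI_ex[OF entire_exponential_integral_exists] unfolding Ein_def by blast

lemma continuous_on_Ein: "continuous_on A Ein"
  by (intro continuous_at_imp_continuous_on ballI DERIV_isCont[OF Ein_has_field_derivative])

text \<open>
  Up to sign and an additive constant, twice the real part of the exponential integral \<open>E\<^sub>1\<close>; unlike \<open>E\<^sub>1\<close>
  it has no branch cut. It is harmonic off the origin, with a logarithmic singularity at the origin.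
\<close>

definition log_potential :: "complex \<Rightarrow> real" where
  "log_potential z = 2 * (ln (norm z) - Re (Ein z))"

lemma log_potential_has_derivative:
  assumes "z \<noteq> 0"
  shows "(log_potential has_derivative (\<lambda>e. 2 * Re (exp (- z) / z * e))) (at z)"
proof -
  have "((\<lambda>z. ln (norm z)) has_derivative (\<lambda>e. inner e (sgn z) * inverse (norm z))) (at z)"
    using assms
    by (auto intro!: derivative_eq_intros has_derivative_norm simp: fun_eq_iff divide_inverse)
  moreover have "(\<lambda>e. inner e (sgn z) * inverse (norm z)) = (\<lambda>e. Re (e / z))"
  proof
    fix e
    have "inner e (sgn z) * inverse (norm z) = inner e z / (norm z)\<^sup>2"
      by (simp add: sgn_div_norm power2_eq_square divide_inverse)
    also have "\<dots> = Re (e / z)"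
      by (simp add: Re_divide inner_complex_def cmod_power2)
    finally show "inner e (sgn z) * inverse (norm z) = Re (e / z)" .
  qed
  ultimately have 1: "((\<lambda>z. ln (norm z)) has_derivative (\<lambda>e. Re (e / z))) (at z)"
    by simp
  have 2: "((\<lambda>z. Re (Ein z)) has_derivative (\<lambda>e. Re ((1 - exp (- z)) / z * e))) (at z)"
  proof (rule has_derivative_Re)
    show "(Ein has_derivative (\<lambda>e. (1 - exp (- z)) / z * e)) (at z)"
      using Ein_has_field_derivative[of z] assms
      by (simp only: has_field_derivative_def if_False)
  qed
  have "((\<lambda>z. 2 * (ln (norm z) - Re (Ein z))) has_derivative
      (\<lambda>e. 2 * (Re (e / z) - Re ((1 - exp (- z)) / z * e)))) (at z)"
    by (rule has_derivative_mult_right[OF has_derivative_diff[OF 1 2]])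
  moreover have "Re (e / z) - Re ((1 - exp (- z)) / z * e) = Re (exp (- z) / z * e)" for e
  proof -
    have "e / z - (1 - exp (- z)) / z * e = exp (- z) / z * e"
      using assms by (simp add: field_simps)
    then show ?thesis
      by (metis minus_complex.simps(1))
  qed
  ultimately show ?thesis
    unfolding log_potential_def[abs_def] by (simp only:)
qed

lemma Complex_line: "Complex t y = of_real t + \<i> * of_real y"
  by (simp add: complex_eq_iff)

lemma norm_exp_over: "norm (exp (- z) / z) = exp (- Re z) / norm z"
  by (simp add: norm_divide)

lemma exp_line_derivative:
  "((\<lambda>t. c * (exp (- t) * (2 + t - x))) has_real_derivative - c * (exp (- t) * (1 + t - x))) (at (t::real))"
  by (auto intro!: derivative_eq_intros simp: algebra_simps)

text \<open>
  Along a horizontal ray to the right the derivative is at most \<open>2 e\<^sup>-\<^sup>t / |t + i y|\<close>. As long as the ray keeps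
  the distance \<open>1\<close> from the origin, \<open>1 / |t + i y| \<le> (1 + t - x) / |x + i y|\<close>, and the resulting bound has
  an elementary primitive.
\<close>

lemma log_potential_horizontal:
  assumes "x \<le> X" and far: "\<And>t. x \<le> t \<Longrightarrow> norm (Complex t y) \<ge> 1"
  shows "\<bar>log_potential (Complex X y) - log_potential (Complex x y)\<bar> \<le> 4 * exp (- x) / norm (Complex x y)"
proof (cases "x = X")
  case False
  let ?n = "norm (Complex x y)"
  have n1: "?n \<ge> 1"
    using far by simp
  let ?f' = "\<lambda>t. 2 * Re (exp (- Complex t y) / Complex t y * 1)"
  let ?phi = "\<lambda>t. - (2 / ?n) * (exp (- t) * (2 + t - x))"
  let ?phi' = "\<lambda>t. - (- (2 / ?n)) * (exp (- t) * (1 + t - x))"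
  have der: "((\<lambda>t. log_potential (Complex t y)) has_vector_derivative ?f' t) (at t)" if "x \<le> t" for t
  proof -
    have "Complex t y \<noteq> 0"
      using far[OF that] by auto
    from log_potential_has_derivative[OF this]
    have "(log_potential has_derivative (\<lambda>e. 2 * Re (exp (- Complex t y) / Complex t y * e))) (at (Complex t y))" .
    moreover have "((\<lambda>t. Complex t y) has_derivative (\<lambda>s. of_real s)) (at t)"
      unfolding Complex_line by (auto intro!: derivative_eq_intros)
    ultimately have "((\<lambda>t. log_potential (Complex t y)) has_derivative
        (\<lambda>s. 2 * Re (exp (- Complex t y) / Complex t y * of_real s))) (at t)"
      by (rule has_derivative_compose[rotated])
    moreover have "2 * Re (exp (- Complex t y) / Complex t y * of_real s) = s *\<^sub>R ?f' t" for s
      by (simp only: times_complex.sel Re_complex_of_real Im_complex_of_real mult_1_right) simp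
    ultimately show ?thesis
      by (simp only: has_vector_derivative_def)
  qed
  have "norm (log_potential (Complex X y) - log_potential (Complex x y)) \<le> ?phi X - ?phi x"
  proof (rule differentiable_bound_general)
    show "x < X" using False assms(1) by simp
    show "continuous_on {x..X} (\<lambda>t. log_potential (Complex t y))"
      by (intro continuous_at_imp_continuous_on ballI has_vector_derivative_continuous[OF der]) auto
    show "continuous_on {x..X} ?phi"
      using n1 by (intro continuous_intros) auto
    fix t assume t: "x < t" "t < X"
    show "((\<lambda>t. log_potential (Complex t y)) has_vector_derivative ?f' t) (at t)"
      using t by (intro der) simp
    show "(?phi has_vector_derivative ?phi' t) (at t)"
      unfolding has_real_derivative_iff_has_vector_derivative[symmetric]
      by (rule exp_line_derivative)
    have "norm (?f' t) \<le> 2 * norm (exp (- Complex t y) / Complex t y)"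
      using abs_Re_le_cmod[of "exp (- Complex t y) / Complex t y"] by (simp add: abs_mult)
    also have "\<dots> = 2 * exp (- t) * (1 / norm (Complex t y))"
      by (simp add: norm_exp_over)
    also have "\<dots> \<le> 2 * exp (- t) * ((1 + t - x) / ?n)"
    proof (rule mult_left_mono)
      have "?n \<le> norm (Complex t y) + norm (Complex x y - Complex t y)"
        by (rule norm_triangle_sub)
      also have "norm (Complex x y - Complex t y) = t - x"
        using t by (simp add: cmod_def)
      also have "norm (Complex t y) + (t - x) \<le> norm (Complex t y) + (t - x) * norm (Complex t y)"
        using mult_left_mono[OF far[of t], of "t - x"] t by simp
      finally have "?n \<le> (1 + t - x) * norm (Complex t y)"
        by (simp add: algebra_simps)
      moreover have "norm (Complex t y) > 0" "?n > 0"
        using far[of t] n1 t by linarith+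
      ultimately show "1 / norm (Complex t y) \<le> (1 + t - x) / ?n"
        by (simp add: divide_simps mult.commute)
    qed simp
    finally show "norm (?f' t) \<le> ?phi' t"
      by simp
  qed
  also have "\<dots> \<le> 4 * exp (- x) / ?n"
  proof -
    have "?phi X \<le> 0"
      using n1 assms(1) by (intro mult_nonpos_nonneg mult_nonneg_nonneg) auto
    moreover have "?phi x = - (4 * exp (- x) / ?n)"
      by simp
    ultimately show ?thesis
      by linarith
  qed
  finally show ?thesis
    by simp
qed simp

lemma log_potential_vertical:
  assumes "x \<noteq> 0"
  shows "\<bar>log_potential (Complex x y) - log_potential (Complex x v)\<bar> \<le> 2 * exp (- x) / \<bar>x\<bar> * \<bar>y - v\<bar>"
proof -
  have "norm (log_potential (Complex x y) - log_potential (Complex x v)) \<le> 2 * exp (- x) / \<bar>x\<bar> * norm (y - v)"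
  proof (rule differentiable_bound[where S = UNIV and f = "\<lambda>s. log_potential (Complex x s)"
        and f' = "\<lambda>s e. 2 * Re (exp (- Complex x s) / Complex x s * (\<i> * of_real e))"])
    fix s :: real
    have nz: "Complex x s \<noteq> 0"
      using assms by (simp add: complex_eq_iff)
    have "((\<lambda>t. Complex x t) has_derivative (\<lambda>s. \<i> * of_real s)) (at s)"
      unfolding Complex_line by (auto intro!: derivative_eq_intros)
    from has_derivative_compose[OF this log_potential_has_derivative[OF nz]]
    show "((\<lambda>s. log_potential (Complex x s)) has_derivative
        (\<lambda>e. 2 * Re (exp (- Complex x s) / Complex x s * (\<i> * of_real e)))) (at s within UNIV)"
      by simp
    show "onorm (\<lambda>e. 2 * Re (exp (- Complex x s) / Complex x s * (\<i> * of_real e))) \<le> 2 * exp (- x) / \<bar>x\<bar>"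
    proof (rule onorm_le)
      fix e :: real
      have "norm (2 * Re (exp (- Complex x s) / Complex x s * (\<i> * of_real e)))
          \<le> 2 * norm (exp (- Complex x s) / Complex x s * (\<i> * of_real e))"
        using abs_Re_le_cmod[of "exp (- Complex x s) / Complex x s * (\<i> * of_real e)"]
        by (simp add: abs_mult)
      also have "\<dots> = 2 * (exp (- x) / norm (Complex x s)) * \<bar>e\<bar>"
        unfolding norm_mult norm_exp_over by simp
      also have "\<dots> \<le> 2 * (exp (- x) / \<bar>x\<bar>) * \<bar>e\<bar>"
        using assms abs_Re_le_cmod[of "Complex x s"]
        by (intro mult_right_mono mult_left_mono divide_left_mono) (auto intro!: mult_pos_pos simp: nz)
      finally show "norm (2 * Re (exp (- Complex x s) / Complex x s * (\<i> * of_real e))) \<le> 2 * exp (- x) / \<bar>x\<bar> * norm e"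
        by simp
    qed
  qed auto
  then show ?thesis by simp
qed

text \<open>
  The limit exists along the real axis by the horizontal estimate; the vertical one shows that it is the
  same on every horizontal line.
\<close>

lemma log_potential_limit:
  "\<exists>L. \<forall>y. (\<lambda>n. log_potential (Complex (real n) y)) \<longlonglongrightarrow> L"
proof -
  have e0: "(\<lambda>n. exp (- real n)) \<longlonglongrightarrow> 0"
    by real_asymp
  have "Cauchy (\<lambda>n. log_potential (Complex (real n) 0))"
  proof (rule CauchyI')
    fix e :: real assume "e > 0"
    then have "eventually (\<lambda>n. exp (- real n) < e / 4) sequentially"
      using order_tendstoD(2)[OF e0, of "e / 4"] by simp
    then obtain M where M: "\<And>n. n \<ge> M \<Longrightarrow> exp (- real n) < e / 4"
      by (auto simp: eventually_sequentially)
    show "\<exists>M. \<forall>m\<ge>M. \<forall>n>m. dist (log_potential (Complex (real m) 0)) (log_potential (Complex (real n) 0)) < e"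
    proof (intro exI allI impI)
      fix m n :: nat assume mn: "max 1 M \<le> m" "m < n"
      have nm: "norm (Complex t 0) = \<bar>t\<bar>" for t
        by (simp add: cmod_def)
      have "\<bar>log_potential (Complex (real n) 0) - log_potential (Complex (real m) 0)\<bar> \<le> 4 * exp (- real m) / norm (Complex (real m) 0)"
        using mn by (intro log_potential_horizontal) (auto simp: nm)
      also have "\<dots> \<le> 4 * exp (- real m) / 1"
        using mn by (intro divide_left_mono) (auto simp: nm)
      also have "\<dots> < e"
        using M[of m] mn by simp
      finally show "dist (log_potential (Complex (real m) 0)) (log_potential (Complex (real n) 0)) < e"
        by (simp add: dist_real_def abs_minus_commute)
    qed
  qed
  then obtain L where L: "(\<lambda>n. log_potential (Complex (real n) 0)) \<longlonglongrightarrow> L"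
    using Cauchy_convergent_iff convergent_def by blast
  have "(\<lambda>n. log_potential (Complex (real n) y)) \<longlonglongrightarrow> L" for y
  proof -
    have "(\<lambda>n. log_potential (Complex (real n) y) - log_potential (Complex (real n) 0)) \<longlonglongrightarrow> 0"
    proof (rule Lim_null_comparison)
      show "(\<lambda>n. 2 * exp (- real n) / real n * \<bar>y\<bar>) \<longlonglongrightarrow> 0"
        by real_asymp
      show "eventually (\<lambda>n. norm (log_potential (Complex (real n) y) - log_potential (Complex (real n) 0))
          \<le> 2 * exp (- real n) / real n * \<bar>y\<bar>) sequentially"
        using eventually_gt_at_top[of 0]
      proof eventually_elim
        case (elim n)
        then show ?case
          using log_potential_vertical[of "real n" y 0] by simp
      qed
    qed
    from tendsto_add[OF this L] show ?thesis by simp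
  qed
  then show ?thesis by blast
qed

definition log_potential_at_infinity :: real where
  "log_potential_at_infinity = (SOME L. \<forall>y. (\<lambda>n. log_potential (Complex (real n) y)) \<longlonglongrightarrow> L)"

lemma log_potential_tendsto: "(\<lambda>n. log_potential (Complex (real n) y)) \<longlonglongrightarrow> log_potential_at_infinity"
  using someI_ex[OF log_potential_limit] unfolding log_potential_at_infinity_def by blast

text \<open>
  This is \<open>- 2 Re E\<^sub>1\<close>: the constant is determined by decay in the direction of the positive real axis.
\<close>

definition exp_potential :: "complex \<Rightarrow> real" where
  "exp_potential z = log_potential z - log_potential_at_infinity"

lemma exp_potential_has_derivative:
  assumes "z \<noteq> 0"
  shows "(exp_potential has_derivative (\<lambda>e. 2 * Re (exp (- z) / z * e))) (at z)"
  unfolding exp_potential_def[abs_def]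
  using has_derivative_diff[OF log_potential_has_derivative[OF assms] has_derivative_const] by simp

text \<open>
  Here the horizontal ray to \<open>+\<infinity>\<close> does not meet the open unit disc, so the horizontal estimate can be
  applied on all of it.
\<close>

lemma exp_potential_bound_outer:
  assumes "Re z \<ge> 1 \<or> \<bar>Im z\<bar> \<ge> 1"
  shows "\<bar>exp_potential z\<bar> \<le> 4 * exp (- Re z) / norm z"
proof -
  obtain x y where z: "z = Complex x y" by (cases z)
  have far: "norm (Complex t y) \<ge> 1" if "x \<le> t" for t
    using assms that abs_Re_le_cmod[of "Complex t y"] abs_Im_le_cmod[of "Complex t y"] by (auto simp: z)
  have "(\<lambda>n. \<bar>log_potential (Complex (real n) y) - log_potential (Complex x y)\<bar>) \<longlonglongrightarrow> \<bar>log_potential_at_infinity - log_potential (Complex x y)\<bar>"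
    by (intro tendsto_intros log_potential_tendsto)
  moreover have "eventually (\<lambda>n. \<bar>log_potential (Complex (real n) y) - log_potential (Complex x y)\<bar> \<le> 4 * exp (- x) / norm (Complex x y)) sequentially"
    using eventually_ge_at_top[of "nat \<lceil>x\<rceil>"]
  proof eventually_elim
    case (elim n)
    then have "x \<le> real n" by linarith
    then show ?case
      by (rule log_potential_horizontal) (rule far)
  qed
  ultimately have "\<bar>log_potential_at_infinity - log_potential (Complex x y)\<bar> \<le> 4 * exp (- x) / norm (Complex x y)"
    by (rule tendsto_upperbound) simp
  then show ?thesis
    by (simp add: exp_potential_def z abs_minus_commute)
qed

text \<open>
  In this half-strip the ray to \<open>+\<infinity>\<close> runs into the singularity; instead the value is compared with the
  one on the line \<open>Im z = 1\<close>.
\<close>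

lemma exp_potential_bound_left:
  assumes "Re z \<le> -1" "\<bar>Im z\<bar> \<le> 1"
  shows "\<bar>exp_potential z\<bar> \<le> 12 * exp (- Re z) / norm z"
proof -
  obtain x y where z: "z = Complex x y" by (cases z)
  have x: "x \<le> -1" "\<bar>y\<bar> \<le> 1" using assms by (auto simp: z)
  have nz: "norm z > 0" using x by (auto simp: z complex_eq_iff)
  have "\<bar>exp_potential (Complex x 1)\<bar> \<le> 4 * exp (- x) / norm (Complex x 1)"
    using exp_potential_bound_outer[of "Complex x 1"] by simp
  also have "\<dots> \<le> 4 * exp (- x) / norm z"
    using x nz by (intro divide_left_mono) (auto simp: z cmod_def abs_square_le_1 intro!: mult_pos_pos real_sqrt_le_mono add_nonneg_pos)
  finally have 1: "\<bar>exp_potential (Complex x 1)\<bar> \<le> 4 * exp (- x) / norm z" .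
  have "\<bar>exp_potential z - exp_potential (Complex x 1)\<bar> \<le> 2 * exp (- x) / \<bar>x\<bar> * \<bar>y - 1\<bar>"
    using log_potential_vertical[of x y 1] x by (simp add: z exp_potential_def)
  also have "\<dots> \<le> 2 * exp (- x) / \<bar>x\<bar> * 2"
    using x by (intro mult_left_mono divide_nonneg_nonneg) auto
  also have "\<dots> \<le> 8 * exp (- x) / norm z"
  proof -
    have "norm z \<le> 2 * \<bar>x\<bar>"
      using cmod_le[of z] x by (auto simp: z)
    then have "1 / \<bar>x\<bar> \<le> 2 / norm z"
      using nz x by (simp add: divide_simps)
    then have "4 * exp (- x) * (1 / \<bar>x\<bar>) \<le> 4 * exp (- x) * (2 / norm z)"
      by (intro mult_left_mono) auto
    then show ?thesis by simp
  qed
  finally have "\<bar>exp_potential z - exp_potential (Complex x 1)\<bar> \<le> 8 * exp (- x) / norm z" .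
  with 1 have "\<bar>exp_potential z\<bar> \<le> 4 * exp (- x) / norm z + 8 * exp (- x) / norm z"
    by linarith
  then show ?thesis
    by (simp add: z add_divide_distrib[symmetric])
qed

text \<open>
  Logarithmic growth at the origin and decay like \<open>1 / |z|\<close> at infinity, in one bound: \<open>a = 1\<close> gives the decay,
  and a small \<open>a\<close> the weak singularity.
\<close>

lemma exp_times_exp_potential_bound:
  assumes a: "0 < a" "a \<le> 1"
  shows "\<exists>C. \<forall>z\<noteq>0. norm (exp z) * \<bar>exp_potential z\<bar> \<le> C * norm z powr - a"
proof -
  have "compact ((\<lambda>z. Ein z) ` cball 0 2)"
    by (intro compact_continuous_image continuous_on_Ein) auto
  then obtain B where B: "\<And>z. norm z \<le> 2 \<Longrightarrow> norm (Ein z) \<le> B"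
    using compact_imp_bounded bounded_iff by (metis (no_types, lifting) imageI mem_cball_0)
  define M where "M = 2 * B + \<bar>log_potential_at_infinity\<bar> + 2"
  have B0: "B \<ge> 0" using order_trans[OF norm_ge_zero B[of 0]] by simp
  have M: "M \<ge> 0" using B0 by (simp add: M_def)
  define C where "C = max 12 (exp 2 * (2 / a + 2 * M))"
  have "norm (exp z) * \<bar>exp_potential z\<bar> \<le> C * norm z powr - a" if "z \<noteq> 0" for z
  proof (cases "norm z \<le> 2")
    case True
    have nz: "norm z > 0" using that by simp
    have pw: "norm z powr - a \<ge> 1 / 2"
    proof -
      have "norm z powr - a \<ge> 2 powr - a"
        using True nz a by (intro powr_mono2') auto
      moreover have "2 powr - a \<ge> 2 powr (-1)"
        using a by (intro powr_mono) auto
      moreover have "2 powr (-1) = (1 / 2 :: real)"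
        by (simp add: powr_minus_divide)
      ultimately show ?thesis by linarith
    qed
    have ln_b: "\<bar>ln (norm z)\<bar> \<le> norm z powr - a / a + 1"
    proof (cases "norm z \<ge> 1")
      case 1: True
      have "ln (norm z) \<le> norm z - 1"
        using nz by (intro ln_le_minus_one)
      moreover have "ln (norm z) \<ge> 0" "norm z powr - a / a \<ge> 0"
        using 1 a by auto
      ultimately show ?thesis
        using True by linarith
    next
      case False
      have "- a * ln (norm z) = ln (norm z powr - a)"
        using nz by (simp add: ln_powr)
      also have "\<dots> \<le> norm z powr - a - 1"
        using nz by (intro ln_le_minus_one) auto
      finally have "- ln (norm z) \<le> norm z powr - a / a"
        using a by (simp add: field_simps)
      then show ?thesis
        using False nz by (auto simp: abs_if)
    qed
    have "\<bar>exp_potential z\<bar> \<le> 2 * \<bar>ln (norm z)\<bar> + 2 * norm (Ein z) + \<bar>log_potential_at_infinity\<bar>"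
    proof -
      have "\<bar>2 * (l - r) - L\<bar> \<le> 2 * \<bar>l\<bar> + 2 * \<bar>r\<bar> + \<bar>L\<bar>" for l r L :: real
        by (auto simp: abs_if)
      from this[of "ln (norm z)" "Re (Ein z)" log_potential_at_infinity] show ?thesis
        using abs_Re_le_cmod[of "Ein z"] unfolding exp_potential_def log_potential_def by linarith
    qed
    also have "\<dots> \<le> 2 * (norm z powr - a / a) + M"
      using ln_b B[OF True] by (simp add: M_def)
    also have "\<dots> \<le> 2 * (norm z powr - a / a) + M * (2 * norm z powr - a)"
      using pw M by (intro add_left_mono mult_left_le) (auto simp: mult_le_cancel_left1)
    also have "\<dots> = (2 / a + 2 * M) * norm z powr - a"
      by (simp add: algebra_simps)
    finally have 1: "\<bar>exp_potential z\<bar> \<le> (2 / a + 2 * M) * norm z powr - a" .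
    have "norm (exp z) \<le> exp 2"
      using True complex_Re_le_cmod[of z] by simp
    then have "norm (exp z) * \<bar>exp_potential z\<bar> \<le> exp 2 * ((2 / a + 2 * M) * norm z powr - a)"
      using 1 by (intro mult_mono) auto
    also have "\<dots> \<le> C * norm z powr - a"
      unfolding C_def mult.assoc[symmetric] by (intro mult_right_mono) auto
    finally show ?thesis .
  next
    case False
    have "\<bar>exp_potential z\<bar> \<le> 12 * exp (- Re z) / norm z"
    proof (cases "Re z \<ge> 1 \<or> \<bar>Im z\<bar> \<ge> 1")
      case True
      have "4 * exp (- Re z) / norm z \<le> 12 * exp (- Re z) / norm z"
        by (intro divide_right_mono) auto
      then show ?thesis
        using exp_potential_bound_outer[OF True] by linarith
    next
      case in_strip: False
      moreover have "Re z \<le> -1"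
        using in_strip False cmod_le[of z] by linarith
      ultimately show ?thesis
        by (intro exp_potential_bound_left) auto
    qed
    then have "norm (exp z) * \<bar>exp_potential z\<bar> \<le> exp (Re z) * (12 * exp (- Re z) / norm z)"
      by (intro mult_mono) auto
    also have "\<dots> = 12 * norm z powr - 1"
      by (simp add: powr_minus_divide exp_minus)
    also have "\<dots> \<le> 12 * norm z powr - a"
      using a False by (intro mult_left_mono powr_mono) auto
    also have "\<dots> \<le> C * norm z powr - a"
      unfolding C_def by (intro mult_right_mono) auto
    finally show ?thesis .
  qed
  then show ?thesis by blast
qed

text \<open>
  The fundamental solution of \<open>\<partial>\<close>bar\<open>(\<partial> + i k)\<close>. The factor \<open>exp (- i k z)\<close> conjugates this operator to
  \<open>\<partial>\<close>bar\<open> \<partial>\<close>, a multiple of the Laplacian, and among the fundamental solutions of the latter the potential of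
  the exponential integral is one for which the product decays in all directions.
\<close>

definition faddeev_green :: "complex \<Rightarrow> complex \<Rightarrow> complex" where
  "faddeev_green k z = exp (- \<i> * k * z) * of_real (exp_potential (- \<i> * k * z)) / of_real pi"

lemma faddeev_green_bound:
  assumes "k \<noteq> 0" "0 < a" "a \<le> 1"
  shows "\<exists>C. \<forall>z\<noteq>0. norm (faddeev_green k z) \<le> C * norm z powr - a"
proof -
  obtain C where C: "\<And>z. z \<noteq> 0 \<Longrightarrow> norm (exp z) * \<bar>exp_potential z\<bar> \<le> C * norm z powr - a"
    using exp_times_exp_potential_bound[OF assms(2,3)] by blast
  have "norm (faddeev_green k z) \<le> C * norm k powr - a / pi * norm z powr - a" if "z \<noteq> 0" for z
  proof -
    let ?w = "- \<i> * k * z"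
    have "norm (faddeev_green k z) = norm (exp ?w) * \<bar>exp_potential ?w\<bar> / pi"
      by (simp add: faddeev_green_def norm_mult norm_divide)
    also have "\<dots> \<le> C * norm ?w powr - a / pi"
      using assms that by (intro divide_right_mono C) auto
    also have "\<dots> = C * norm k powr - a / pi * norm z powr - a"
      by (simp add: norm_mult powr_mult)
    finally show ?thesis .
  qed
  then show ?thesis by blast
qed

text \<open>
  With \<open>\<partial>\<close> the coefficient of \<open>e\<close> and \<open>\<partial>\<close>bar the one of its conjugate, this states
  \<open>(\<partial> + i k) G = 1 / (\<pi> z)\<close> and \<open>\<partial>\<close>bar\<open> G = e\<^sub>-\<^sub>k(z) / (\<pi> z\<close>bar\<open>)\<close>. These two first order equations are all that
  the rest of the proof uses about the derivatives of \<open>G\<close>.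
\<close>

lemma faddeev_green_has_derivative:
  assumes "k \<noteq> 0" "z \<noteq> 0"
  shows "(faddeev_green k has_derivative
    (\<lambda>e. (1 / (of_real pi * z) - \<i> * k * faddeev_green k z) * e + e_osc (- k) z / (of_real pi * cnj z) * cnj e)) (at z)"
proof -
  let ?w = "- \<i> * k * z"
  have w: "?w \<noteq> 0" using assms by auto
  have lin: "((\<lambda>z. - \<i> * k * z) has_derivative (\<lambda>e. - \<i> * k * e)) (at z)"
    by (auto intro!: derivative_eq_intros)
  have 1: "((\<lambda>z. exp_potential (- \<i> * k * z)) has_derivative (\<lambda>e. 2 * Re (exp (- ?w) / ?w * (- \<i> * k * e)))) (at z)"
    by (rule has_derivative_compose[OF lin exp_potential_has_derivative[OF w]])
  have "((\<lambda>z. exp z :: complex) has_derivative (*) (exp ?w)) (at ?w)"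
    using DERIV_exp[of ?w] by (simp add: has_field_derivative_def)
  from has_derivative_compose[OF lin this]
  have 2: "((\<lambda>z. exp (- \<i> * k * z)) has_derivative (\<lambda>e. exp ?w * (- \<i> * k * e))) (at z)" .
  have "((\<lambda>z. exp (- \<i> * k * z) * of_real (exp_potential (- \<i> * k * z)) * (1 / of_real pi)) has_derivative
    (\<lambda>e. (exp ?w * of_real (2 * Re (exp (- ?w) / ?w * (- \<i> * k * e)))
       + exp ?w * (- \<i> * k * e) * of_real (exp_potential ?w)) * (1 / of_real pi))) (at z)"
    by (intro has_derivative_mult_left has_derivative_mult 2 has_derivative_of_real 1)
  moreover have "(exp ?w * of_real (2 * Re (exp (- ?w) / ?w * (- \<i> * k * e)))
       + exp ?w * (- \<i> * k * e) * of_real (exp_potential ?w)) * (1 / of_real pi)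
     = (1 / (of_real pi * z) - \<i> * k * faddeev_green k z) * e + e_osc (- k) z / (of_real pi * cnj z) * cnj e" for e
  proof -
    have "exp (- ?w) / ?w * (- \<i> * k * e) = exp (- ?w) * (e / z)"
      using assms by (simp add: field_simps)
    moreover have "of_real (2 * Re u) = u + cnj u" for u
      by (simp add: complex_eq_iff)
    ultimately have "of_real (2 * Re (exp (- ?w) / ?w * (- \<i> * k * e)))
        = exp (- ?w) * (e / z) + cnj (exp (- ?w) * (e / z))"
      by metis
    also have "\<dots> = exp (- ?w) * (e / z) + exp (- cnj ?w) * (cnj e / cnj z)"
      by (simp add: exp_cnj)
    finally have "exp ?w * of_real (2 * Re (exp (- ?w) / ?w * (- \<i> * k * e)))
       = (exp ?w * exp (- ?w)) * (e / z) + (exp ?w * exp (- cnj ?w)) * (cnj e / cnj z)"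
      by (simp add: algebra_simps)
    also have "exp ?w * exp (- cnj ?w) = e_osc (- k) z"
      by (simp add: e_osc_def algebra_simps flip: exp_add)
    also have "exp ?w * exp (- ?w) = 1"
      by (simp flip: exp_add)
    finally show ?thesis
      by (simp add: faddeev_green_def add_divide_distrib diff_divide_distrib algebra_simps)
  qed
  ultimately show ?thesis
    unfolding faddeev_green_def[abs_def] by (simp add: divide_inverse)
qed

text \<open>
  The identity behind the theorem. The argument \<open>- i k z\<close> is invariant under \<open>(k, z) \<mapsto> (- k, - z)\<close> and the potential
  is real, so only the exponential factor feels the conjugation.
\<close>

lemma faddeev_green_symmetry: "e_osc k z * faddeev_green k z = cnj (faddeev_green (- k) (- z))"
proof -
  have "e_osc k z * exp (- \<i> * k * z) = exp (\<i> * (cnj k * cnj z))"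
    by (simp add: e_osc_def algebra_simps flip: exp_add)
  moreover have "cnj (exp (- \<i> * k * z)) = exp (\<i> * (cnj k * cnj z))"
    by (simp add: exp_cnj mult.assoc)
  ultimately show ?thesis
    by (simp add: faddeev_green_def mult.assoc[symmetric])
qed

section \<open>Integration by parts against weakly singular kernels\<close>

lemma integrable_lborel_shift:
  fixes f :: "complex \<Rightarrow> complex"
  assumes "integrable lborel f"
  shows "integrable lborel (\<lambda>x. f (x + c))"
proof -
  have "integrable (distr lborel borel ((+) c)) f"
    using assms by (simp add: lborel_distr_plus)
  then show ?thesis
    by (subst (asm) integrable_distr_eq) (use assms in \<open>auto simp: add.commute\<close>)
qed

lemma integral_lborel_shift:
  fixes f :: "complex \<Rightarrow> complex"
  assumes [measurable]: "f \<in> borel_measurable borel"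
  shows "(\<integral>x. f (x + c) \<partial>lborel) = (\<integral>x. f x \<partial>lborel)"
proof -
  have "(\<integral>x. f x \<partial>lborel) = (\<integral>x. f x \<partial>(distr lborel borel ((+) c)))"
    by (simp add: lborel_distr_plus)
  also have "\<dots> = (\<integral>x. f (x + c) \<partial>lborel)"
    by (subst integral_distr) (auto simp: add.commute)
  finally show ?thesis ..
qed

lemma AE_off_line:
  fixes y e :: complex
  shows "AE x in lborel. \<forall>s::real. x + s *\<^sub>R e \<noteq> y"
proof -
  let ?S = "(\<lambda>s::real. y - s *\<^sub>R e) ` UNIV"
  have "dim (span {e}) < DIM(complex)"
    using dim_span[of "{e}"] dim_le_card'[of "{e}"] by simp
  then have "negligible (span {e})"
    by (rule negligible_lowdim)
  then have "negligible ((+) y ` span {e})"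
    by (rule negligible_translation)
  moreover have "?S \<subseteq> (+) y ` span {e}"
  proof
    fix x assume "x \<in> ?S"
    then obtain s where "x = y + (- s) *\<^sub>R e" by auto
    then show "x \<in> (+) y ` span {e}"
      by (intro image_eqI[of _ _ "(- s) *\<^sub>R e"]) (auto intro: span_scale span_base span_neg)
  qed
  ultimately have "negligible ?S"
    by (rule negligible_subset)
  then have "?S \<in> null_sets lebesgue"
    by (simp add: negligible_iff_null_sets)
  then have "AE x in lebesgue. x \<notin> ?S"
    by (rule AE_not_in)
  then have "AE x in lborel. x \<notin> ?S"
    by (simp add: AE_completion_iff)
  then show ?thesis
    by (rule AE_mp) (auto intro!: AE_I2 simp: image_iff algebra_simps)
qed

text \<open>
  The integral of \<open>F (x + e) - F x\<close> vanishes by translation invariance, and for almost every \<open>x\<close> this difference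
  is the integral of \<open>D\<close> along the segment from \<open>x\<close> to \<open>x + e\<close>, because almost every segment misses the
  singular point \<open>y\<close>. So an isolated singularity produces no boundary term as long as \<open>F\<close> and \<open>D\<close> are integrable.
\<close>

theorem integral_directional_derivative_zero:
  fixes F D :: "complex \<Rightarrow> complex"
  assumes F: "integrable lborel F" and D: "integrable lborel D"
    and der: "\<And>x. x \<noteq> y \<Longrightarrow> \<exists>F'. (F has_derivative F') (at x) \<and> F' e = D x"
  shows "(\<integral>x. D x \<partial>lborel) = 0"
proof -
  have [measurable]: "D \<in> borel_measurable borel" "F \<in> borel_measurable borel"
    using F D by auto
  define H where "H = (\<lambda>(x, s::real). indicator {0..1} s *\<^sub>R D (x + s *\<^sub>R e))"
  have [measurable]: "H \<in> borel_measurable (lborel \<Otimes>\<^sub>M lborel)"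
    unfolding H_def by (simp add: indicator_def case_prod_unfold)
  have H_int: "integrable (lborel \<Otimes>\<^sub>M lborel) H"
  proof (rule integrableI_bounded)
    have "(\<integral>\<^sup>+ z. norm (H z) \<partial>(lborel \<Otimes>\<^sub>M lborel)) = (\<integral>\<^sup>+ s. (\<integral>\<^sup>+ x. norm (H (x, s)) \<partial>lborel) \<partial>lborel)"
      by (rule lborel_pair.nn_integral_snd[symmetric]) simp
    also have "\<dots> = (\<integral>\<^sup>+ s. (\<integral>\<^sup>+ x. norm (D x) \<partial>lborel) * indicator {0..1::real} s \<partial>lborel)"
    proof (rule nn_integral_cong)
      fix s :: real
      have "(\<integral>\<^sup>+ x. norm (D (x + s *\<^sub>R e)) \<partial>lborel) = (\<integral>\<^sup>+ x. norm (D x) \<partial>lborel)"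
        using nn_integral_lborel_shift[of "\<lambda>x. ennreal (norm (D x))" "- s *\<^sub>R e"] by simp
      then show "(\<integral>\<^sup>+ x. norm (H (x, s)) \<partial>lborel) = (\<integral>\<^sup>+ x. norm (D x) \<partial>lborel) * indicator {0..1} s"
        by (cases "s \<in> {0..1}") (auto simp: H_def)
    qed
    also have "\<dots> = (\<integral>\<^sup>+ x. norm (D x) \<partial>lborel)"
      by (simp add: nn_integral_cmult_indicator)
    also have "\<dots> < \<infinity>"
      using D by (simp add: integrable_iff_bounded)
    finally show "(\<integral>\<^sup>+ z. norm (H z) \<partial>(lborel \<Otimes>\<^sub>M lborel)) < \<infinity>" .
  qed simp
  have line: "AE x in lborel. (\<integral>s. H (x, s) \<partial>lborel) = F (x + e) - F x"
    using AE_off_line[of e y] lborel_pair.AE_integrable_fst'[OF H_int]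
  proof eventually_elim
    case (elim x)
    have vd: "((\<lambda>s. F (x + s *\<^sub>R e)) has_vector_derivative D (x + s *\<^sub>R e)) (at s within T)" for s T
    proof -
      obtain F' where F': "(F has_derivative F') (at (x + s *\<^sub>R e))" "F' e = D (x + s *\<^sub>R e)"
        using der[of "x + s *\<^sub>R e"] elim by auto
      have "((\<lambda>s. x + s *\<^sub>R e) has_derivative (\<lambda>h. h *\<^sub>R e)) (at s within T)"
        by (auto intro!: derivative_eq_intros)
      from has_derivative_compose[OF this F'(1)]
      have "((\<lambda>s. F (x + s *\<^sub>R e)) has_derivative (\<lambda>h. F' (h *\<^sub>R e))) (at s within T)" .
      moreover have "F' (h *\<^sub>R e) = h *\<^sub>R D (x + s *\<^sub>R e)" for h
        using F' by (simp add: linear_simps(5)[OF has_derivative_bounded_linear])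
      ultimately show ?thesis
        by (simp add: has_vector_derivative_def)
    qed
    have "((\<lambda>s. D (x + s *\<^sub>R e)) has_integral F (x + 1 *\<^sub>R e) - F (x + 0 *\<^sub>R e)) {0..1}"
      by (intro fundamental_theorem_of_calculus vd) simp
    then have "integral {0..1} (\<lambda>s. D (x + s *\<^sub>R e)) = F (x + e) - F x"
      by (simp add: integral_unique)
    moreover have "set_integrable lborel {0..1} (\<lambda>s. D (x + s *\<^sub>R e))"
      using elim by (simp add: H_def set_integrable_def)
    ultimately show ?case
      using set_borel_integral_eq_integral(2)[of "{0..1}" "\<lambda>s. D (x + s *\<^sub>R e)"]
      by (simp add: H_def set_lebesgue_integral_def)
  qed
  have "(\<integral>x. (\<integral>s. H (x, s) \<partial>lborel) \<partial>lborel) = (\<integral>x. F (x + e) - F x \<partial>lborel)"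
    by (intro integral_cong_AE line) measurable
  also have "\<dots> = 0"
    using F integral_lborel_shift[of F e] by (simp add: integrable_lborel_shift)
  finally have 0: "(\<integral>x. (\<integral>s. H (x, s) \<partial>lborel) \<partial>lborel) = 0" .
  have "(\<integral>s. (\<integral>x. H (x, s) \<partial>lborel) \<partial>lborel) = (\<integral>x. (\<integral>s. H (x, s) \<partial>lborel) \<partial>lborel)"
    using lborel_pair.Fubini_integral[of "\<lambda>x s. H (x, s)"] H_int by simp
  moreover have "(\<integral>x. H (x, s) \<partial>lborel) = indicator {0..1} s *\<^sub>R (\<integral>x. D x \<partial>lborel)" for s
    using integral_lborel_shift[of D "s *\<^sub>R e"] by (simp add: H_def)
  ultimately show ?thesis
    using 0 by simp
qed

text \<open>
  Continuously differentiable with compact support; the derivative is carried along as the function \<open>f'\<close>. Unlike test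
  functions, these may be modified by the \<open>C\<^sup>1\<close> cap below.
\<close>

definition C1_compact :: "(complex \<Rightarrow> complex) \<Rightarrow> (complex \<Rightarrow> complex \<Rightarrow> complex) \<Rightarrow> bool" where
  "C1_compact f f' \<longleftrightarrow> (\<forall>x. (f has_derivative f' x) (at x)) \<and> (\<forall>e. continuous_on UNIV (\<lambda>x. f' x e)) \<and>
     (\<exists>R. \<forall>x. norm x > R \<longrightarrow> f x = 0 \<and> (\<forall>e. f' x e = 0))"

lemma bounded_of_continuous_compact_support:
  fixes f :: "complex \<Rightarrow> complex"
  assumes "continuous_on UNIV f" "\<And>x. norm x > R \<Longrightarrow> f x = 0"
  shows "\<exists>M\<ge>0. \<forall>x. norm (f x) \<le> M"
proof -
  have "compact (f ` cball 0 R)"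
    by (intro compact_continuous_image continuous_on_subset[OF assms(1)]) auto
  then obtain M where M: "\<And>x. norm x \<le> R \<Longrightarrow> norm (f x) \<le> M"
    using compact_imp_bounded bounded_iff by (metis (no_types, lifting) imageI mem_cball_0)
  have "norm (f x) \<le> max M 0" for x
    using M[of x] assms(2)[of x] by (cases "norm x \<le> R") auto
  then show ?thesis
    by (intro exI[of _ "max M 0"]) auto
qed

lemma C1_compactD:
  assumes "C1_compact f f'"
  shows "(f has_derivative f' x) (at x)" "continuous_on UNIV f" "continuous_on UNIV (\<lambda>x. f' x e)"
    "f \<in> borel_measurable borel" "(\<lambda>x. f' x e) \<in> borel_measurable borel"
proof -
  show d: "(f has_derivative f' x) (at x)" for x
    using assms by (auto simp: C1_compact_def)
  show c: "continuous_on UNIV f"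
    by (intro continuous_at_imp_continuous_on ballI has_derivative_continuous[OF d])
  show c': "continuous_on UNIV (\<lambda>x. f' x e)"
    using assms by (auto simp: C1_compact_def)
  show "f \<in> borel_measurable borel" "(\<lambda>x. f' x e) \<in> borel_measurable borel"
    using c c' by (auto intro: borel_measurable_continuous_onI)
qed

lemma C1_compact_support:
  assumes "C1_compact f f'"
  obtains R M where "R > 0" "M > 0" "\<And>x. norm x > R \<Longrightarrow> f x = 0" "\<And>x e. norm x > R \<Longrightarrow> f' x e = 0"
    "\<And>x. norm (f x) \<le> M" "\<And>x. norm (f' x 1) \<le> M" "\<And>x. norm (f' x \<i>) \<le> M"
proof -
  obtain R where R: "\<And>x. norm x > R \<Longrightarrow> f x = 0" "\<And>x e. norm x > R \<Longrightarrow> f' x e = 0"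
  proof -
    from assms obtain R where "\<forall>x. norm x > R \<longrightarrow> f x = 0 \<and> (\<forall>e. f' x e = 0)"
      unfolding C1_compact_def by blast
    then show ?thesis
      by (intro that[of R]) blast+
  qed
  obtain A B C where "A \<ge> 0" "B \<ge> 0" "C \<ge> 0" and b: "\<And>x. norm (f x) \<le> A" "\<And>x. norm (f' x 1) \<le> B" "\<And>x. norm (f' x \<i>) \<le> C"
    using bounded_of_continuous_compact_support[OF C1_compactD(2)[OF assms] R(1)]
      bounded_of_continuous_compact_support[OF C1_compactD(3)[OF assms] R(2)] by metis
  then show ?thesis
    using R by (intro that[of "\<bar>R\<bar> + 1" "A + B + C + 1"]) (auto intro: order_trans[OF b(1)] order_trans[OF b(2)] order_trans[OF b(3)])
qed

lemma nn_integral_singular_kernel_bound: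
  fixes y :: complex
  assumes "R > 0" "M \<ge> 0"
  shows "(\<integral>\<^sup>+x. ennreal (M * indicator (cball 0 R) x / norm (x - y)) \<partial>lborel)
    \<le> ennreal (M * (2 * pi + pi * R\<^sup>2))"
proof -
  have "(\<integral>\<^sup>+x. ennreal (M * indicator (cball 0 R) x / norm (x - y)) \<partial>lborel)
     \<le> (\<integral>\<^sup>+x. ennreal M * (ennreal (norm (x - y) powr -1) * indicator (ball y 1) x) + ennreal M * indicator (cball (0::complex) R) x \<partial>lborel)"
  proof (rule nn_integral_mono)
    fix x :: complex
    show "ennreal (M * indicator (cball 0 R) x / norm (x - y))
      \<le> ennreal M * (ennreal (norm (x - y) powr -1) * indicator (ball y 1) x) + ennreal M * indicator (cball 0 R) x"
    proof (cases "x \<in> ball y 1")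
      case True
      have "M * indicator (cball 0 R) x / norm (x - y) \<le> M * 1 / norm (x - y)"
        using assms by (intro divide_right_mono mult_left_mono) (auto simp: indicator_def)
      also have "\<dots> = M * norm (x - y) powr -1"
        by (cases "x = y") (simp_all add: powr_minus inverse_eq_divide)
      finally have "ennreal (M * indicator (cball 0 R) x / norm (x - y)) \<le> ennreal (M * norm (x - y) powr -1)"
        by (rule ennreal_leI)
      also have "\<dots> = ennreal M * (ennreal (norm (x - y) powr -1) * indicator (ball y 1) x)"
        using True assms by (simp flip: ennreal_mult)
      finally show ?thesis
        by (rule order_trans) simp
    next
      case False
      then have "norm (x - y) \<ge> 1"
        by (auto simp: dist_norm norm_minus_commute)
      then have "M * indicator (cball 0 R) x / norm (x - y) \<le> M * indicator (cball 0 R) x / 1"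
        using assms by (intro divide_left_mono) auto
      then have "ennreal (M * indicator (cball 0 R) x / norm (x - y)) \<le> ennreal (M * indicator (cball 0 R) x)"
        by (intro ennreal_leI) simp
      also have "\<dots> = ennreal M * indicator (cball 0 R) x"
        by (auto simp: indicator_def)
      finally show ?thesis
        by (auto intro: add_increasing)
    qed
  qed
  also have "\<dots> = ennreal M * (\<integral>\<^sup>+x. ennreal (norm (x - y) powr -1) * indicator (ball y 1) x \<partial>lborel) + ennreal M * emeasure lborel (cball (0::complex) R)"
  proof -
    have m: "(\<lambda>x. ennreal (norm (x - y) powr -1) * indicator (ball y 1) x) \<in> borel_measurable lborel"
      by (intro borel_measurable_times_ennreal borel_measurable_indicator) auto
    have m': "(\<lambda>x. ennreal M * indicator (cball (0::complex) R) x) \<in> borel_measurable lborel"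
      by (intro borel_measurable_times_ennreal borel_measurable_indicator) auto
    show ?thesis
      by (subst nn_integral_add[OF borel_measurable_times_ennreal[OF borel_measurable_const m] m'],
          subst nn_integral_cmult[OF m], subst nn_integral_cmult_indicator) auto
  qed
  also have "\<dots> \<le> ennreal M * ennreal (2 * pi / (2 - 1) * 1 powr (2 - 1)) + ennreal M * ennreal (pi * R\<^sup>2)"
    using assms by (intro add_mono mult_left_mono nn_integral_norm_shift_near) (auto simp: emeasure_cball_complex)
  also have "\<dots> = ennreal (M * (2 * pi + pi * R\<^sup>2))"
    using assms by (simp add: algebra_simps flip: ennreal_mult ennreal_plus)
  finally show ?thesis .
qed

lemma integrable_singular_kernel:
  fixes g :: "complex \<Rightarrow> complex"
  assumes [measurable]: "g \<in> borel_measurable borel"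
    and "R > 0" "M \<ge> 0" and bd: "\<And>x. x \<noteq> y \<Longrightarrow> norm (g x) \<le> M / norm (x - y)"
    and supp: "\<And>x. norm x > R \<Longrightarrow> g x = 0"
  shows "integrable lborel g"
proof (rule integrableI_bounded)
  have "(\<integral>\<^sup>+x. ennreal (norm (g x)) \<partial>lborel) \<le> (\<integral>\<^sup>+x. ennreal (M * indicator (cball 0 R) x / norm (x - y)) \<partial>lborel)"
  proof (rule nn_integral_mono_AE)
    show "AE x in lborel. ennreal (norm (g x)) \<le> ennreal (M * indicator (cball 0 R) x / norm (x - y))"
      using AE_lborel_singleton[of y]
    proof eventually_elim
      case (elim x)
      then show ?case
        using bd[of x] supp[of x] by (intro ennreal_leI) (auto simp: indicator_def not_le)
    qed
  qed
  also have "\<dots> \<le> ennreal (M * (2 * pi + pi * R\<^sup>2))"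
    by (rule nn_integral_singular_kernel_bound) fact+
  finally show "(\<integral>\<^sup>+x. ennreal (norm (g x)) \<partial>lborel) < \<infinity>"
    by (auto simp: less_top top_unique intro: order_le_less_trans)
qed simp

text \<open>
  The class of kernels to which both the Hardy-Littlewood-Sobolev inequality and integration by parts apply.
\<close>

definition weakly_singular :: "(complex \<Rightarrow> complex) \<Rightarrow> bool" where
  "weakly_singular K \<longleftrightarrow> K \<in> borel_measurable borel \<and> (\<exists>C\<ge>0. \<forall>z\<noteq>0. norm (K z) \<le> C / norm z)"

lemma weakly_singular_add:
  assumes "weakly_singular K" "weakly_singular L"
  shows "weakly_singular (\<lambda>z. K z + L z)"
proof -
  have [measurable]: "K \<in> borel_measurable borel" "L \<in> borel_measurable borel"
    using assms by (auto simp: weakly_singular_def)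
  obtain A B where "A \<ge> 0" "B \<ge> 0" and b: "\<And>z. z \<noteq> 0 \<Longrightarrow> norm (K z) \<le> A / norm z" "\<And>z. z \<noteq> 0 \<Longrightarrow> norm (L z) \<le> B / norm z"
    using assms by (auto simp: weakly_singular_def)
  then have "norm (K z + L z) \<le> (A + B) / norm z" if "z \<noteq> 0" for z
    using b[OF that] norm_triangle_ineq[of "K z" "L z"] by (simp add: add_divide_distrib)
  then show ?thesis
    using \<open>A \<ge> 0\<close> \<open>B \<ge> 0\<close> unfolding weakly_singular_def by (intro conjI exI[of _ "A + B"]) auto
qed

lemma weakly_singular_cmult:
  assumes "weakly_singular K"
  shows "weakly_singular (\<lambda>z. K z * c)"
proof -
  have [measurable]: "K \<in> borel_measurable borel"
    using assms by (auto simp: weakly_singular_def)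
  obtain A where "A \<ge> 0" and b: "\<And>z. z \<noteq> 0 \<Longrightarrow> norm (K z) \<le> A / norm z"
    using assms by (auto simp: weakly_singular_def)
  have "norm (K z * c) \<le> (A * norm c) / norm z" if "z \<noteq> 0" for z
    using mult_right_mono[OF b[OF that], of "norm c"] by (simp add: norm_mult)
  then show ?thesis
    using \<open>A \<ge> 0\<close> unfolding weakly_singular_def by (intro conjI exI[of _ "A * norm c"]) auto
qed

lemma integrable_kernel_times:
  assumes K: "weakly_singular K" and [measurable]: "\<phi> \<in> borel_measurable borel"
    and "M \<ge> 0" "\<And>x. norm (\<phi> x) \<le> M" "\<forall>x. norm x > R \<longrightarrow> \<phi> x = 0"
  shows "integrable lborel (\<lambda>x. K (x - y) * \<phi> x)"
proof -
  have [measurable]: "K \<in> borel_measurable borel"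
    using K by (auto simp: weakly_singular_def)
  obtain A where "A \<ge> 0" and b: "\<And>z. z \<noteq> 0 \<Longrightarrow> norm (K z) \<le> A / norm z"
    using K by (auto simp: weakly_singular_def)
  show ?thesis
  proof (rule integrable_singular_kernel[of _ "\<bar>R\<bar> + 1" "A * M" y])
    fix x assume "x \<noteq> y"
    then show "norm (K (x - y) * \<phi> x) \<le> A * M / norm (x - y)"
      using mult_mono[OF b[of "x - y"] assms(4)[of x]] \<open>A \<ge> 0\<close> by (simp add: norm_mult)
  qed (use assms \<open>A \<ge> 0\<close> in auto)
qed

lemma kernel_integration_by_parts:
  assumes \<phi>: "C1_compact \<phi> \<phi>'" and e: "e = 1 \<or> e = \<i>"
    and K: "weakly_singular K" "weakly_singular D"
    and der: "\<And>z. z \<noteq> 0 \<Longrightarrow> \<exists>K'. (K has_derivative K') (at z) \<and> K' e = D z"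
  shows "(\<integral>x. K (x - y) * \<phi>' x e \<partial>lborel) = - (\<integral>x. D (x - y) * \<phi> x \<partial>lborel)"
proof -
  obtain R M where R: "R > 0" "M > 0" "\<And>x. norm x > R \<Longrightarrow> \<phi> x = 0" "\<And>x e. norm x > R \<Longrightarrow> \<phi>' x e = 0"
    "\<And>x. norm (\<phi> x) \<le> M" "\<And>x. norm (\<phi>' x 1) \<le> M" "\<And>x. norm (\<phi>' x \<i>) \<le> M"
    using C1_compact_support[OF \<phi>] by metis
  have 1: "integrable lborel (\<lambda>x. K (x - y) * \<phi>' x e)"
    using R e by (intro integrable_kernel_times[where M = M and R = R] K C1_compactD[OF \<phi>]) auto
  have 2: "integrable lborel (\<lambda>x. D (x - y) * \<phi> x)"
    using R e by (intro integrable_kernel_times[where M = M and R = R] K C1_compactD[OF \<phi>]) auto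
  have 3: "integrable lborel (\<lambda>x. K (x - y) * \<phi> x)"
    using R e by (intro integrable_kernel_times[where M = M and R = R] K C1_compactD[OF \<phi>]) auto
  have "(\<integral>x. K (x - y) * \<phi>' x e + D (x - y) * \<phi> x \<partial>lborel) = 0"
  proof (rule integral_directional_derivative_zero[OF 3, where y = y and e = e])
    fix x assume "x \<noteq> y"
    then obtain K' where K': "(K has_derivative K') (at (x - y))" "K' e = D (x - y)"
      using der[of "x - y"] by auto
    have "((\<lambda>x. x - y) has_derivative (\<lambda>h. h)) (at x)"
      by (auto intro!: derivative_eq_intros)
    from has_derivative_compose[OF this K'(1)]
    have "((\<lambda>x. K (x - y)) has_derivative K') (at x)" .
    from has_derivative_mult[OF this C1_compactD(1)[OF \<phi>, of x]]
    have hd: "((\<lambda>x. K (x - y) * \<phi> x) has_derivative (\<lambda>h. K (x - y) * \<phi>' x h + K' h * \<phi> x)) (at x)" .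
    show "\<exists>F'. ((\<lambda>x. K (x - y) * \<phi> x) has_derivative F') (at x) \<and> F' e = K (x - y) * \<phi>' x e + D (x - y) * \<phi> x"
      by (rule exI, rule conjI, rule hd) (simp only: K'(2))
  qed (use 1 2 in simp)
  then show ?thesis
    using 1 2 by (simp add: add_eq_0_iff2)
qed

section \<open>The Cauchy-Pompeiu formula\<close>

lemma positive_part_square_has_derivative:
  "((\<lambda>t::real. (max 0 t)\<^sup>2) has_real_derivative 2 * max 0 t) (at t)"
proof -
  consider "t > 0" | "t < 0" | "t = 0" by linarith
  then show ?thesis
  proof cases
    case 1
    have "((\<lambda>t::real. t\<^sup>2) has_real_derivative 2 * t) (at t)"
      by (auto intro!: derivative_eq_intros)
    then show ?thesis
      using 1 by (subst DERIV_cong_ev[OF refl _ refl, where g = "\<lambda>t. t\<^sup>2"])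
        (auto intro!: eventually_mono[OF eventually_nhds_in_open[of "{0<..}" t]])
  next
    case 2
    show ?thesis
      using 2 by (subst DERIV_cong_ev[OF refl _ refl, where g = "\<lambda>t. 0"])
        (auto intro!: eventually_mono[OF eventually_nhds_in_open[of "{..<0}" t]])
  next
    case 3
    have "((\<lambda>h::real. (max 0 h)\<^sup>2 / h) \<longlongrightarrow> 0) (at 0)"
    proof (rule Lim_null_comparison)
      show "\<forall>\<^sub>F h in at 0. norm ((max 0 h)\<^sup>2 / h) \<le> \<bar>h :: real\<bar>"
        by (intro always_eventually allI) (auto simp: max_def power2_eq_square)
      show "((\<lambda>h::real. \<bar>h\<bar>) \<longlongrightarrow> 0) (at 0)"
        by (intro tendsto_eq_intros) auto
    qed
    then show ?thesis
      using 3 by (simp add: has_field_derivative_iff)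
  qed
qed

text \<open>
  Its square is a compactly supported \<open>C\<^sup>1\<close> function with value \<open>1\<close> at \<open>y\<close>, for which the integral in the
  Cauchy-Pompeiu formula can be computed.
\<close>

definition cap :: "complex \<Rightarrow> complex \<Rightarrow> real" where
  "cap y x = max 0 (1 - (norm (x - y))\<^sup>2)"

lemma cap_square_C1_compact:
  "C1_compact (\<lambda>x. of_real ((cap y x)\<^sup>2)) (\<lambda>x e. of_real (2 * cap y x * (- 2 * inner (x - y) e)))"
  unfolding C1_compact_def
proof (intro conjI allI)
  fix x
  have "((\<lambda>x. 1 - inner (x - y) (x - y)) has_derivative (\<lambda>e. - 2 * inner (x - y) e)) (at x)"
    by (auto intro!: derivative_eq_intros simp: inner_commute)
  then have 1: "((\<lambda>x. 1 - (norm (x - y))\<^sup>2) has_derivative (\<lambda>e. - 2 * inner (x - y) e)) (at x)"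
    by (simp add: power2_norm_eq_inner)
  have "((\<lambda>t::real. (max 0 t)\<^sup>2) has_derivative (*) (2 * cap y x)) (at (1 - (norm (x - y))\<^sup>2))"
    using positive_part_square_has_derivative[of "1 - (norm (x - y))\<^sup>2"]
    by (simp add: has_field_derivative_def cap_def)
  from has_derivative_compose[OF 1 this]
  have "((\<lambda>x. (cap y x)\<^sup>2) has_derivative (\<lambda>e. 2 * cap y x * (- 2 * inner (x - y) e))) (at x)"
    unfolding cap_def .
  then show "((\<lambda>x. of_real ((cap y x)\<^sup>2) :: complex) has_derivative (\<lambda>e. of_real (2 * cap y x * (- 2 * inner (x - y) e)))) (at x)"
    by (rule has_derivative_of_real)
next
  fix e :: complex
  show "continuous_on UNIV (\<lambda>x. complex_of_real (2 * cap y x * (- 2 * inner (x - y) e)))"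
    unfolding cap_def by (intro continuous_intros)
next
  have "cap y x = 0" if "norm x > norm y + 1" for x
  proof -
    have "norm (x - y) \<ge> 1"
      using norm_triangle_ineq2[of x y] that by linarith
    then have "(norm (x - y))\<^sup>2 \<ge> 1"
      by (simp add: one_le_power)
    then show ?thesis
      by (simp add: cap_def)
  qed
  then show "\<exists>R. \<forall>x. R < norm x \<longrightarrow> complex_of_real ((cap y x)\<^sup>2) = 0 \<and> (\<forall>e. complex_of_real (2 * cap y x * (- 2 * inner (x - y) e)) = 0)"
    by (intro exI[of _ "norm y + 1"]) simp
qed

lemma cap_measurable [measurable]: "cap y \<in> borel_measurable borel"
  unfolding cap_def[abs_def] by measurable

text \<open>
  The layers of \<open>1 - |z|\<^sup>2\<close> are discs.
\<close>

lemma cap_integral: "integrable lborel (cap y)" "(\<integral>x. cap y x \<partial>lborel) = pi / 2"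
proof -
  have "(\<integral>\<^sup>+x. ennreal (cap y x) \<partial>lborel) = (\<integral>\<^sup>+x. ennreal (cap 0 (x - y)) \<partial>lborel)"
    by (simp add: cap_def)
  also have "\<dots> = (\<integral>\<^sup>+z. ennreal (cap 0 z) \<partial>lborel)"
    by (rule nn_integral_lborel_shift) simp
  also have "\<dots> = (\<integral>\<^sup>+z. (\<integral>\<^sup>+r. ennreal (2 * r) * indicator {norm (z::complex)..1} r \<partial>lborel) \<partial>lborel)"
  proof (rule nn_integral_cong)
    fix z :: complex
    show "ennreal (cap 0 z) = (\<integral>\<^sup>+r. ennreal (2 * r) * indicator {norm z..1} r \<partial>lborel)"
    proof (cases "norm z \<le> 1")
      case True
      have "(\<integral>\<^sup>+r. ennreal (2 * r) * indicator {norm z..1} r \<partial>lborel) = ennreal (1\<^sup>2 - (norm z)\<^sup>2)"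
      proof (rule nn_integral_FTC_Icc[where F = "\<lambda>r. r\<^sup>2"])
        fix r assume "r \<in> {norm z..1}"
        then show "0 \<le> 2 * r"
          by (auto intro: order_trans[OF norm_ge_zero])
      qed (use True in \<open>auto intro!: derivative_eq_intros\<close>)
      then show ?thesis
        using True by (simp add: cap_def abs_square_le_1)
    next
      case False
      then have "(norm z)\<^sup>2 > 1"
        by (simp add: one_less_power)
      then show ?thesis
        using False by (simp add: cap_def)
    qed
  qed
  also have "\<dots> = (\<integral>\<^sup>+r. (\<integral>\<^sup>+z. ennreal (2 * r) * indicator {norm (z::complex)..1} r \<partial>lborel) \<partial>lborel)"
    by (rule lborel_pair.Fubini') (simp add: indicator_def case_prod_unfold, measurable)
  also have "\<dots> = (\<integral>\<^sup>+r. ennreal (2 * pi * r ^ 3) * indicator {0..1} r \<partial>lborel)"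
  proof (rule nn_integral_cong)
    fix r :: real
    have "(\<integral>\<^sup>+z. ennreal (2 * r) * indicator {norm (z::complex)..1} r \<partial>lborel)
      = (\<integral>\<^sup>+z. ennreal (2 * r) * indicator {..1} r * indicator (cball (0::complex) r) z \<partial>lborel)"
      by (intro nn_integral_cong) (auto simp: indicator_def)
    also have "\<dots> = ennreal (2 * r) * indicator {..1} r * emeasure lborel (cball (0::complex) r)"
      by (subst nn_integral_cmult_indicator) auto
    also have "\<dots> = ennreal (2 * pi * r ^ 3) * indicator {0..1} r"
    proof (cases "r \<ge> 0")
      case True
      then show ?thesis
        by (auto simp: emeasure_cball_complex indicator_def power2_eq_square power3_eq_cube mult_ac simp flip: ennreal_mult)
    qed (simp add: ennreal_neg)
    finally show "(\<integral>\<^sup>+z. ennreal (2 * r) * indicator {norm (z::complex)..1} r \<partial>lborel) = ennreal (2 * pi * r ^ 3) * indicator {0..1} r" .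
  qed
  also have "\<dots> = ennreal (pi / 2 * 1 ^ 4 - pi / 2 * 0 ^ 4)"
    by (rule nn_integral_FTC_Icc[where F = "\<lambda>r. pi / 2 * r ^ 4"]) (auto intro!: derivative_eq_intros)
  finally have nn: "(\<integral>\<^sup>+x. ennreal (cap y x) \<partial>lborel) = ennreal (pi / 2)"
    by simp
  have pos: "cap y x \<ge> 0" for x
    by (simp add: cap_def)
  show "integrable lborel (cap y)"
    by (rule integrableI_nonneg) (use nn pos in auto)
  show "(\<integral>x. cap y x \<partial>lborel) = pi / 2"
    by (rule integral_eq_nn_integral[THEN trans]) (use nn pos in auto)
qed

lemma C1_compact_diff_cmult:
  assumes "C1_compact f f'" "C1_compact g g'"
  shows "C1_compact (\<lambda>x. f x - c * g x) (\<lambda>x e. f' x e - c * g' x e)"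
proof -
  obtain R M where R: "\<And>x. norm x > R \<Longrightarrow> f x = 0" "\<And>x e. norm x > R \<Longrightarrow> f' x e = 0"
    using C1_compact_support[OF assms(1)] by metis
  obtain S N where S: "\<And>x. norm x > S \<Longrightarrow> g x = 0" "\<And>x e. norm x > S \<Longrightarrow> g' x e = 0"
    using C1_compact_support[OF assms(2)] by metis
  show ?thesis
    unfolding C1_compact_def
  proof (intro conjI allI)
    show "((\<lambda>x. f x - c * g x) has_derivative (\<lambda>e. f' x e - c * g' x e)) (at x)" for x
      by (intro has_derivative_diff has_derivative_mult_right C1_compactD(1)[OF assms(1)] C1_compactD(1)[OF assms(2)])
    show "continuous_on UNIV (\<lambda>x. f' x e - c * g' x e)" for e
      by (intro continuous_intros C1_compactD(3)[OF assms(1)] C1_compactD(3)[OF assms(2)])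
    show "\<exists>R. \<forall>x. R < norm x \<longrightarrow> f x - c * g x = 0 \<and> (\<forall>e. f' x e - c * g' x e = 0)"
      using R S by (intro exI[of _ "max R S"]) simp
  qed
qed

lemma C1_compact_lipschitz:
  assumes "C1_compact f f'"
  shows "\<exists>L\<ge>0. \<forall>x y. norm (f x - f y) \<le> L * norm (x - y)"
proof -
  obtain R M where M: "M > 0" "\<And>x. norm (f' x 1) \<le> M" "\<And>x. norm (f' x \<i>) \<le> M"
    using C1_compact_support[OF assms] by metis
  have "norm (f x - f y) \<le> 2 * M * norm (x - y)" for x y
  proof (rule differentiable_bound[where S = UNIV and f' = f'])
    fix x
    show "(f has_derivative f' x) (at x within UNIV)"
      using C1_compactD(1)[OF assms] by simp
    have lin: "linear (f' x)"
      using C1_compactD(1)[OF assms] by (rule has_derivative_linear)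
    show "onorm (f' x) \<le> 2 * M"
    proof (rule onorm_le)
      fix e
      have "e = Re e *\<^sub>R 1 + Im e *\<^sub>R \<i>"
        by (simp add: complex_eq_iff)
      then have "f' x e = Re e *\<^sub>R f' x 1 + Im e *\<^sub>R f' x \<i>"
        using linear_add[OF lin] linear_scale[OF lin] by metis
      then have "norm (f' x e) \<le> \<bar>Re e\<bar> * norm (f' x 1) + \<bar>Im e\<bar> * norm (f' x \<i>)"
        using norm_triangle_ineq[of "Re e *\<^sub>R f' x 1" "Im e *\<^sub>R f' x \<i>"] by simp
      also have "\<dots> \<le> norm e * M + norm e * M"
        using M by (intro add_mono mult_mono abs_Re_le_cmod abs_Im_le_cmod) auto
      finally show "norm (f' x e) \<le> 2 * M * norm e"
        by (simp add: algebra_simps)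
    qed
  qed auto
  then show ?thesis
    using M by (intro exI[of _ "2 * M"]) auto
qed

text \<open>
  Subtracting a multiple of the square of the cap reduces to a function \<open>\<psi>\<close> that vanishes at \<open>y\<close>. Then
  \<open>\<psi>(x) / (x - y)\<close> is bounded and its derivatives have only a weak singularity, so their integrals vanish. The
  subtracted function contributes the constant \<open>\<pi>\<close>, since its \<open>\<partial>\<close>bar-derivative is \<open>- 2 (x - y)\<close> times the cap.
\<close>

theorem cauchy_pompeiu:
  assumes \<phi>: "C1_compact \<phi> \<phi>'"
  shows "(\<integral>x. (1 / (of_real pi * (x - y))) * ((\<phi>' x 1 + \<i> * \<phi>' x \<i>) / 2) \<partial>lborel) = - \<phi> y"
proof -
  define \<psi> where "\<psi> x = \<phi> x - \<phi> y * of_real ((cap y x)\<^sup>2)" for x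
  define \<psi>' where "\<psi>' x e = \<phi>' x e - \<phi> y * of_real (2 * cap y x * (- 2 * inner (x - y) e))" for x e
  have \<psi>: "C1_compact \<psi> \<psi>'"
    unfolding \<psi>_def[abs_def] \<psi>'_def[abs_def] by (rule C1_compact_diff_cmult[OF \<phi> cap_square_C1_compact])
  have \<psi>0: "\<psi> y = 0"
    by (simp add: \<psi>_def cap_def)
  obtain L where L: "L \<ge> 0" "\<And>x. norm (\<psi> x) \<le> L * norm (x - y)"
    using C1_compact_lipschitz[OF \<psi>] \<psi>0 by (metis diff_zero)
  obtain R M where R: "R > 0" "M > 0" "\<And>x. norm x > R \<Longrightarrow> \<psi> x = 0" "\<And>x e. norm x > R \<Longrightarrow> \<psi>' x e = 0"
    "\<And>x. norm (\<psi> x) \<le> M" "\<And>x. norm (\<psi>' x 1) \<le> M" "\<And>x. norm (\<psi>' x \<i>) \<le> M"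
    using C1_compact_support[OF \<psi>] by metis
  note [measurable] = C1_compactD(4,5)[OF \<psi>] C1_compactD(4,5)[OF \<phi>]
  define F where "F x = \<psi> x / (x - y)" for x
  define D where "D e x = \<psi>' x e / (x - y) - \<psi> x * e / (x - y)\<^sup>2" for e x
  have F: "integrable lborel F"
  proof (rule integrable_singular_kernel[of _ R M y])
    show "F \<in> borel_measurable borel"
      unfolding F_def by measurable
    show "norm (F x) \<le> M / norm (x - y)" for x
      using R(5) by (simp add: F_def norm_divide divide_right_mono)
  qed (use R in \<open>auto simp: F_def\<close>)
  have D: "integrable lborel (D e)" if e: "e = 1 \<or> e = \<i>" for e
  proof (rule integrable_singular_kernel[of _ R "M + L" y])
    show "D e \<in> borel_measurable borel"
      unfolding D_def by measurable
    fix x assume x: "x \<noteq> y"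
    have "norm (D e x) \<le> norm (\<psi>' x e / (x - y)) + norm (\<psi> x * e / (x - y)\<^sup>2)"
      unfolding D_def by (rule norm_triangle_ineq4)
    also have "\<dots> = norm (\<psi>' x e) / norm (x - y) + norm (\<psi> x) / (norm (x - y))\<^sup>2"
      using e by (auto simp: norm_divide norm_mult norm_power)
    also have "\<dots> \<le> M / norm (x - y) + L * norm (x - y) / (norm (x - y))\<^sup>2"
      using e R L by (intro add_mono divide_right_mono) auto
    also have "\<dots> = (M + L) / norm (x - y)"
      using x by (simp add: power2_eq_square add_divide_distrib)
    finally show "norm (D e x) \<le> (M + L) / norm (x - y)" .
  qed (use R L e in \<open>auto simp: D_def\<close>)
  have D0: "(\<integral>x. D e x \<partial>lborel) = 0" if e: "e = 1 \<or> e = \<i>" for e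
  proof (rule integral_directional_derivative_zero[OF F D[OF e], where y = y and e = e])
    fix x assume x: "x \<noteq> y"
    have "((\<lambda>x. 1 / (x - y)) has_field_derivative - 1 / (x - y)\<^sup>2) (at x)"
      using x by (auto intro!: derivative_eq_intros simp: power2_eq_square)
    then have "((\<lambda>x. 1 / (x - y)) has_derivative (\<lambda>h. - 1 / (x - y)\<^sup>2 * h)) (at x)"
      by (rule has_field_derivative_imp_has_derivative)
    from has_derivative_mult[OF C1_compactD(1)[OF \<psi>, of x] this]
    have hd: "(F has_derivative (\<lambda>h. \<psi> x * (- 1 / (x - y)\<^sup>2 * h) + \<psi>' x h * (1 / (x - y)))) (at x)"
      by (simp add: F_def[abs_def])
    show "\<exists>F'. (F has_derivative F') (at x) \<and> F' e = D e x"
      by (rule exI, rule conjI, rule hd) (simp add: D_def)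
  qed
  have cap': "(\<integral>x. complex_of_real (4 * cap y x) \<partial>lborel) = 2 * of_real pi" "integrable lborel (\<lambda>x. complex_of_real (4 * cap y x))"
    using cap_integral[of y] by (simp_all only: integral_complex_of_real complex_of_real_integrable_eq integral_mult_right_zero integrable_mult_right) auto
  have "0 = (\<integral>x. D 1 x + \<i> * D \<i> x \<partial>lborel)"
    using D D0 by simp
  also have "\<dots> = (\<integral>x. (\<phi>' x 1 + \<i> * \<phi>' x \<i>) / (x - y) + \<phi> y * of_real (4 * cap y x) \<partial>lborel)"
  proof (rule integral_cong_AE)
    show "AE x in lborel. D 1 x + \<i> * D \<i> x = (\<phi>' x 1 + \<i> * \<phi>' x \<i>) / (x - y) + \<phi> y * of_real (4 * cap y x)"
      using AE_lborel_singleton[of y]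
    proof eventually_elim
      case (elim x)
      have w: "of_real (inner (x - y) 1) + \<i> * of_real (inner (x - y) \<i>) = x - y"
        by (simp add: complex_eq_iff inner_complex_def)
      have "D 1 x + \<i> * D \<i> x = (\<psi>' x 1 + \<i> * \<psi>' x \<i>) / (x - y)"
        by (simp add: D_def add_divide_distrib algebra_simps)
      also have "\<psi>' x 1 + \<i> * \<psi>' x \<i> = \<phi>' x 1 + \<i> * \<phi>' x \<i>
          + \<phi> y * of_real (4 * cap y x) * (of_real (inner (x - y) 1) + \<i> * of_real (inner (x - y) \<i>))"
        by (simp add: \<psi>'_def algebra_simps)
      finally show ?case
        unfolding w using elim by (simp add: add_divide_distrib)
    qed
  qed (unfold D_def, measurable)
  also have "\<dots> = (\<integral>x. (\<phi>' x 1 + \<i> * \<phi>' x \<i>) / (x - y) \<partial>lborel) + \<phi> y * (2 * of_real pi)"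
  proof -
    obtain R M where R: "R > 0" "M > 0" "\<And>x e. norm x > R \<Longrightarrow> \<phi>' x e = 0" "\<And>x. norm (\<phi>' x 1) \<le> M" "\<And>x. norm (\<phi>' x \<i>) \<le> M"
      using C1_compact_support[OF \<phi>] by metis
    have "integrable lborel (\<lambda>x. (\<phi>' x 1 + \<i> * \<phi>' x \<i>) / (x - y))"
    proof (rule integrable_singular_kernel[of _ R "2 * M" y])
      fix x
      have "norm (\<phi>' x 1 + \<i> * \<phi>' x \<i>) \<le> 2 * M"
        using norm_triangle_ineq[of "\<phi>' x 1" "\<i> * \<phi>' x \<i>"] R(4)[of x] R(5)[of x] by (simp add: norm_mult)
      then show "norm ((\<phi>' x 1 + \<i> * \<phi>' x \<i>) / (x - y)) \<le> 2 * M / norm (x - y)"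
        by (simp add: norm_divide divide_right_mono)
    qed (use R in auto)
    then show ?thesis
      using cap' by simp
  qed
  finally have "(\<integral>x. (\<phi>' x 1 + \<i> * \<phi>' x \<i>) / (x - y) \<partial>lborel) + \<phi> y * (2 * of_real pi) = 0"
    by (rule sym)
  then have "(\<integral>x. (\<phi>' x 1 + \<i> * \<phi>' x \<i>) / (x - y) \<partial>lborel) = - (\<phi> y * (2 * of_real pi))"
    by (rule eq_neg_iff_add_eq_0[THEN iffD2])
  moreover have "(1 / (of_real pi * (x - y))) * ((\<phi>' x 1 + \<i> * \<phi>' x \<i>) / 2) = 1 / (2 * of_real pi) * ((\<phi>' x 1 + \<i> * \<phi>' x \<i>) / (x - y))" for x
    by simp
  ultimately show ?thesis
    by (simp only: integral_mult_right_zero) simp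
qed

section \<open>Convolutions as distributions\<close>

definition convolve :: "(complex \<Rightarrow> complex) \<Rightarrow> (complex \<Rightarrow> complex) \<Rightarrow> complex \<Rightarrow> complex" where
  "convolve K f x = (\<integral>y. K (x - y) * f y \<partial>lborel)"

lemma convolve_measurable [measurable]:
  assumes [measurable]: "K \<in> borel_measurable borel" "f \<in> borel_measurable borel"
  shows "convolve K f \<in> borel_measurable borel"
  unfolding convolve_def[abs_def] by measurable

lemma integrable_kernel_product:
  fixes K f \<phi> :: "complex \<Rightarrow> complex"
  assumes K: "weakly_singular K" and f: "integrable lborel f" and [measurable]: "\<phi> \<in> borel_measurable borel"
    and M: "\<And>x. norm (\<phi> x) \<le> M" and R: "\<forall>x. norm x > R \<longrightarrow> \<phi> x = 0"
  shows "integrable (lborel \<Otimes>\<^sub>M lborel) (\<lambda>(x, y). K (x - y) * f y * \<phi> x)"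
proof (rule integrableI_bounded)
  have [measurable]: "K \<in> borel_measurable borel" "f \<in> borel_measurable borel"
    using K f by (auto simp: weakly_singular_def)
  obtain A where A: "A \<ge> 0" and b: "\<And>z. z \<noteq> 0 \<Longrightarrow> norm (K z) \<le> A / norm z"
    using K by (auto simp: weakly_singular_def)
  have M0: "M \<ge> 0"
    using order_trans[OF norm_ge_zero M[of 0]] .
  define S where "S = \<bar>R\<bar> + 1"
  have [measurable]: "cball (0::complex) S \<in> sets borel"
    by simp
  show "(\<lambda>(x, y). K (x - y) * f y * \<phi> x) \<in> borel_measurable (lborel \<Otimes>\<^sub>M lborel)"
    by measurable
  have "(\<integral>\<^sup>+ z. norm (case z of (x, y) \<Rightarrow> K (x - y) * f y * \<phi> x) \<partial>(lborel \<Otimes>\<^sub>M lborel))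
     = (\<integral>\<^sup>+ y. (\<integral>\<^sup>+ x. norm (K (x - y) * f y * \<phi> x) \<partial>lborel) \<partial>lborel)"
    by (subst lborel_pair.nn_integral_snd[symmetric]) auto
  also have "\<dots> \<le> (\<integral>\<^sup>+ y. ennreal (norm (f y)) * ennreal (A * M * (2 * pi + pi * S\<^sup>2)) \<partial>lborel)"
  proof (rule nn_integral_mono)
    fix y :: complex
    have "(\<integral>\<^sup>+ x. norm (K (x - y) * f y * \<phi> x) \<partial>lborel)
       \<le> (\<integral>\<^sup>+ x. ennreal (norm (f y)) * ennreal (A * M * indicator (cball 0 S) x / norm (x - y)) \<partial>lborel)"
    proof (rule nn_integral_mono_AE)
      show "AE x in lborel. ennreal (norm (K (x - y) * f y * \<phi> x)) \<le> ennreal (norm (f y)) * ennreal (A * M * indicator (cball 0 S) x / norm (x - y))"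
        using AE_lborel_singleton[of y]
      proof eventually_elim
        case (elim x)
        have "norm (K (x - y) * \<phi> x) \<le> A * M * indicator (cball 0 S) x / norm (x - y)"
        proof (cases "x \<in> cball 0 S")
          case True
          then show ?thesis
            using mult_mono[OF b[of "x - y"] M[of x]] elim A by (simp add: norm_mult)
        next
          case False
          then have "\<phi> x = 0"
            using R by (auto simp: S_def)
          then show ?thesis
            using False by simp
        qed
        then have "norm (f y) * norm (K (x - y) * \<phi> x) \<le> norm (f y) * (A * M * indicator (cball 0 S) x / norm (x - y))"
          by (intro mult_left_mono) auto
        then show ?case
          using A M0 by (simp add: norm_mult mult_ac flip: ennreal_mult)
      qed
    qed
    also have "\<dots> = ennreal (norm (f y)) * (\<integral>\<^sup>+ x. ennreal (A * M * indicator (cball 0 S) x / norm (x - y)) \<partial>lborel)"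
      by (rule nn_integral_cmult) measurable
    also have "\<dots> \<le> ennreal (norm (f y)) * ennreal (A * M * (2 * pi + pi * S\<^sup>2))"
      using A M0 by (intro mult_left_mono nn_integral_singular_kernel_bound) (auto simp: S_def)
    finally show "(\<integral>\<^sup>+ x. norm (K (x - y) * f y * \<phi> x) \<partial>lborel) \<le> \<dots>" .
  qed
  also have "\<dots> = (\<integral>\<^sup>+ y. ennreal (norm (f y)) \<partial>lborel) * ennreal (A * M * (2 * pi + pi * S\<^sup>2))"
    by (rule nn_integral_multc) measurable
  also have "\<dots> < \<infinity>"
    using f by (simp add: integrable_iff_bounded ennreal_mult_less_top)
  finally show "(\<integral>\<^sup>+ z. norm (case z of (x, y) \<Rightarrow> K (x - y) * f y * \<phi> x) \<partial>(lborel \<Otimes>\<^sub>M lborel)) < \<infinity>" .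
qed

text \<open>
  The convolution of \<open>K\<close> and \<open>f\<close>, paired with \<open>\<phi>\<close>, with the integrals in the other order. The inner integral
  exists for every \<open>y\<close>, whereas the one that defines the convolution exists only almost everywhere; linearity in
  \<open>K\<close> is therefore read off from this form.
\<close>

definition kernel_pairing :: "(complex \<Rightarrow> complex) \<Rightarrow> (complex \<Rightarrow> complex) \<Rightarrow> (complex \<Rightarrow> complex) \<Rightarrow> complex" where
  "kernel_pairing K f \<phi> = (\<integral>y. f y * (\<integral>x. K (x - y) * \<phi> x \<partial>lborel) \<partial>lborel)"

lemma convolve_pairing:
  assumes K: "weakly_singular K" and f: "integrable lborel f" and [measurable]: "\<phi> \<in> borel_measurable borel"
    and M: "\<And>x. norm (\<phi> x) \<le> M" and R: "\<forall>x. norm x > R \<longrightarrow> \<phi> x = 0"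
  shows "integrable lborel (\<lambda>x. convolve K f x * \<phi> x)"
    "integrable lborel (\<lambda>y. f y * (\<integral>x. K (x - y) * \<phi> x \<partial>lborel))"
    "(\<integral>x. convolve K f x * \<phi> x \<partial>lborel) = kernel_pairing K f \<phi>"
proof -
  note int = integrable_kernel_product[OF assms]
  have 1: "(\<integral>y. K (x - y) * f y * \<phi> x \<partial>lborel) = convolve K f x * \<phi> x" for x
    unfolding convolve_def by (rule integral_mult_left_zero)
  have 2: "(\<integral>x. K (x - y) * f y * \<phi> x \<partial>lborel) = f y * (\<integral>x. K (x - y) * \<phi> x \<partial>lborel)" for y
    by (subst integral_mult_right_zero[symmetric]) (simp add: mult_ac)
  show "integrable lborel (\<lambda>x. convolve K f x * \<phi> x)"
    using lborel_pair.integrable_fst'[OF int] by (simp only: prod.case 1)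
  show "integrable lborel (\<lambda>y. f y * (\<integral>x. K (x - y) * \<phi> x \<partial>lborel))"
    using lborel_pair.integrable_snd[OF int] by (simp only: prod.case 2)
  show "(\<integral>x. convolve K f x * \<phi> x \<partial>lborel) = kernel_pairing K f \<phi>"
    using lborel_pair.Fubini_integral[OF int] by (simp only: prod.case 1 2 kernel_pairing_def)
qed

lemma kernel_pairing_linear:
  assumes K: "weakly_singular K" "weakly_singular L" and f: "integrable lborel f" and \<phi>[measurable]: "\<phi> \<in> borel_measurable borel"
    and M: "\<And>x. norm (\<phi> x) \<le> M" and R: "\<forall>x. norm x > R \<longrightarrow> \<phi> x = 0"
  shows "kernel_pairing (\<lambda>z. K z * a + L z * b) f \<phi> = kernel_pairing K f \<phi> * a + kernel_pairing L f \<phi> * b"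
proof -
  have M0: "M \<ge> 0"
    using order_trans[OF norm_ge_zero M[of 0]] .
  have "(\<integral>x. (K (x - y) * a + L (x - y) * b) * \<phi> x \<partial>lborel)
      = (\<integral>x. K (x - y) * \<phi> x \<partial>lborel) * a + (\<integral>x. L (x - y) * \<phi> x \<partial>lborel) * b" for y
  proof -
    have "(\<integral>x. (K (x - y) * a + L (x - y) * b) * \<phi> x \<partial>lborel) = (\<integral>x. K (x - y) * \<phi> x * a + L (x - y) * \<phi> x * b \<partial>lborel)"
      by (simp add: algebra_simps)
    then show ?thesis
      using integrable_kernel_times[OF K(1) \<phi> M0 M R, where y = y] integrable_kernel_times[OF K(2) \<phi> M0 M R, where y = y] by simp
  qed
  then have "kernel_pairing (\<lambda>z. K z * a + L z * b) f \<phi>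
     = (\<integral>y. f y * (\<integral>x. K (x - y) * \<phi> x \<partial>lborel) * a + f y * (\<integral>x. L (x - y) * \<phi> x \<partial>lborel) * b \<partial>lborel)"
    by (simp add: kernel_pairing_def algebra_simps)
  also have "\<dots> = kernel_pairing K f \<phi> * a + kernel_pairing L f \<phi> * b"
    using convolve_pairing(2)[OF K(1) f \<phi> M R] convolve_pairing(2)[OF K(2) f \<phi> M R]
    by (simp add: kernel_pairing_def)
  finally show ?thesis .
qed

lemma test_function_C1_compact:
  assumes "\<phi> \<in> test_functions"
  shows "C1_compact \<phi> (\<lambda>x e. partial e \<phi> x)"
proof -
  have "\<phi> \<in> Cn (Suc 0)"
    using assms unfolding test_functions_def by blast
  then have d: "\<phi> differentiable (at x)" and c: "continuous_on UNIV (partial 1 \<phi>)" "continuous_on UNIV (partial \<i> \<phi>)" for x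
    by auto
  have hd: "(\<phi> has_derivative (\<lambda>e. partial e \<phi> x)) (at x)" for x
    unfolding partial_def using d[of x] by (simp add: frechet_derivative_works)
  have split: "partial e \<phi> x = Re e *\<^sub>R partial 1 \<phi> x + Im e *\<^sub>R partial \<i> \<phi> x" for e x
  proof -
    have lin: "linear (\<lambda>e. partial e \<phi> x)"
      using hd by (rule has_derivative_linear)
    have "e = Re e *\<^sub>R 1 + Im e *\<^sub>R \<i>"
      by (simp add: complex_eq_iff)
    then show ?thesis
      using linear_add[OF lin] linear_scale[OF lin] by metis
  qed
  have "bounded (closure {x. \<phi> x \<noteq> 0})"
    using assms by (auto simp: test_functions_def compact_imp_bounded)
  then obtain R where R: "\<And>x. x \<in> closure {x. \<phi> x \<noteq> 0} \<Longrightarrow> norm x \<le> R"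
    by (auto simp: bounded_iff)
  have z: "\<phi> x = 0 \<and> (\<forall>e. partial e \<phi> x = 0)" if "norm x > R" for x
  proof -
    let ?U = "- closure {x. \<phi> x \<noteq> 0}"
    have x: "x \<in> ?U"
      using R[of x] that by auto
    have "(\<phi> has_derivative (\<lambda>e. 0)) (at x)"
    proof (rule has_derivative_transform_within_open[where s = ?U])
      show "((\<lambda>x. 0) has_derivative (\<lambda>e. 0)) (at x)"
        by simp
      show "0 = \<phi> y" if "y \<in> ?U" for y
        using that closure_subset[of "{x. \<phi> x \<noteq> 0}"] by auto
    qed (use x in auto)
    then have "(\<lambda>e. partial e \<phi> x) = (\<lambda>e. 0)"
      using hd[of x] by (rule has_derivative_unique[rotated])
    moreover have "\<phi> x = 0"
      using x closure_subset[of "{x. \<phi> x \<noteq> 0}"] by auto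
    ultimately show ?thesis
      by metis
  qed
  show ?thesis
    unfolding C1_compact_def
  proof (intro conjI allI)
    show "continuous_on UNIV (\<lambda>x. partial e \<phi> x)" for e
      unfolding split[of e] by (intro continuous_intros c)
    show "\<exists>R. \<forall>x. R < norm x \<longrightarrow> \<phi> x = 0 \<and> (\<forall>e. partial e \<phi> x = 0)"
      using z by blast
  qed (rule hd)
qed

lemma partial_test_function:
  assumes "\<phi> \<in> test_functions" and e: "e = 1 \<or> e = \<i>"
  shows "partial e \<phi> \<in> test_functions"
proof -
  obtain R where R: "\<And>x. norm x > R \<Longrightarrow> partial e \<phi> x = 0"
    using C1_compact_support[OF test_function_C1_compact[OF assms(1)]] by metis
  have "{x. partial e \<phi> x \<noteq> 0} \<subseteq> cball 0 R"
    using R by (auto simp: not_less[symmetric])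
  then have "closure {x. partial e \<phi> x \<noteq> 0} \<subseteq> cball 0 R"
    by (intro closure_minimal) auto
  then have "compact (closure {x. partial e \<phi> x \<noteq> 0})"
    by (meson bounded_cball bounded_subset closed_closure compact_eq_bounded_closed)
  moreover have "partial e \<phi> \<in> Cn n" for n
  proof -
    have "\<phi> \<in> Cn (Suc n)"
      using assms(1) unfolding test_functions_def by blast
    then show ?thesis
      using e by auto
  qed
  ultimately show ?thesis
    by (simp add: test_functions_def)
qed

lemma test_function_bounds:
  assumes "\<phi> \<in> test_functions"
  obtains R M where "R > 0" "M > 0" "\<And>x. norm (\<phi> x) \<le> M" "\<And>x. norm x > R \<Longrightarrow> \<phi> x = 0"
  using C1_compact_support[OF test_function_C1_compact[OF assms]] by metis

lemma test_function_measurable: "\<phi> \<in> test_functions \<Longrightarrow> \<phi> \<in> borel_measurable borel"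
  by (rule C1_compactD(4)[OF test_function_C1_compact])

lemma distr_of_eq_lborel:
  assumes "f \<in> borel_measurable borel" "\<phi> \<in> test_functions"
  shows "distr_of f \<phi> = (\<integral>x. f x * \<phi> x \<partial>lborel)"
  unfolding distr_of_def using assms test_function_measurable[OF assms(2)]
  by (intro integral_completion) auto

lemma distr_of_convolve:
  assumes K: "weakly_singular K" and f: "integrable lborel f" and \<phi>: "\<phi> \<in> test_functions"
  shows "distr_of (convolve K f) \<phi> = kernel_pairing K f \<phi>"
proof -
  have [measurable]: "K \<in> borel_measurable borel" "f \<in> borel_measurable borel"
    using K f by (auto simp: weakly_singular_def)
  obtain R M where "R > 0" "M > 0" "\<And>x. norm (\<phi> x) \<le> M" "\<And>x. norm x > R \<Longrightarrow> \<phi> x = 0"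
    using test_function_bounds[OF \<phi>] by metis
  then show ?thesis
    using convolve_pairing(3)[OF K f test_function_measurable[OF \<phi>]]
    by (subst distr_of_eq_lborel[OF _ \<phi>]) auto
qed

lemma distr_partial_convolve:
  assumes K: "weakly_singular K" "weakly_singular D" and f: "integrable lborel f" and \<phi>: "\<phi> \<in> test_functions"
    and e: "e = 1 \<or> e = \<i>"
    and der: "\<And>z. z \<noteq> 0 \<Longrightarrow> \<exists>K'. (K has_derivative K') (at z) \<and> K' e = D z"
  shows "distr_partial e (distr_of (convolve K f)) \<phi> = distr_of (convolve D f) \<phi>"
proof -
  have "(\<integral>x. K (x - y) * partial e \<phi> x \<partial>lborel) = - (\<integral>x. D (x - y) * \<phi> x \<partial>lborel)" for y
    by (rule kernel_integration_by_parts[OF test_function_C1_compact[OF \<phi>] e K]) (rule der)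
  then have "kernel_pairing K f (partial e \<phi>) = - kernel_pairing D f \<phi>"
    by (simp add: kernel_pairing_def)
  then show ?thesis
    by (simp add: distr_partial_def distr_of_convolve[OF K(1) f partial_test_function[OF \<phi> e]] distr_of_convolve[OF K(2) f \<phi>])
qed

lemma integral_partial_test_function:
  assumes \<phi>: "\<phi> \<in> test_functions" and e: "e = 1 \<or> e = \<i>"
  shows "(\<integral>x. partial e \<phi> x \<partial>lborel) = 0"
proof -
  have int: "integrable lborel \<psi>" if tf: "\<psi> \<in> test_functions" for \<psi>
  proof -
    obtain R M where R: "R > 0" "M > 0" "\<And>x. norm (\<psi> x) \<le> M" "\<And>x. norm x > R \<Longrightarrow> \<psi> x = 0"
      using test_function_bounds[OF tf] by metis
    show ?thesis
    proof (rule integrableI_bounded_set[where A = "cball 0 R" and B = M])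
      show "emeasure lborel (cball (0::complex) R) < \<infinity>"
        using R by (simp add: emeasure_cball_complex)
    qed (use R test_function_measurable[OF tf] in \<open>auto intro!: AE_I2\<close>)
  qed
  show ?thesis
  proof (rule integral_directional_derivative_zero[OF int[OF \<phi>] int[OF partial_test_function[OF \<phi> e]]])
    fix x
    show "\<exists>F'. (\<phi> has_derivative F') (at x) \<and> F' e = partial e \<phi> x"
      using C1_compactD(1)[OF test_function_C1_compact[OF \<phi>]] by blast
  qed
qed

lemma convolve_in_Lp:
  assumes K: "weakly_singular K" and [measurable]: "f \<in> borel_measurable borel"
    and p: "1 < p" "p < 2" and f: "(\<integral>\<^sup>+x. ennreal (norm (f x) powr p) \<partial>lborel) < \<infinity>"
  shows "convolve K f \<in> Lp_space (sobolev_conj p)"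
proof -
  have [measurable]: "K \<in> borel_measurable borel"
    using K by (auto simp: weakly_singular_def)
  obtain A where A: "A \<ge> 0" and b: "\<And>z. z \<noteq> 0 \<Longrightarrow> norm (K z) \<le> A / norm z"
    using K by (auto simp: weakly_singular_def)
  have "(\<integral>\<^sup>+x. ennreal (norm (convolve K f x) powr sobolev_conj p) \<partial>lborel) < \<infinity>"
  proof (rule hardy_littlewood_sobolev_plane[where f = "\<lambda>x. A * norm (f x)" and p = p])
    show "1 / sobolev_conj p = 1 / p - 1 / 2"
      by (simp add: sobolev_conj_def)
    have "(\<integral>\<^sup>+x. ennreal ((A * norm (f x)) powr p) \<partial>lborel) = ennreal (A powr p) * (\<integral>\<^sup>+x. ennreal (norm (f x) powr p) \<partial>lborel)"
      using A by (simp add: powr_mult ennreal_mult nn_integral_cmult)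
    then show "(\<integral>\<^sup>+x. ennreal ((A * norm (f x)) powr p) \<partial>lborel) < \<infinity>"
      using f by (simp add: ennreal_mult_less_top)
    fix x
    show "ennreal (norm (convolve K f x)) \<le> (\<integral>\<^sup>+y. ennreal (A * norm (f y) / norm (x - y)) \<partial>lborel)"
    proof (cases "integrable lborel (\<lambda>y. K (x - y) * f y)")
      case True
      have "ennreal (norm (convolve K f x)) \<le> (\<integral>\<^sup>+y. ennreal (norm (K (x - y) * f y)) \<partial>lborel)"
        unfolding convolve_def by (rule integral_norm_bound_ennreal[OF True])
      also have "\<dots> \<le> (\<integral>\<^sup>+y. ennreal (A * norm (f y) / norm (x - y)) \<partial>lborel)"
      proof (rule nn_integral_mono_AE)
        show "AE y in lborel. ennreal (norm (K (x - y) * f y)) \<le> ennreal (A * norm (f y) / norm (x - y))"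
          using AE_lborel_singleton[of x]
        proof eventually_elim
          case (elim y)
          then show ?case
            using mult_right_mono[OF b[of "x - y"], of "norm (f y)"] by (intro ennreal_leI) (simp add: norm_mult)
        qed
      qed
      finally show ?thesis .
    next
      case False
      then show ?thesis
        by (simp add: convolve_def not_integrable_integral_eq)
    qed
  qed (use p A in auto)
  then have "integrable lborel (\<lambda>x. norm (convolve K f x) powr sobolev_conj p)"
    by (intro integrableI_bounded) auto
  then have "integrable lebesgue (\<lambda>x. norm (convolve K f x) powr sobolev_conj p)"
    by (subst integrable_completion) auto
  then show ?thesis
    by (auto simp: Lp_space_def intro!: measurable_completion)
qed

lemma locally_integrable_convolve:
  assumes K: "weakly_singular K" and f: "integrable lborel f"
  shows "locally_integrable (\<lambda>x. c + convolve K f x)"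
  unfolding locally_integrable_def
proof (intro allI impI)
  fix S :: "complex set" assume S: "compact S"
  have [measurable]: "K \<in> borel_measurable borel" "f \<in> borel_measurable borel"
    using K f by (auto simp: weakly_singular_def)
  have [measurable]: "S \<in> sets borel"
    using S by (simp add: borel_compact)
  obtain R where R: "\<And>x. x \<in> S \<Longrightarrow> norm x \<le> R"
    using compact_imp_bounded[OF S] by (auto simp: bounded_iff)
  have "integrable lborel (\<lambda>x. convolve K f x * indicator S x)"
    by (rule convolve_pairing(1)[OF K f, where M = 1 and R = R])
      (use R in \<open>force simp: indicator_def intro!: borel_measurable_indicator\<close>)+
  moreover have "integrable lborel (\<lambda>x. indicator S x *\<^sub>R c)"
    using emeasure_compact_finite[OF S] by (intro integrable_scaleR_left integrable_real_indicator) auto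
  ultimately have "integrable lborel (\<lambda>x. indicator S x *\<^sub>R c + convolve K f x * indicator S x)"
    by simp
  also have "(\<lambda>x. indicator S x *\<^sub>R c + convolve K f x * indicator S x) = (\<lambda>x. indicator S x *\<^sub>R (c + convolve K f x))"
    by (auto simp: indicator_def)
  finally have "integrable lebesgue (\<lambda>x. indicator S x *\<^sub>R (c + convolve K f x))"
    by (subst integrable_completion) auto
  then show "set_integrable lebesgue S (\<lambda>x. c + convolve K f x)"
    by (simp add: set_integrable_def)
qed

section \<open>Compactness of the integral operator\<close>

lemma ennreal_mult_bound:
  assumes "a \<le> b" "0 \<le> b" "0 \<le> c"
  shows "ennreal (a * c) \<le> ennreal b * ennreal c"
  using assms by (subst ennreal_mult[symmetric]) (auto intro!: ennreal_leI mult_right_mono)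

text \<open>
  The bound with \<open>a = 1\<close> gives the decay at infinity. Smaller exponents control the singularity in two ways: \<open>a < 2 / p'\<close>, with \<open>p'\<close> the exponent dual to \<open>p\<close>, makes \<open>G\<close> locally an element of \<open>L\<^sup>p\<^sup>'\<close>,
  and \<open>a < 1\<close> makes \<open>|z| G(z)\<close> continuous at the origin.
\<close>

locale subcritical_kernel =
  fixes G q :: "complex \<Rightarrow> complex" and p :: real
  assumes p_gt_1: "1 < p"
    and G_cont: "continuous_on (- {0}) G"
    and G_bound: "\<And>a. 0 < a \<Longrightarrow> a \<le> 1 \<Longrightarrow> \<exists>C. \<forall>z\<noteq>0. norm (G z) \<le> C * norm z powr - a"
    and q_int: "integrable lborel q"
    and q_Lp: "(\<integral>\<^sup>+x. ennreal (norm (q x) powr p) \<partial>lborel) < \<infinity>"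
begin

lemma G_measurable [measurable]: "G \<in> borel_measurable borel"
  by (rule borel_measurable_continuous_countable_exceptions[OF _ G_cont]) simp

lemma q_measurable [measurable]: "q \<in> borel_measurable borel"
  using q_int by auto

lemma G_weakly_singular: "weakly_singular G"
proof -
  obtain C where C: "\<And>z. z \<noteq> 0 \<Longrightarrow> norm (G z) \<le> C * norm z powr - 1"
    using G_bound[of 1] by auto
  have "norm (G z) \<le> \<bar>C\<bar> / norm z" if "z \<noteq> 0" for z
  proof -
    have "norm (G z) \<le> C / norm z"
      using C[OF that] that by (simp add: powr_minus inverse_eq_divide)
    also have "\<dots> \<le> \<bar>C\<bar> / norm z"
      by (intro divide_right_mono) auto
    finally show ?thesis .
  qed
  then show ?thesis
    unfolding weakly_singular_def by (intro conjI exI[of _ "\<bar>C\<bar>"]) auto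
qed

abbreviation abs_potential :: "complex \<Rightarrow> ennreal" where
  "abs_potential x \<equiv> (\<integral>\<^sup>+y. ennreal (norm (G (x - y)) * norm (q y)) \<partial>lborel)"

abbreviation near_potential :: "real \<Rightarrow> complex \<Rightarrow> ennreal" where
  "near_potential \<delta> x \<equiv> (\<integral>\<^sup>+y. ennreal (norm (G (x - y)) * norm (q y)) * indicator (ball x \<delta>) y \<partial>lborel)"

abbreviation potential_variation :: "complex \<Rightarrow> complex \<Rightarrow> ennreal" where
  "potential_variation x' x \<equiv> (\<integral>\<^sup>+y. ennreal (norm (G (x' - y) - G (x - y)) * norm (q y)) \<partial>lborel)"

text \<open>
  This uniform bound near the diagonal is where \<open>q \<in> L\<^sup>p\<close> for some \<open>p > 1\<close> enters. By Young's inequality the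
  integrand is at most \<open>l\<^sup>p |q|\<^sup>p\<close> plus a multiple of \<open>|x - y|\<^sup>-\<^sup>1\<close>; \<open>l\<close> is chosen first, then \<open>\<delta>\<close>.
\<close>

lemma near_diagonal_small:
  assumes "\<epsilon> > 0"
  shows "\<exists>\<delta>>0. \<forall>x. near_potential \<delta> x \<le> ennreal \<epsilon>"
proof -
  define p' where "p' = p / (p - 1)"
  have p': "p' > 1"
    using p_gt_1 by (simp add: p'_def field_simps)
  have conj: "1 / p + 1 / p' = 1"
    using p_gt_1 by (simp add: p'_def field_simps)
  \<comment> \<open>any exponent \<open>a < 2 / p'\<close> would do; with this one the power of \<open>|x - y|\<close> becomes \<open>a p' = 1\<close>\<close>
  define a where "a = 1 / p'"
  have a: "0 < a" "a \<le> 1" "a * p' = 1"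
    using p' by (auto simp: a_def)
  obtain C where C: "\<And>z. z \<noteq> 0 \<Longrightarrow> norm (G z) \<le> C * norm z powr - a"
    using G_bound[OF a(1,2)] by blast
  have C0: "C \<ge> 0"
    using order_trans[OF norm_ge_zero C[of 1]] by simp
  obtain N where N: "N \<ge> 0" "(\<integral>\<^sup>+x. ennreal (norm (q x) powr p) \<partial>lborel) = ennreal N"
    using q_Lp by (metis ennreal_cases infinity_ennreal_def less_irrefl)
  define l where "l = (\<epsilon> / (2 * (N + 1))) powr (1 / p)"
  have l: "l > 0"
    using assms N by (simp add: l_def)
  have lp: "l powr p * N \<le> \<epsilon> / 2"
  proof -
    have "l powr p * N = \<epsilon> / (2 * (N + 1)) * N"
      using p_gt_1 assms N by (simp add: l_def powr_powr)
    also have "\<dots> \<le> \<epsilon> / 2"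
      using assms N by (simp add: field_simps)
    finally show ?thesis .
  qed
  define K where "K = (C / l) powr p' * (2 * pi)"
  define \<delta> where "\<delta> = \<epsilon> / (2 * (K + 1))"
  have K: "K \<ge> 0"
    by (simp add: K_def)
  have \<delta>: "\<delta> > 0"
    using assms K by (simp add: \<delta>_def add_nonneg_pos)
  have K\<delta>: "K * \<delta> \<le> \<epsilon> / 2"
    using assms K by (simp add: \<delta>_def field_simps)
  have "near_potential \<delta> x \<le> ennreal \<epsilon>" for x
  proof -
    have "near_potential \<delta> x
      \<le> (\<integral>\<^sup>+y. ennreal (l powr p) * ennreal (norm (q y) powr p)
          + ennreal ((C / l) powr p') * (ennreal (norm (y - x) powr - 1) * indicator (ball x \<delta>) y) \<partial>lborel)"
    proof (rule nn_integral_mono_AE)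
      show "AE y in lborel. ennreal (norm (G (x - y)) * norm (q y)) * indicator (ball x \<delta>) y
        \<le> ennreal (l powr p) * ennreal (norm (q y) powr p)
          + ennreal ((C / l) powr p') * (ennreal (norm (y - x) powr - 1) * indicator (ball x \<delta>) y)"
        using AE_lborel_singleton[of x]
      proof eventually_elim
        case (elim y)
        then have y: "norm (y - x) > 0" by simp
        have "norm (G (x - y)) * norm (q y) \<le> (C * norm (y - x) powr - a) * norm (q y)"
          using C[of "x - y"] elim by (intro mult_right_mono) (auto simp: norm_minus_commute)
        also have "\<dots> = (l * norm (q y)) * (C / l * norm (y - x) powr - a)"
          using l by simp
        also have "\<dots> \<le> (l * norm (q y)) powr p / p + (C / l * norm (y - x) powr - a) powr p' / p'"
          using p_gt_1 p' conj l C0 by (intro Youngs_inequality) auto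
        also have "\<dots> \<le> (l * norm (q y)) powr p / 1 + (C / l * norm (y - x) powr - a) powr p' / 1"
          using p_gt_1 p' by (intro add_mono divide_left_mono) auto
        also have "\<dots> = l powr p * norm (q y) powr p + (C / l) powr p' * norm (y - x) powr - 1"
        proof -
          have "(C / l * norm (y - x) powr - a) powr p' = (C / l) powr p' * norm (y - x) powr (- (a * p'))"
            using l C0 by (subst powr_mult) (simp_all add: powr_powr)
          then show ?thesis
            using l unfolding a(3) by (simp add: powr_mult)
        qed
        finally have "ennreal (norm (G (x - y)) * norm (q y)) \<le> ennreal (l powr p * norm (q y) powr p + (C / l) powr p' * norm (y - x) powr - 1)"
          by (rule ennreal_leI)
        also have "\<dots> = ennreal (l powr p) * ennreal (norm (q y) powr p) + ennreal ((C / l) powr p') * ennreal (norm (y - x) powr - 1)"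
          by (simp only: ennreal_plus ennreal_mult powr_ge_zero mult_nonneg_nonneg)
        finally have le: "ennreal (norm (G (x - y)) * norm (q y)) \<le> \<dots>" .
        show ?case
        proof (cases "y \<in> ball x \<delta>")
          case True
          then have "indicator (ball x \<delta>) y = (1 :: ennreal)"
            by simp
          then show ?thesis
            using le by (simp only: mult_1_right)
        qed simp
      qed
    qed
    also have "\<dots> = ennreal (l powr p) * ennreal N
        + ennreal ((C / l) powr p') * (\<integral>\<^sup>+y. ennreal (norm (y - x) powr - 1) * indicator (ball x \<delta>) y \<partial>lborel)"
    proof -
      have m: "(\<lambda>y. ennreal (norm (y - x) powr - 1) * indicator (ball x \<delta>) y) \<in> borel_measurable lborel"
        by (intro borel_measurable_times_ennreal borel_measurable_indicator) auto
      have m': "(\<lambda>y. ennreal (norm (q y) powr p)) \<in> borel_measurable lborel"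
        by measurable
      show ?thesis
        by (subst nn_integral_add[OF borel_measurable_times_ennreal[OF borel_measurable_const m'] borel_measurable_times_ennreal[OF borel_measurable_const m]],
            subst nn_integral_cmult[OF m], subst nn_integral_cmult[OF m']) (simp add: N)
    qed
    also have "\<dots> \<le> ennreal (l powr p) * ennreal N + ennreal ((C / l) powr p') * ennreal (2 * pi / (2 - 1) * \<delta> powr (2 - 1))"
      using \<delta> by (intro add_left_mono mult_left_mono nn_integral_norm_shift_near) auto
    also have "\<dots> = ennreal (l powr p * N + K * \<delta>)"
      using N \<delta> by (simp add: K_def mult_ac flip: ennreal_mult ennreal_plus)
    also have "\<dots> \<le> ennreal \<epsilon>"
      using lp K\<delta> by (intro ennreal_leI) linarith
    finally show ?thesis .
  qed
  then show ?thesis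
    using \<delta> by blast
qed

text \<open>
  The kernel with its singularity softened at the scale \<open>\<delta>\<close>: continuous, bounded, and vanishing at infinity. So for it
  boundedness, decay and continuity of the potential follow from dominated convergence with the dominating function \<open>|q|\<close>, and the error is
  a near-diagonal contribution.
\<close>

definition softened :: "real \<Rightarrow> complex \<Rightarrow> complex" where
  "softened \<delta> z = G z * of_real (min 1 (norm z / \<delta>))"

lemma softened_measurable [measurable]: "softened \<delta> \<in> borel_measurable borel"
  unfolding softened_def[abs_def] by measurable

lemma softened_bound:
  shows "\<exists>C\<ge>0. \<forall>\<delta>>0. \<forall>z. norm (softened \<delta> z) \<le> C / \<delta> \<and> (z \<noteq> 0 \<longrightarrow> norm (softened \<delta> z) \<le> C / norm z)"
proof -
  obtain C where C: "C \<ge> 0" "\<And>z. z \<noteq> 0 \<Longrightarrow> norm (G z) \<le> C / norm z"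
    using G_weakly_singular by (auto simp: weakly_singular_def)
  have "norm (softened \<delta> z) \<le> C / \<delta>" if "\<delta> > 0" for \<delta> z
  proof (cases "z = 0")
    case False
    have "norm (softened \<delta> z) \<le> C / norm z * (norm z / \<delta>)"
      unfolding softened_def norm_mult using C False that by (intro mult_mono) auto
    then show ?thesis
      using False by simp
  qed (use C that in \<open>simp add: softened_def\<close>)
  moreover have "norm (softened \<delta> z) \<le> C / norm z" if "\<delta> > 0" "z \<noteq> 0" for \<delta> z
  proof -
    have "norm (softened \<delta> z) \<le> C / norm z * 1"
      unfolding softened_def norm_mult using C that by (intro mult_mono) auto
    then show ?thesis by simp
  qed
  ultimately show ?thesis
    using C by blast
qed

lemma softened_isCont:
  assumes "\<delta> > 0"
  shows "isCont (softened \<delta>) z"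
proof (cases "z = 0")
  case False
  have "isCont G z"
    using G_cont False by (simp add: continuous_on_eq_continuous_at open_Compl)
  then show ?thesis
    unfolding softened_def[abs_def] using assms by (intro continuous_intros) auto
next
  case True
  obtain C where C: "\<And>z. z \<noteq> 0 \<Longrightarrow> norm (G z) \<le> C * norm z powr - (1/2)"
    using G_bound[of "1/2"] by auto
  have "(softened \<delta> \<longlongrightarrow> 0) (at 0)"
  proof (rule Lim_null_comparison)
    have "norm (softened \<delta> z) \<le> C / \<delta> * norm z powr (1/2)" if z: "z \<noteq> 0" for z
    proof -
      have "norm (softened \<delta> z) \<le> (C * norm z powr - (1/2)) * (norm z / \<delta>)"
        unfolding softened_def norm_mult using C[OF z] assms order_trans[OF norm_ge_zero C[OF z]] by (intro mult_mono) auto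
      also have "\<dots> = C / \<delta> * (norm z powr - (1/2) * norm z powr 1)"
        by simp
      also have "norm z powr - (1/2) * norm z powr 1 = norm z powr (1/2)"
        by (simp only: powr_add[symmetric]) simp
      finally show ?thesis .
    qed
    then show "\<forall>\<^sub>F z in at 0. norm (softened \<delta> z) \<le> C / \<delta> * norm z powr (1/2)"
      by (simp add: eventually_at_filter)
    have "((\<lambda>z::complex. norm z powr (1/2)) \<longlongrightarrow> 0 powr (1/2)) (at 0)"
      by (intro tendsto_powr2 tendsto_norm_zero tendsto_const tendsto_ident_at) auto
    then show "((\<lambda>z::complex. C / \<delta> * norm z powr (1/2)) \<longlongrightarrow> 0) (at 0)"
      by (intro tendsto_mult_right_zero) simp
  qed
  then show ?thesis
    using True by (simp add: isCont_def softened_def)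
qed

lemma G_minus_softened: "\<delta> > 0 \<Longrightarrow> norm (G (x - y) - softened \<delta> (x - y)) \<le> norm (G (x - y)) * indicator (ball x \<delta>) y"
proof -
  assume \<delta>: "\<delta> > 0"
  have "norm (G (x - y) - softened \<delta> (x - y)) = norm (G (x - y)) * \<bar>1 - min 1 (norm (x - y) / \<delta>)\<bar>"
  proof -
    have "G (x - y) - softened \<delta> (x - y) = G (x - y) * of_real (1 - min 1 (norm (x - y) / \<delta>))"
      by (simp add: softened_def algebra_simps)
    then show ?thesis
      by (simp only: norm_mult norm_of_real)
  qed
  also have "\<dots> \<le> norm (G (x - y)) * indicator (ball x \<delta>) y"
    using \<delta> by (intro mult_left_mono) (auto simp: indicator_def dist_norm min_def field_simps)
  finally show ?thesis .
qed

lemma q_nn_finite: "(\<integral>\<^sup>+y. ennreal (norm (q y)) \<partial>lborel) < \<infinity>"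
  using q_int by (simp add: integrable_iff_bounded)

lemma softening_error:
  assumes \<delta>: "\<delta> > 0" and [measurable]: "K \<in> borel_measurable borel"
  shows "(\<integral>\<^sup>+y. ennreal (norm (G (x - y) - K y) * norm (q y)) \<partial>lborel)
    \<le> (\<integral>\<^sup>+y. ennreal (norm (softened \<delta> (x - y) - K y) * norm (q y)) \<partial>lborel)
      + near_potential \<delta> x"
proof -
  have m: "(\<lambda>y. ennreal (norm (G (x - y)) * norm (q y)) * indicator (ball x \<delta>) y) \<in> borel_measurable lborel"
    by (intro borel_measurable_times_ennreal borel_measurable_indicator) auto
  have "(\<integral>\<^sup>+y. ennreal (norm (G (x - y) - K y) * norm (q y)) \<partial>lborel)
    \<le> (\<integral>\<^sup>+y. ennreal (norm (softened \<delta> (x - y) - K y) * norm (q y)) + ennreal (norm (G (x - y)) * norm (q y)) * indicator (ball x \<delta>) y \<partial>lborel)"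
  proof (rule nn_integral_mono)
    fix y :: complex
    have "norm (G (x - y) - K y) \<le> norm (softened \<delta> (x - y) - K y) + norm (G (x - y)) * indicator (ball x \<delta>) y"
      using norm_triangle_ineq[of "G (x - y) - softened \<delta> (x - y)" "softened \<delta> (x - y) - K y"] G_minus_softened[OF \<delta>, of x y] by simp
    from mult_right_mono[OF this, of "norm (q y)"]
    have "ennreal (norm (G (x - y) - K y) * norm (q y))
      \<le> ennreal (norm (softened \<delta> (x - y) - K y) * norm (q y) + norm (G (x - y)) * norm (q y) * indicator (ball x \<delta>) y)"
      by (intro ennreal_leI) (simp add: algebra_simps)
    also have "\<dots> = ennreal (norm (softened \<delta> (x - y) - K y) * norm (q y)) + ennreal (norm (G (x - y)) * norm (q y)) * indicator (ball x \<delta>) y"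
      by (cases "y \<in> ball x \<delta>") (simp_all add: ennreal_plus)
    finally show "ennreal (norm (G (x - y) - K y) * norm (q y)) \<le> \<dots>" .
  qed
  also have "\<dots> = (\<integral>\<^sup>+y. ennreal (norm (softened \<delta> (x - y) - K y) * norm (q y)) \<partial>lborel)
      + near_potential \<delta> x"
    by (rule nn_integral_add[OF _ m]) measurable
  finally show ?thesis .
qed

lemma potential_bounded:
  "\<exists>B\<ge>0. \<forall>x. abs_potential x \<le> ennreal B"
proof -
  obtain \<delta> where \<delta>: "\<delta> > 0" "\<And>x. near_potential \<delta> x \<le> ennreal 1"
    using near_diagonal_small[of 1] by auto
  obtain C where C: "C \<ge> 0" "\<And>z. norm (softened \<delta> z) \<le> C / \<delta>"
    using softened_bound \<delta>(1) by metis
  obtain N where N: "N \<ge> 0" "(\<integral>\<^sup>+y. ennreal (norm (q y)) \<partial>lborel) = ennreal N"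
    using q_nn_finite by (metis ennreal_cases infinity_ennreal_def less_irrefl)
  have "abs_potential x \<le> ennreal (C / \<delta> * N + 1)" for x
  proof -
    have "(\<integral>\<^sup>+y. ennreal (norm (softened \<delta> (x - y)) * norm (q y)) \<partial>lborel) \<le> (\<integral>\<^sup>+y. ennreal (C / \<delta>) * ennreal (norm (q y)) \<partial>lborel)"
      using C \<delta>(1) by (intro nn_integral_mono ennreal_mult_bound) auto
    also have "\<dots> = ennreal (C / \<delta> * N)"
    proof -
      have "(\<integral>\<^sup>+y. ennreal (C / \<delta>) * ennreal (norm (q y)) \<partial>lborel) = ennreal (C / \<delta>) * ennreal N"
        unfolding N(2)[symmetric] by (rule nn_integral_cmult) measurable
      then show ?thesis
        using C \<delta>(1) N(1) by (simp flip: ennreal_mult)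
    qed
    finally have "abs_potential x \<le> ennreal (C / \<delta> * N) + ennreal 1"
      using order_trans[OF softening_error[OF \<delta>(1), of "\<lambda>y. 0" x] add_mono[OF _ \<delta>(2)]] by simp
    then show ?thesis
      using ennreal_plus[of "C / \<delta> * N" 1] C(1) \<delta>(1) N(1) by simp
  qed
  then show ?thesis
    using C \<delta>(1) N by (intro exI[of _ "C / \<delta> * N + 1"]) auto
qed

lemma potential_decay:
  assumes "\<epsilon> > 0"
  shows "\<exists>R. \<forall>x. norm x > R \<longrightarrow> abs_potential x \<le> ennreal \<epsilon>"
proof (rule ccontr)
  assume "\<not> ?thesis"
  then have "\<exists>x. norm x > real n \<and> \<not> abs_potential x \<le> ennreal \<epsilon>" for n
    by blast
  then obtain X where X: "\<And>n. norm (X n) > real n" "\<And>n. \<not> abs_potential (X n) \<le> ennreal \<epsilon>"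
    by metis
  obtain \<delta> where \<delta>: "\<delta> > 0" "\<And>x. near_potential \<delta> x \<le> ennreal (\<epsilon> / 2)"
    using near_diagonal_small[of "\<epsilon> / 2"] assms by auto
  obtain C where C: "C \<ge> 0" "\<And>z. norm (softened \<delta> z) \<le> C / \<delta>" "\<And>z. z \<noteq> 0 \<Longrightarrow> norm (softened \<delta> z) \<le> C / norm z"
    using softened_bound \<delta>(1) by metis
  have "(\<lambda>n. \<integral>\<^sup>+y. ennreal (norm (softened \<delta> (X n - y)) * norm (q y)) \<partial>lborel) \<longlonglongrightarrow> (\<integral>\<^sup>+(y::complex). 0 \<partial>lborel)"
  proof (rule nn_integral_dominated_convergence[where w = "\<lambda>y. ennreal (C / \<delta>) * ennreal (norm (q y))"])
    show "(\<integral>\<^sup>+y. ennreal (C / \<delta>) * ennreal (norm (q y)) \<partial>lborel) < \<infinity>"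
      using q_nn_finite by (simp add: nn_integral_cmult ennreal_mult_less_top)
    show "AE y in lborel. ennreal (norm (softened \<delta> (X n - y)) * norm (q y)) \<le> ennreal (C / \<delta>) * ennreal (norm (q y))" for n
      using C \<delta>(1) by (intro AE_I2 ennreal_mult_bound) auto
    show "AE y in lborel. (\<lambda>n. ennreal (norm (softened \<delta> (X n - y)) * norm (q y))) \<longlonglongrightarrow> 0"
    proof (rule AE_I2)
      fix y :: complex
      have lim: "filterlim (\<lambda>n. real n - norm y) at_top sequentially"
        using filterlim_tendsto_add_at_top[OF tendsto_const[of "- norm y"] filterlim_real_sequentially] by (simp add: add.commute)
      have "(\<lambda>n. C / (real n - norm y)) \<longlonglongrightarrow> 0"
        by (rule tendsto_divide_0[OF tendsto_const]) (use lim filterlim_at_top_imp_at_infinity in blast)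
      moreover have "\<forall>\<^sub>F n in sequentially. norm (softened \<delta> (X n - y)) \<le> C / (real n - norm y)"
        using filterlim_at_top_dense[THEN iffD1, OF lim, rule_format, of 0]
      proof eventually_elim
        case (elim n)
        have big: "norm (X n - y) \<ge> real n - norm y"
          using norm_triangle_ineq2[of "X n" y] X(1)[of n] by linarith
        have "norm (softened \<delta> (X n - y)) \<le> C / norm (X n - y)"
          using big elim by (intro C(3)) auto
        also have "\<dots> \<le> C / (real n - norm y)"
          using big elim C(1) by (intro divide_left_mono) (auto intro!: mult_pos_pos)
        finally show ?case .
      qed
      ultimately have "(\<lambda>n. softened \<delta> (X n - y)) \<longlonglongrightarrow> 0"
        by (rule Lim_null_comparison[rotated])
      then have "(\<lambda>n. norm (softened \<delta> (X n - y))) \<longlonglongrightarrow> 0"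
        by (rule tendsto_norm_zero)
      then have "(\<lambda>n. norm (softened \<delta> (X n - y)) * norm (q y)) \<longlonglongrightarrow> 0"
        by (rule tendsto_mult_left_zero)
      from tendsto_ennrealI[OF this]
      show "(\<lambda>n. ennreal (norm (softened \<delta> (X n - y)) * norm (q y))) \<longlonglongrightarrow> 0"
        by simp
    qed
  qed measurable
  then have "\<forall>\<^sub>F n in sequentially. (\<integral>\<^sup>+y. ennreal (norm (softened \<delta> (X n - y)) * norm (q y)) \<partial>lborel) < ennreal (\<epsilon> / 2)"
    using assms by (intro order_tendstoD) auto
  then obtain n where n: "(\<integral>\<^sup>+y. ennreal (norm (softened \<delta> (X n - y)) * norm (q y)) \<partial>lborel) < ennreal (\<epsilon> / 2)"
    using eventually_happens'[OF sequentially_bot] by blast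
  have "abs_potential (X n) \<le> ennreal (\<epsilon> / 2) + ennreal (\<epsilon> / 2)"
    using order_trans[OF softening_error[OF \<delta>(1), of "\<lambda>y. 0" "X n"] add_mono[OF less_imp_le \<delta>(2)]] n by simp
  also have "\<dots> = ennreal \<epsilon>"
    using assms by (simp flip: ennreal_plus)
  finally show False
    using X(2) by blast
qed

lemma potential_equicontinuous:
  assumes "\<epsilon> > 0"
  shows "\<exists>d>0. \<forall>x'. norm (x' - x) < d \<longrightarrow> potential_variation x' x \<le> ennreal \<epsilon>"
proof (rule ccontr)
  assume neg: "\<not> ?thesis"
  have "\<exists>x'. norm (x' - x) < inverse (real (Suc n)) \<and> \<not> potential_variation x' x \<le> ennreal \<epsilon>" for n
  proof -
    have "inverse (real (Suc n)) > 0" by simp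
    with neg show ?thesis by blast
  qed
  then obtain X where X: "\<And>n. norm (X n - x) < inverse (real (Suc n))" "\<And>n. \<not> potential_variation (X n) x \<le> ennreal \<epsilon>"
    by metis
  have "(\<lambda>n. X n - x) \<longlonglongrightarrow> 0"
    by (rule Lim_null_comparison[OF _ LIMSEQ_inverse_real_of_nat])
      (use X(1) in \<open>auto intro!: always_eventually less_imp_le\<close>)
  then have Xlim: "X \<longlonglongrightarrow> x"
    by (rule LIM_zero_cancel)
  obtain \<delta> where \<delta>: "\<delta> > 0" "\<And>x. near_potential \<delta> x \<le> ennreal (\<epsilon> / 3)"
    using near_diagonal_small[of "\<epsilon> / 3"] assms by auto
  obtain C where C: "C \<ge> 0" "\<And>z. norm (softened \<delta> z) \<le> C / \<delta>"
    using softened_bound \<delta>(1) by metis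
  have "(\<lambda>n. \<integral>\<^sup>+y. ennreal (norm (softened \<delta> (X n - y) - softened \<delta> (x - y)) * norm (q y)) \<partial>lborel) \<longlonglongrightarrow> (\<integral>\<^sup>+(y::complex). 0 \<partial>lborel)"
  proof (rule nn_integral_dominated_convergence[where w = "\<lambda>y. ennreal (2 * (C / \<delta>)) * ennreal (norm (q y))"])
    show "(\<integral>\<^sup>+y. ennreal (2 * (C / \<delta>)) * ennreal (norm (q y)) \<partial>lborel) < \<infinity>"
      using q_nn_finite by (simp add: nn_integral_cmult ennreal_mult_less_top)
    show "AE y in lborel. ennreal (norm (softened \<delta> (X n - y) - softened \<delta> (x - y)) * norm (q y)) \<le> ennreal (2 * (C / \<delta>)) * ennreal (norm (q y))" for n
    proof (rule AE_I2)
      fix y :: complex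
      have "norm (softened \<delta> (X n - y) - softened \<delta> (x - y)) \<le> 2 * (C / \<delta>)"
        using norm_triangle_ineq4[of "softened \<delta> (X n - y)" "softened \<delta> (x - y)"] C(2)[of "X n - y"] C(2)[of "x - y"] by linarith
      then show "ennreal (norm (softened \<delta> (X n - y) - softened \<delta> (x - y)) * norm (q y)) \<le> ennreal (2 * (C / \<delta>)) * ennreal (norm (q y))"
        using C(1) \<delta>(1) by (intro ennreal_mult_bound) auto
    qed
    show "AE y in lborel. (\<lambda>n. ennreal (norm (softened \<delta> (X n - y) - softened \<delta> (x - y)) * norm (q y))) \<longlonglongrightarrow> 0"
    proof (rule AE_I2)
      fix y :: complex
      have "(\<lambda>n. softened \<delta> (X n - y)) \<longlonglongrightarrow> softened \<delta> (x - y)"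
        by (intro isCont_tendsto_compose[OF softened_isCont[OF \<delta>(1)]] tendsto_intros Xlim)
      then have "(\<lambda>n. norm (softened \<delta> (X n - y) - softened \<delta> (x - y))) \<longlonglongrightarrow> 0"
        by (intro tendsto_norm_zero LIM_zero)
      then have "(\<lambda>n. norm (softened \<delta> (X n - y) - softened \<delta> (x - y)) * norm (q y)) \<longlonglongrightarrow> 0"
        by (rule tendsto_mult_left_zero)
      from tendsto_ennrealI[OF this]
      show "(\<lambda>n. ennreal (norm (softened \<delta> (X n - y) - softened \<delta> (x - y)) * norm (q y))) \<longlonglongrightarrow> 0"
        by simp
    qed
  qed measurable
  then have "\<forall>\<^sub>F n in sequentially. (\<integral>\<^sup>+y. ennreal (norm (softened \<delta> (X n - y) - softened \<delta> (x - y)) * norm (q y)) \<partial>lborel) < ennreal (\<epsilon> / 3)"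
    using assms by (intro order_tendstoD) auto
  then obtain n where n: "(\<integral>\<^sup>+y. ennreal (norm (softened \<delta> (X n - y) - softened \<delta> (x - y)) * norm (q y)) \<partial>lborel) < ennreal (\<epsilon> / 3)"
    using eventually_happens'[OF sequentially_bot] by blast
  have "potential_variation (X n) x
     \<le> (\<integral>\<^sup>+y. ennreal (norm (softened \<delta> (X n - y) - G (x - y)) * norm (q y)) \<partial>lborel) + ennreal (\<epsilon> / 3)"
    by (rule order_trans[OF softening_error[OF \<delta>(1), of "\<lambda>y. G (x - y)" "X n"] add_left_mono[OF \<delta>(2)]]) measurable
  also have "(\<integral>\<^sup>+y. ennreal (norm (softened \<delta> (X n - y) - G (x - y)) * norm (q y)) \<partial>lborel)
     = (\<integral>\<^sup>+y. ennreal (norm (G (x - y) - softened \<delta> (X n - y)) * norm (q y)) \<partial>lborel)"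
    by (simp add: norm_minus_commute)
  also have "\<dots> \<le> (\<integral>\<^sup>+y. ennreal (norm (softened \<delta> (x - y) - softened \<delta> (X n - y)) * norm (q y)) \<partial>lborel) + ennreal (\<epsilon> / 3)"
    by (rule order_trans[OF softening_error[OF \<delta>(1), of "\<lambda>y. softened \<delta> (X n - y)" x] add_left_mono[OF \<delta>(2)]]) measurable
  also have "\<dots> \<le> ennreal (\<epsilon> / 3) + ennreal (\<epsilon> / 3)"
    using n by (intro add_right_mono) (simp add: norm_minus_commute less_imp_le)
  finally have "potential_variation (X n) x \<le> ennreal (\<epsilon> / 3) + ennreal (\<epsilon> / 3) + ennreal (\<epsilon> / 3)"
    by (auto simp: add_right_mono)
  also have "\<dots> = ennreal \<epsilon>"
    using assms by (simp flip: ennreal_plus)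
  finally show False
    using X(2) by blast
qed

end

instance bcontfun :: (metric_space, banach) banach ..

context subcritical_kernel
begin

lemma potential_integrable:
  assumes [measurable]: "v \<in> borel_measurable borel" and M: "\<And>y. norm (v y) \<le> M"
  shows "integrable lborel (\<lambda>y. G (x - y) * (q y * v y))"
proof (rule integrableI_bounded)
  obtain B where B: "\<And>x. abs_potential x \<le> ennreal B"
    using potential_bounded by blast
  have M0: "M \<ge> 0"
    using order_trans[OF norm_ge_zero M[of 0]] .
  have "(\<integral>\<^sup>+y. ennreal (norm (G (x - y) * (q y * v y))) \<partial>lborel) \<le> (\<integral>\<^sup>+y. ennreal M * ennreal (norm (G (x - y)) * norm (q y)) \<partial>lborel)"
  proof (rule nn_integral_mono)
    fix y
    have "ennreal (norm (v y) * (norm (G (x - y)) * norm (q y))) \<le> ennreal M * ennreal (norm (G (x - y)) * norm (q y))"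
      using M M0 by (intro ennreal_mult_bound) auto
    then show "ennreal (norm (G (x - y) * (q y * v y))) \<le> ennreal M * ennreal (norm (G (x - y)) * norm (q y))"
      by (simp add: norm_mult mult_ac)
  qed
  also have "\<dots> = ennreal M * abs_potential x"
    by (rule nn_integral_cmult) measurable
  also have "\<dots> \<le> ennreal M * ennreal B"
    by (intro mult_left_mono B) simp
  also have "\<dots> < \<infinity>"
    by (simp add: ennreal_mult_less_top)
  finally show "(\<integral>\<^sup>+y. ennreal (norm (G (x - y) * (q y * v y))) \<partial>lborel) < \<infinity>" .
qed measurable

text \<open>
  Stated for an arbitrary kernel \<open>K\<close> of \<open>y\<close> so that it applies both to \<open>G (x - y)\<close> and to the difference
  \<open>G (x' - y) - G (x - y)\<close>.
\<close>

lemma convolve_bound: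
  assumes [measurable]: "v \<in> borel_measurable borel" "K \<in> borel_measurable borel" and M: "\<And>y. norm (v y) \<le> M"
    and bound: "(\<integral>\<^sup>+y. ennreal (norm (K y) * norm (q y)) \<partial>lborel) \<le> ennreal B" "B \<ge> 0"
  shows "norm (\<integral>y. K y * (q y * v y) \<partial>lborel) \<le> M * B"
proof -
  have M0: "M \<ge> 0"
    using order_trans[OF norm_ge_zero M[of 0]] .
  show ?thesis
  proof (cases "integrable lborel (\<lambda>y. K y * (q y * v y))")
    case True
    have "ennreal (norm (\<integral>y. K y * (q y * v y) \<partial>lborel)) \<le> (\<integral>\<^sup>+y. ennreal (norm (K y * (q y * v y))) \<partial>lborel)"
      by (rule integral_norm_bound_ennreal[OF True])
    also have "\<dots> \<le> (\<integral>\<^sup>+y. ennreal M * ennreal (norm (K y) * norm (q y)) \<partial>lborel)"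
    proof (rule nn_integral_mono)
      fix y
      have "ennreal (norm (v y) * (norm (K y) * norm (q y))) \<le> ennreal M * ennreal (norm (K y) * norm (q y))"
        using M M0 by (intro ennreal_mult_bound) auto
      then show "ennreal (norm (K y * (q y * v y))) \<le> ennreal M * ennreal (norm (K y) * norm (q y))"
        by (simp add: norm_mult mult_ac)
    qed
    also have "\<dots> = ennreal M * (\<integral>\<^sup>+y. ennreal (norm (K y) * norm (q y)) \<partial>lborel)"
      by (rule nn_integral_cmult) measurable
    also have "\<dots> \<le> ennreal M * ennreal B"
      by (intro mult_left_mono bound) simp
    also have "\<dots> = ennreal (M * B)"
      using M0 bound by (simp add: ennreal_mult)
    finally show ?thesis
      using M0 bound by (simp add: ennreal_le_iff)
  next
    case False
    then show ?thesis
      using M0 bound by (simp add: not_integrable_integral_eq)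
  qed
qed

lemma convolve_potential_bounded:
  "\<exists>B\<ge>0. \<forall>v M x. v \<in> borel_measurable borel \<longrightarrow> (\<forall>y. norm (v y) \<le> M) \<longrightarrow> norm (convolve G (\<lambda>y. q y * v y) x) \<le> M * B"
proof -
  obtain B where B: "B \<ge> 0" "\<And>x. abs_potential x \<le> ennreal B"
    using potential_bounded by blast
  have "norm (convolve G (\<lambda>y. q y * v y) x) \<le> M * B"
    if "v \<in> borel_measurable borel" "\<forall>y. norm (v y) \<le> M" for v M x
    unfolding convolve_def by (rule convolve_bound) (use that B in auto)
  then show ?thesis
    using B(1) by blast
qed

lemma convolve_potential_decay:
  assumes "\<epsilon> > 0"
  shows "\<exists>R. \<forall>v x. v \<in> borel_measurable borel \<longrightarrow> (\<forall>y. norm (v y) \<le> 1) \<longrightarrow> norm x > R \<longrightarrow> norm (convolve G (\<lambda>y. q y * v y) x) \<le> \<epsilon>"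
proof -
  obtain R where R: "\<And>x. norm x > R \<Longrightarrow> abs_potential x \<le> ennreal \<epsilon>"
    using potential_decay[OF assms] by blast
  have "norm (convolve G (\<lambda>y. q y * v y) x) \<le> 1 * \<epsilon>"
    if "v \<in> borel_measurable borel" "\<forall>y. norm (v y) \<le> 1" "norm x > R" for v x
    unfolding convolve_def by (rule convolve_bound) (use that R assms in auto)
  then show ?thesis
    by auto
qed

lemma convolve_potential_equicontinuous:
  assumes "\<epsilon> > 0"
  shows "\<exists>d>0. \<forall>v x'. v \<in> borel_measurable borel \<longrightarrow> (\<forall>y. norm (v y) \<le> M) \<longrightarrow> norm (x' - x) < d \<longrightarrow>
    norm (convolve G (\<lambda>y. q y * v y) x' - convolve G (\<lambda>y. q y * v y) x) \<le> M * \<epsilon>"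
proof -
  obtain d where d: "d > 0" "\<And>x'. norm (x' - x) < d \<Longrightarrow> potential_variation x' x \<le> ennreal \<epsilon>"
    using potential_equicontinuous[OF assms, of x] by blast
  have "norm (convolve G (\<lambda>y. q y * v y) x' - convolve G (\<lambda>y. q y * v y) x) \<le> M * \<epsilon>"
    if v: "v \<in> borel_measurable borel" "\<forall>y. norm (v y) \<le> M" and x': "norm (x' - x) < d" for v x'
  proof -
    have "convolve G (\<lambda>y. q y * v y) x' - convolve G (\<lambda>y. q y * v y) x = (\<integral>y. (G (x' - y) - G (x - y)) * (q y * v y) \<partial>lborel)"
      using potential_integrable[of v M] v by (simp add: convolve_def left_diff_distrib)
    also have "norm \<dots> \<le> M * \<epsilon>"
      using v(1) by (intro convolve_bound d(2)[OF x']) (use v assms in auto)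
    finally show ?thesis .
  qed
  then show ?thesis
    using d(1) by blast
qed

lemma convolve_potential_bcontfun:
  assumes v: "v \<in> borel_measurable borel" and M: "\<And>y. norm (v y) \<le> M"
  shows "convolve G (\<lambda>y. q y * v y) \<in> bcontfun"
proof -
  have M0: "M \<ge> 0"
    using order_trans[OF norm_ge_zero M[of 0]] .
  have "isCont (convolve G (\<lambda>y. q y * v y)) x" for x
    unfolding continuous_at_eps_delta
  proof (intro allI impI)
    fix e :: real assume e: "e > 0"
    define s where "s = M + 1"
    define c where "c = e / 2 / s"
    have "s > 0"
      using M0 by (simp add: s_def)
    then have c: "c > 0" and sc: "s * c = e / 2"
      using e by (simp_all add: c_def)
    from convolve_potential_equicontinuous[OF c, of M x] obtain d where
      d: "d > 0" "\<And>x'. norm (x' - x) < d \<Longrightarrow> norm (convolve G (\<lambda>y. q y * v y) x' - convolve G (\<lambda>y. q y * v y) x) \<le> M * c"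
      using v M by blast
    have "M * c < e"
    proof -
      have "M * c + c = e / 2"
        using sc by (simp only: s_def distrib_right mult_1)
      then show ?thesis
        using c e by linarith
    qed
    then show "\<exists>d>0. \<forall>x'. dist x' x < d \<longrightarrow> dist (convolve G (\<lambda>y. q y * v y) x') (convolve G (\<lambda>y. q y * v y) x) < e"
      using d by (intro exI[of _ d]) (auto simp: dist_norm intro: le_less_trans)
  qed
  then have "continuous_on UNIV (convolve G (\<lambda>y. q y * v y))"
    by (simp add: continuous_on_eq_continuous_at)
  moreover have "bounded (range (convolve G (\<lambda>y. q y * v y)))"
    using convolve_potential_bounded v M unfolding bounded_iff by blast
  ultimately show ?thesis
    by (simp add: bcontfun_def)
qed

definition potential_op :: "(complex \<Rightarrow>\<^sub>C complex) \<Rightarrow> (complex \<Rightarrow>\<^sub>C complex)" where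
  "potential_op v = Bcontfun (convolve G (\<lambda>y. q y * apply_bcontfun v y))"

lemma apply_bcontfun_measurable [measurable]: "apply_bcontfun (v :: complex \<Rightarrow>\<^sub>C complex) \<in> borel_measurable borel"
  by (rule borel_measurable_continuous_onI) simp

lemma potential_op_apply: "apply_bcontfun (potential_op v) x = convolve G (\<lambda>y. q y * apply_bcontfun v y) x"
  unfolding potential_op_def
  by (subst Bcontfun_inverse[OF convolve_potential_bcontfun[OF _ norm_bounded]]) simp_all

lemma potential_op_bounded_linear: "bounded_linear potential_op"
proof -
  obtain B where B: "\<And>v M x. v \<in> borel_measurable borel \<Longrightarrow> \<forall>y. norm (v y) \<le> M \<Longrightarrow> norm (convolve G (\<lambda>y. q y * v y) x) \<le> M * B"
    using convolve_potential_bounded by blast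
  note int = potential_integrable[OF apply_bcontfun_measurable norm_bounded]
  show ?thesis
  proof (rule bounded_linear_intro)
    show "potential_op (v + w) = potential_op v + potential_op w" for v w
      using int by (intro bcontfun_eqI) (simp add: potential_op_apply convolve_def distrib_left)
    show "potential_op (r *\<^sub>R v) = r *\<^sub>R potential_op v" for r v
      by (intro bcontfun_eqI) (simp add: potential_op_apply convolve_def)
    show "norm (potential_op v) \<le> norm v * B" for v
      by (rule norm_bound) (simp add: potential_op_apply B norm_bounded)
  qed
qed

text \<open>
  The functions \<open>U n\<close> are bounded, equicontinuous at every point, and uniformly small near infinity. Transplanted to the unit
  disc by \<open>h y = y / (1 - |y|)\<close> and extended by \<open>0\<close> to its boundary, they are equicontinuous on the closed disc,
  where the theorem of Arzela and Ascoli applies; decay is equicontinuity at the boundary points.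
\<close>

lemma potential_op_compact:
  fixes v :: "nat \<Rightarrow> (complex \<Rightarrow>\<^sub>C complex)"
  assumes v: "\<And>n. norm (v n) \<le> 1"
  shows "\<exists>r l. strict_mono r \<and> (\<lambda>n. potential_op (v (r n))) \<longlonglongrightarrow> l"
proof -
  have v1: "norm (apply_bcontfun (v n) y) \<le> 1" for n y
    using norm_bounded[of "v n" y] v[of n] by linarith
  define U where "U n = convolve G (\<lambda>y. q y * apply_bcontfun (v n) y)" for n
  obtain B where B: "B \<ge> 0" "\<And>v M x. v \<in> borel_measurable borel \<Longrightarrow> \<forall>y. norm (v y) \<le> M \<Longrightarrow> norm (convolve G (\<lambda>y. q y * v y) x) \<le> M * B"
    using convolve_potential_bounded by blast
  define h where "h y = y /\<^sub>R (1 - norm y)" for y :: complex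
  define F where "F n y = (if norm y < 1 then U n (h y) else 0)" for n y
  have F_bound: "norm (F n y) \<le> B" for n y
    using B(2)[of "apply_bcontfun (v n)" 1 "h y"] B(1) v1 by (simp add: F_def U_def)
  have F_equi: "\<exists>d>0. \<forall>n y. y \<in> cball 0 1 \<and> norm (x - y) < d \<longrightarrow> norm (F n x - F n y) < e"
    if x: "x \<in> cball 0 1" and e: "e > 0" for x e
  proof (cases "norm x < 1")
    case True
    have e2: "e / 2 > 0" using e by simp
    obtain d where d: "d > 0" and d0: "\<forall>v x'. v \<in> borel_measurable borel \<longrightarrow> (\<forall>y. norm (v y) \<le> 1) \<longrightarrow> norm (x' - h x) < d \<longrightarrow>
        norm (convolve G (\<lambda>y. q y * v y) x' - convolve G (\<lambda>y. q y * v y) (h x)) \<le> 1 * (e / 2)"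
      using convolve_potential_equicontinuous[OF e2, of 1 "h x"] by blast
    have dU: "norm (U n z - U n (h x)) \<le> e / 2" if "norm (z - h x) < d" for n z
      using d0[rule_format, of "apply_bcontfun (v n)" z] v1 that by (simp add: U_def)
    have "isCont h x"
      unfolding h_def using True by (intro continuous_intros) auto
    then obtain d' where d': "d' > 0" "\<And>y. norm (y - x) < d' \<Longrightarrow> norm (h y - h x) < d"
      using d unfolding continuous_at_eps_delta dist_norm by blast
    show ?thesis
    proof (intro exI[of _ "min d' (1 - norm x)"] conjI allI impI)
      show "min d' (1 - norm x) > 0"
        using d' True by simp
      fix n y assume y: "y \<in> cball 0 1 \<and> norm (x - y) < min d' (1 - norm x)"
      then have "norm y < 1"
        using norm_triangle_ineq2[of y x] by (simp add: norm_minus_commute)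
      moreover have "norm (U n (h y) - U n (h x)) \<le> e / 2"
        using y by (intro dU d'(2)) (simp add: norm_minus_commute)
      ultimately show "norm (F n x - F n y) < e"
        using True e by (simp add: F_def norm_minus_commute)
    qed
  next
    case False
    then have x1: "norm x = 1"
      using x by simp
    have e2: "e / 2 > 0" using e by simp
    obtain R where R0: "\<forall>v x. v \<in> borel_measurable borel \<longrightarrow> (\<forall>y. norm (v y) \<le> 1) \<longrightarrow> norm x > R \<longrightarrow>
        norm (convolve G (\<lambda>y. q y * v y) x) \<le> e / 2"
      using convolve_potential_decay[OF e2] by blast
    have R: "norm (U n z) \<le> e / 2" if "norm z > R" for n z
      using R0[rule_format, of "apply_bcontfun (v n)" z] v1 that by (simp add: U_def)
    define d where "d = 1 / (\<bar>R\<bar> + 2)"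
    have d: "d > 0" by (simp add: d_def)
    show ?thesis
    proof (intro exI[of _ d] conjI allI impI d)
      fix n y assume y: "y \<in> cball 0 1 \<and> norm (x - y) < d"
      have "norm (F n y) \<le> e / 2"
      proof (cases "norm y < 1")
        case True
        have s: "1 - norm y < d"
          using y x1 norm_triangle_ineq2[of x y] by linarith
        have "norm y / (1 - norm y) > R"
        proof -
          have "R * (1 - norm y) \<le> \<bar>R\<bar> * d"
            using True s by (intro mult_mono) auto
          also have "\<dots> < 1 - d"
            by (simp add: d_def field_simps)
          also have "\<dots> < norm y"
            using s by simp
          finally show ?thesis
            using True by (simp add: pos_less_divide_eq)
        qed
        moreover have "norm (h y) = norm y / (1 - norm y)"
          using True by (simp add: h_def divide_inverse mult.commute)
        ultimately have "norm (U n (h y)) \<le> e / 2"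
          by (intro R) simp
        then show ?thesis
          using True by (simp add: F_def)
      qed (use e in \<open>simp add: F_def\<close>)
      then show "norm (F n x - F n y) < e"
        using x1 e by (simp add: F_def)
    qed
  qed
  have "\<exists>g. \<exists>k::nat \<Rightarrow> nat. strict_mono k \<and> (\<forall>e>0. \<exists>N. \<forall>n x. n \<ge> N \<and> x \<in> cball 0 1 \<longrightarrow> norm (F (k n) x - g x) < e)"
  proof (rule Arzela_Ascoli[OF compact_cball F_bound F_equi])
    fix g :: "complex \<Rightarrow> complex" and k :: "nat \<Rightarrow> nat"
    assume sm: "strict_mono k" and lim: "\<And>e. 0 < e \<Longrightarrow> \<exists>N. \<forall>n x. n \<ge> N \<and> x \<in> cball 0 1 \<longrightarrow> norm (F (k n) x - g x) < e"
    show "\<exists>g. \<exists>k::nat \<Rightarrow> nat. strict_mono k \<and> (\<forall>e>0. \<exists>N. \<forall>n x. n \<ge> N \<and> x \<in> cball 0 1 \<longrightarrow> norm (F (k n) x - g x) < e)"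
      by (rule exI[of _ g], rule exI[of _ k], intro conjI allI impI sm lim)
  qed
  then obtain g and k :: "nat \<Rightarrow> nat" where k: "strict_mono k" and
    g: "\<And>e. 0 < e \<Longrightarrow> \<exists>N. \<forall>n x. n \<ge> N \<and> x \<in> cball 0 1 \<longrightarrow> norm (F (k n) x - g x) < e"
    by blast
  have "Cauchy (\<lambda>n. potential_op (v (k n)))"
  proof (rule metric_CauchyI)
    fix e :: real assume e: "e > 0"
    then obtain N where N: "\<And>n x. n \<ge> N \<Longrightarrow> x \<in> cball 0 1 \<Longrightarrow> norm (F (k n) x - g x) < e / 4"
      using g[of "e / 4"] by (metis zero_less_divide_iff zero_less_numeral)
    show "\<exists>M. \<forall>m\<ge>M. \<forall>n\<ge>M. dist (potential_op (v (k m))) (potential_op (v (k n))) < e"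
    proof (intro exI[of _ N] allI impI)
      fix m n assume mn: "m \<ge> N" "n \<ge> N"
      have "norm (potential_op (v (k m)) - potential_op (v (k n))) \<le> e / 2"
      proof (rule norm_bound)
        fix x :: complex
        define y where "y = x /\<^sub>R (1 + norm x)"
        have n1: "1 + norm x \<noteq> 0"
          using norm_ge_zero[of x] by linarith
        have ny: "norm y = norm x / (1 + norm x)"
          by (simp add: y_def divide_inverse mult.commute)
        have y1: "norm y < 1"
          unfolding ny by (simp add: pos_divide_less_eq add_pos_nonneg)
        have "1 - norm y = inverse (1 + norm x)"
          unfolding ny using n1 by (simp add: field_simps)
        then have hy: "h y = x"
          unfolding h_def using n1 by (simp add: y_def)
        have "norm (U (k m) x - U (k n) x) = norm ((F (k m) y - g y) - (F (k n) y - g y))"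
          using y1 by (simp add: F_def hy)
        also have "\<dots> \<le> norm (F (k m) y - g y) + norm (F (k n) y - g y)"
          by (rule norm_triangle_ineq4)
        also have "\<dots> \<le> e / 4 + e / 4"
          using N[OF mn(1), of y] N[OF mn(2), of y] y1 by simp
        finally show "norm (apply_bcontfun (potential_op (v (k m)) - potential_op (v (k n))) x) \<le> e / 2"
          by (simp add: potential_op_apply U_def)
      qed
      then show "dist (potential_op (v (k m))) (potential_op (v (k n))) < e"
        using e by (simp add: dist_norm)
    qed
  qed
  then show ?thesis
    using k Cauchy_convergent_iff convergent_def by blast
qed

text \<open>
  The unknown is \<open>m\<close> itself and not \<open>m - 1\<close>: constants are bounded and continuous.
\<close>

theorem lippmann_schwinger_solvable:
  assumes inj: "\<And>v. continuous_on UNIV v \<Longrightarrow> bounded (range v) \<Longrightarrow> (\<And>x. v x = convolve G (\<lambda>y. q y * v y) x) \<Longrightarrow> (\<forall>x. v x = 0)"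
  obtains m where "continuous_on UNIV m" "bounded (range m)" "\<And>x. m x = 1 + convolve G (\<lambda>y. q y * m y) x"
proof -
  have inj': "v = 0" if "potential_op v = v" for v
  proof (rule bcontfun_eqI)
    fix x
    have "\<forall>x. apply_bcontfun v x = 0"
      by (rule inj[OF continuous_on_apply_bcontfun bounded_apply_bcontfun]) (simp only: potential_op_apply[symmetric] that)
    then show "apply_bcontfun v x = apply_bcontfun 0 x"
      by simp
  qed
  have "\<exists>m. m - potential_op m = const_bcontfun 1"
  proof (rule riesz_fredholm_alternative[OF potential_op_bounded_linear])
    show "\<exists>r l. strict_mono r \<and> (\<lambda>n. potential_op (v (r n))) \<longlonglongrightarrow> l" if "\<And>n. norm (v n) \<le> 1" for v :: "nat \<Rightarrow> (complex \<Rightarrow>\<^sub>C complex)"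
      by (rule potential_op_compact) (rule that)
  qed (rule inj')
  then obtain m where m: "m - potential_op m = const_bcontfun 1"
    by blast
  have "apply_bcontfun m x = 1 + convolve G (\<lambda>y. q y * apply_bcontfun m y) x" for x
  proof -
    have "apply_bcontfun (m - potential_op m) x = 1"
      unfolding m by (simp add: const_bcontfun.rep_eq)
    then show ?thesis
      by (simp add: potential_op_apply algebra_simps)
  qed
  then show ?thesis
    by (rule that[OF continuous_on_apply_bcontfun bounded_apply_bcontfun])
qed

end

section \<open>Weighted spaces\<close>

text \<open>
  The weight is at least \<open>1\<close>, which gives \<open>L\<^sup>p\<close>; its inverse lies in \<open>L\<^sup>p\<^sup>'\<close> as \<open>\<rho> p' > 2\<close>, which
  gives \<open>L\<^sup>1\<close>.
\<close>

lemma weighted_Lp_subset_L1_Lp: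
  fixes q :: "complex \<Rightarrow> complex"
  assumes p: "1 < p" "1 / p + 1 / p' = 1" and \<rho>: "\<rho> > 2 / p'"
    and [measurable]: "q \<in> borel_measurable borel"
    and fin: "(\<integral>\<^sup>+x. ennreal (((1 + (norm x)\<^sup>2) powr (\<rho> / 2) * norm (q x)) powr p) \<partial>lborel) < \<infinity>"
  shows "integrable lborel q" "(\<integral>\<^sup>+x. ennreal (norm (q x) powr p) \<partial>lborel) < \<infinity>"
proof -
  have "1 / p' = 1 - 1 / p"
    using p by simp
  then have "1 / p' > 0" "1 / p' < 1"
    using p(1) by simp_all
  then have p': "p' > 1"
    by (simp add: field_simps split: if_splits)
  have \<rho>p': "\<rho> * p' > 2"
    using \<rho> p' by (simp add: pos_divide_less_eq)
  have "2 / p' > 0"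
    using p' by simp
  with \<rho> have \<rho>0: "\<rho> > 0"
    by linarith
  define w where "w x = (1 + (norm x)\<^sup>2) powr (\<rho> / 2)" for x :: complex
  have w: "w x \<ge> 1" for x
    unfolding w_def using \<rho>0 by (intro ge_one_powr_ge_zero) auto
  have [measurable]: "w \<in> borel_measurable borel"
    unfolding w_def by measurable
  have "(\<integral>\<^sup>+x. ennreal (norm (q x) powr p) \<partial>lborel) \<le> (\<integral>\<^sup>+x. ennreal ((w x * norm (q x)) powr p) \<partial>lborel)"
  proof (intro nn_integral_mono ennreal_leI powr_mono2)
    show "norm (q x) \<le> w x * norm (q x)" for x
      using mult_right_mono[OF w norm_ge_zero] by simp
  qed (use p in auto)
  also have "\<dots> < \<infinity>"
    using fin by (simp add: w_def)
  finally show "(\<integral>\<^sup>+x. ennreal (norm (q x) powr p) \<partial>lborel) < \<infinity>" .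
  have w_dual: "(\<integral>\<^sup>+x. ennreal ((1 / w x) powr p') \<partial>lborel) < \<infinity>"
  proof -
    have "(\<integral>\<^sup>+x. ennreal ((1 / w x) powr p') \<partial>lborel)
       \<le> (\<integral>\<^sup>+x. indicator (cball 0 1) x + ennreal (norm x powr - (\<rho> * p')) * indicator (- ball (0::complex) 1) x \<partial>lborel)"
    proof (rule nn_integral_mono)
      fix x :: complex
      show "ennreal ((1 / w x) powr p') \<le> indicator (cball 0 1) x + ennreal (norm x powr - (\<rho> * p')) * indicator (- ball 0 1) x"
      proof (cases "norm x < 1")
        case True
        have "(1 / w x) powr p' \<le> 1"
          using w[of x] p' by (intro powr_le1) auto
        then have "ennreal ((1 / w x) powr p') \<le> ennreal 1"
          by (rule ennreal_leI)
        then show ?thesis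
          using True by simp
      next
        case False
        have "(norm x)\<^sup>2 powr (\<rho> / 2) \<le> w x"
          unfolding w_def using \<rho>0 by (intro powr_mono2) auto
        moreover have "(norm x)\<^sup>2 powr (\<rho> / 2) = norm x powr \<rho>"
        proof -
          have "(norm x)\<^sup>2 = norm x powr 2"
            using False by (simp add: powr_numeral)
          then show ?thesis
            by (simp only: powr_powr) simp
        qed
        moreover have "norm x > 0"
          using False by linarith
        then have "norm x powr \<rho> > 0"
          by simp
        ultimately have "1 / w x \<le> 1 / norm x powr \<rho>"
          by (intro frac_le) simp_all
        then have "(1 / w x) powr p' \<le> (1 / norm x powr \<rho>) powr p'"
          using w[of x] p' by (intro powr_mono2) auto
        also have "\<dots> = norm x powr - (\<rho> * p')"
          by (simp add: powr_minus_divide[symmetric] powr_powr)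
        finally have "ennreal ((1 / w x) powr p') \<le> ennreal (norm x powr - (\<rho> * p'))"
          by (rule ennreal_leI)
        then show ?thesis
          using False by (auto intro: add_increasing)
      qed
    qed
    also have "\<dots> = emeasure lborel (cball (0::complex) 1) + (\<integral>\<^sup>+x. ennreal (norm x powr - (\<rho> * p')) * indicator (- ball (0::complex) 1) x \<partial>lborel)"
    proof -
      have m: "(\<lambda>x. ennreal (norm x powr - (\<rho> * p')) * indicator (- ball (0::complex) 1) x) \<in> borel_measurable lborel"
        by (intro borel_measurable_times_ennreal borel_measurable_indicator) auto
      show ?thesis
        by (subst nn_integral_add[OF _ m]) (auto intro!: borel_measurable_indicator)
    qed
    also have "\<dots> < \<infinity>"
      using le_less_trans[OF nn_integral_norm_powr_far[OF \<rho>p', of 1] ennreal_less_top]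
      by (simp add: emeasure_cball_complex)
    finally show ?thesis .
  qed
  have "(\<integral>\<^sup>+x. ennreal (norm (q x)) \<partial>lborel) \<le> (\<integral>\<^sup>+x. ennreal ((w x * norm (q x)) powr p) + ennreal ((1 / w x) powr p') \<partial>lborel)"
  proof (rule nn_integral_mono)
    fix x
    have "norm (q x) = (w x * norm (q x)) * (1 / w x)"
      using w[of x] by simp
    also have "\<dots> \<le> (w x * norm (q x)) powr p / p + (1 / w x) powr p' / p'"
      using p p' w[of x] by (intro Youngs_inequality) auto
    also have "\<dots> \<le> (w x * norm (q x)) powr p / 1 + (1 / w x) powr p' / 1"
      using p p' by (intro add_mono divide_left_mono) auto
    finally have "ennreal (norm (q x)) \<le> ennreal ((w x * norm (q x)) powr p + (1 / w x) powr p')"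
      by (intro ennreal_leI) simp
    then show "ennreal (norm (q x)) \<le> ennreal ((w x * norm (q x)) powr p) + ennreal ((1 / w x) powr p')"
      by (simp only: ennreal_plus powr_ge_zero)
  qed
  also have "\<dots> = (\<integral>\<^sup>+x. ennreal ((w x * norm (q x)) powr p) \<partial>lborel) + (\<integral>\<^sup>+x. ennreal ((1 / w x) powr p') \<partial>lborel)"
    by (rule nn_integral_add) measurable
  also have "\<dots> < \<infinity>"
    using fin w_dual by (simp add: w_def)
  finally show "integrable lborel q"
    by (intro integrableI_bounded) auto
qed

text \<open>
  Passing to a Borel representative allows all further integrals to be taken over \<open>lborel\<close>, where Fubini's theorem
  is available; passing to a real one removes the exceptional null set.
\<close>

lemma real_potential_representative:
  assumes p: "1 < p" "1 / p + 1 / p' = 1" and \<rho>: "\<rho> > 2 / p'"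
    and q: "q \<in> weighted_Lp p \<rho>" and real: "AE x in lebesgue. q x \<in> \<real>"
  obtains r :: "complex \<Rightarrow> real" where "AE x in lebesgue. q x = of_real (r x)"
    "integrable lborel (\<lambda>x. complex_of_real (r x))" "(\<integral>\<^sup>+x. ennreal (norm (complex_of_real (r x)) powr p) \<partial>lborel) < \<infinity>"
proof -
  have qm [measurable]: "q \<in> borel_measurable lebesgue"
    using q by (simp add: weighted_Lp_def)
  have "(\<lambda>x. Re (q x)) \<in> borel_measurable lebesgue"
    by measurable
  then obtain r where r[measurable]: "r \<in> borel_measurable lborel" and ae: "AE x in lborel. Re (q x) = r x"
    using completion_ex_borel_measurable_real by blast
  have ae': "AE x in lebesgue. q x = of_real (r x)"
    using real AE_completion[OF ae]
    by eventually_elim (auto simp: complex_eq_iff complex_is_Real_iff)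
  have [measurable]: "(\<lambda>x. complex_of_real (r x)) \<in> borel_measurable borel"
    using r by simp
  have "integrable lebesgue (\<lambda>x. norm (complex_of_real ((1 + (norm x)\<^sup>2) powr (\<rho> / 2)) * q x) powr p)"
    using q by (simp add: weighted_Lp_def Lp_space_def)
  then have "(\<integral>\<^sup>+x. ennreal (norm (norm (complex_of_real ((1 + (norm x)\<^sup>2) powr (\<rho> / 2)) * q x) powr p)) \<partial>lebesgue) < \<infinity>"
    by (simp add: integrable_iff_bounded)
  also have "(\<integral>\<^sup>+x. ennreal (norm (norm (complex_of_real ((1 + (norm x)\<^sup>2) powr (\<rho> / 2)) * q x) powr p)) \<partial>lebesgue)
     = (\<integral>\<^sup>+x. ennreal (((1 + (norm x)\<^sup>2) powr (\<rho> / 2) * norm (complex_of_real (r x))) powr p) \<partial>lebesgue)"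
    using ae' by (intro nn_integral_cong_AE) (auto simp: norm_mult)
  finally have fin: "(\<integral>\<^sup>+x. ennreal (((1 + (norm x)\<^sup>2) powr (\<rho> / 2) * norm (complex_of_real (r x))) powr p) \<partial>lborel) < \<infinity>"
    by (simp add: nn_integral_completion)
  show ?thesis
    using weighted_Lp_subset_L1_Lp[OF p \<rho> _ fin] by (intro that[OF ae']) auto
qed

section \<open>From the integral equation to the differential equation\<close>

definition cauchy_kernel :: "complex \<Rightarrow> complex" where
  "cauchy_kernel z = 1 / (of_real pi * z)"

definition conj_cauchy_kernel :: "complex \<Rightarrow> complex \<Rightarrow> complex" where
  "conj_cauchy_kernel k z = e_osc (- k) z / (of_real pi * cnj z)"

lemma norm_e_osc [simp]: "norm (e_osc k x) = 1"
proof -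
  have "\<i> * (k * x + cnj k * cnj x) = \<i> * of_real (2 * Re (k * x))"
    by (simp add: complex_eq_iff)
  then show ?thesis
    by (simp add: e_osc_def)
qed

lemma e_osc_measurable [measurable]: "e_osc k \<in> borel_measurable borel"
  unfolding e_osc_def[abs_def] by (intro borel_measurable_continuous_onI continuous_intros)

lemma weakly_singular_cauchy_kernel: "weakly_singular cauchy_kernel"
  unfolding weakly_singular_def
proof (intro conjI exI[of _ 1] allI impI)
  show "cauchy_kernel \<in> borel_measurable borel"
    unfolding cauchy_kernel_def[abs_def] by measurable
  fix z :: complex
  have "norm (cauchy_kernel z) = (1 / pi) * (1 / norm z)"
    by (simp add: cauchy_kernel_def norm_divide norm_mult)
  also have "\<dots> \<le> 1 * (1 / norm z)"
    using pi_ge_two by (intro mult_right_mono) auto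
  finally show "norm (cauchy_kernel z) \<le> 1 / norm z"
    by simp
qed simp

lemma weakly_singular_conj_cauchy_kernel: "weakly_singular (conj_cauchy_kernel k)"
  unfolding weakly_singular_def
proof (intro conjI exI[of _ 1] allI impI)
  have "cnj \<in> borel_measurable borel"
    by (intro borel_measurable_continuous_onI continuous_intros)
  then show "conj_cauchy_kernel k \<in> borel_measurable borel"
    unfolding conj_cauchy_kernel_def[abs_def] by measurable
  fix z :: complex
  have "norm (conj_cauchy_kernel k z) = (1 / pi) * (1 / norm z)"
    by (simp add: conj_cauchy_kernel_def norm_divide norm_mult)
  also have "\<dots> \<le> 1 * (1 / norm z)"
    using pi_ge_two by (intro mult_right_mono) auto
  finally show "norm (conj_cauchy_kernel k z) \<le> 1 / norm z"
    by simp
qed simp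

lemma subcritical_kernel_faddeev_green:
  assumes "k \<noteq> 0" "1 < p" "integrable lborel q" "(\<integral>\<^sup>+x. ennreal (norm (q x) powr p) \<partial>lborel) < \<infinity>"
  shows "subcritical_kernel (faddeev_green k) q p"
proof
  show "continuous_on (- {0}) (faddeev_green k)"
    by (intro continuous_at_imp_continuous_on ballI has_derivative_continuous[OF faddeev_green_has_derivative[OF assms(1)]]) auto
  show "\<exists>C. \<forall>z. z \<noteq> 0 \<longrightarrow> norm (faddeev_green k z) \<le> C * norm z powr - a" if "0 < a" "a \<le> 1" for a
    by (rule faddeev_green_bound) fact+
qed fact+

definition green_partial :: "complex \<Rightarrow> complex \<Rightarrow> complex \<Rightarrow> complex" where
  "green_partial k e z = (cauchy_kernel z - \<i> * k * faddeev_green k z) * e + conj_cauchy_kernel k z * cnj e"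

lemma green_partial_derivative:
  assumes "k \<noteq> 0" "z \<noteq> 0"
  shows "\<exists>K'. (faddeev_green k has_derivative K') (at z) \<and> K' e = green_partial k e z"
  using faddeev_green_has_derivative[OF assms]
  by (intro exI conjI) (auto simp: green_partial_def cauchy_kernel_def conj_cauchy_kernel_def)

lemma weakly_singular_green_partial:
  assumes "weakly_singular (faddeev_green k)"
  shows "weakly_singular (green_partial k e)"
proof -
  have "weakly_singular (\<lambda>z. cauchy_kernel z * e + faddeev_green k z * (- \<i> * k * e) + conj_cauchy_kernel k z * cnj e)"
    by (intro weakly_singular_add weakly_singular_cmult assms weakly_singular_cauchy_kernel weakly_singular_conj_cauchy_kernel)
  also have "(\<lambda>z. cauchy_kernel z * e + faddeev_green k z * (- \<i> * k * e) + conj_cauchy_kernel k z * cnj e) = green_partial k e"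
    by (simp add: green_partial_def fun_eq_iff algebra_simps)
  finally show ?thesis .
qed

text \<open>
  The distributional form of \<open>(\<partial> + i k) G = 1 / (\<pi> z)\<close>.
\<close>

lemma green_first_order:
  assumes G: "weakly_singular (faddeev_green k)" and k: "k \<noteq> 0" and f: "integrable lborel f" and \<psi>: "\<psi> \<in> test_functions"
  shows "distr_del (distr_of (convolve (faddeev_green k) f)) \<psi> + \<i> * k * distr_of (convolve (faddeev_green k) f) \<psi>
    = kernel_pairing cauchy_kernel f \<psi>"
proof -
  obtain R M where b: "\<And>x. norm (\<psi> x) \<le> M" "\<forall>x. norm x > R \<longrightarrow> \<psi> x = 0"
    using test_function_bounds[OF \<psi>] by metis
  note m = test_function_measurable[OF \<psi>]
  note ws = weakly_singular_green_partial[OF G]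
  have d: "distr_partial e (distr_of (convolve (faddeev_green k) f)) \<psi> = kernel_pairing (green_partial k e) f \<psi>" if "e = 1 \<or> e = \<i>" for e
    using distr_partial_convolve[OF G ws f \<psi> that green_partial_derivative[OF k]] distr_of_convolve[OF ws f \<psi>] by simp
  have 1: "kernel_pairing (green_partial k \<i>) f \<psi> = kernel_pairing (\<lambda>z. green_partial k 1 z * \<i> + conj_cauchy_kernel k z * (- 2 * \<i>)) f \<psi>"
    by (rule arg_cong[where f = "\<lambda>K. kernel_pairing K f \<psi>"]) (simp add: fun_eq_iff green_partial_def algebra_simps)
  have 2: "kernel_pairing (green_partial k 1) f \<psi> = kernel_pairing (\<lambda>z. (cauchy_kernel z * 1 + faddeev_green k z * (- \<i> * k)) * 1 + conj_cauchy_kernel k z * 1) f \<psi>"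
    by (rule arg_cong[where f = "\<lambda>K. kernel_pairing K f \<psi>"]) (simp add: fun_eq_iff green_partial_def algebra_simps)
  note lin = kernel_pairing_linear[OF _ _ f m b]
  have cg: "weakly_singular (\<lambda>z. cauchy_kernel z * 1 + faddeev_green k z * (- \<i> * k))"
    by (intro weakly_singular_add weakly_singular_cmult G weakly_singular_cauchy_kernel)
  have 3: "kernel_pairing (green_partial k \<i>) f \<psi> = kernel_pairing (green_partial k 1) f \<psi> * \<i> + kernel_pairing (conj_cauchy_kernel k) f \<psi> * (- 2 * \<i>)"
    unfolding 1 by (rule lin[OF ws weakly_singular_conj_cauchy_kernel])
  have 4: "kernel_pairing (green_partial k 1) f \<psi> = (kernel_pairing cauchy_kernel f \<psi> * 1 + kernel_pairing (faddeev_green k) f \<psi> * (- \<i> * k)) * 1 + kernel_pairing (conj_cauchy_kernel k) f \<psi> * 1"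
    unfolding 2 lin[OF cg weakly_singular_conj_cauchy_kernel] lin[OF weakly_singular_cauchy_kernel G] ..
  show ?thesis
    unfolding distr_del_def d[OF disjI1[OF refl]] d[OF disjI2[OF refl]] distr_of_convolve[OF G f \<psi>] 3
    unfolding 4 by (simp add: field_simps)
qed

text \<open>
  The distributional form of \<open>\<partial>\<close>bar\<open> (1 / (\<pi> z)) = \<delta>\<close>, convolved with \<open>f\<close>.
\<close>

lemma cauchy_kernel_dbar:
  assumes f: "integrable lborel f" and \<phi>: "\<phi> \<in> test_functions"
  shows "kernel_pairing cauchy_kernel f (partial 1 \<phi>) + \<i> * kernel_pairing cauchy_kernel f (partial \<i> \<phi>)
    = - 2 * (\<integral>y. f y * \<phi> y \<partial>lborel)"
proof -
  note C1 = test_function_C1_compact[OF \<phi>]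
  obtain R M where R: "\<And>x e. norm x > R \<Longrightarrow> partial e \<phi> x = 0" and M: "M > 0" "\<And>x. norm (partial 1 \<phi> x) \<le> M" "\<And>x. norm (partial \<i> \<phi> x) \<le> M"
    using C1_compact_support[OF C1] by metis
  have R': "\<forall>x. norm x > R \<longrightarrow> partial e \<phi> x = 0" for e
    using R by blast
  have M0: "M \<ge> 0" using M by simp
  note m = C1_compactD(5)[OF C1]
  have int: "integrable lborel (\<lambda>x. cauchy_kernel (x - y) * partial 1 \<phi> x)" "integrable lborel (\<lambda>x. cauchy_kernel (x - y) * partial \<i> \<phi> x)" for y
    by (rule integrable_kernel_times[OF weakly_singular_cauchy_kernel m M0 M(2) R'])
       (rule integrable_kernel_times[OF weakly_singular_cauchy_kernel m M0 M(3) R'])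
  have int2: "integrable lborel (\<lambda>y. f y * (\<integral>x. cauchy_kernel (x - y) * partial 1 \<phi> x \<partial>lborel))"
    "integrable lborel (\<lambda>y. f y * (\<integral>x. cauchy_kernel (x - y) * partial \<i> \<phi> x \<partial>lborel))"
    by (rule convolve_pairing(2)[OF weakly_singular_cauchy_kernel f m M(2) R'])
       (rule convolve_pairing(2)[OF weakly_singular_cauchy_kernel f m M(3) R'])
  \<comment> \<open>Cauchy-Pompeiu, with the two real directions separated\<close>
  have cp: "(\<integral>x. cauchy_kernel (x - y) * partial 1 \<phi> x \<partial>lborel) + \<i> * (\<integral>x. cauchy_kernel (x - y) * partial \<i> \<phi> x \<partial>lborel) = - 2 * \<phi> y" for y
  proof -
    have "(\<integral>x. cauchy_kernel (x - y) * partial 1 \<phi> x \<partial>lborel) + \<i> * (\<integral>x. cauchy_kernel (x - y) * partial \<i> \<phi> x \<partial>lborel)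
      = (\<integral>x. cauchy_kernel (x - y) * partial 1 \<phi> x + \<i> * (cauchy_kernel (x - y) * partial \<i> \<phi> x) \<partial>lborel)"
      using int[of y] by simp
    also have "\<dots> = (\<integral>x. 2 * ((1 / (of_real pi * (x - y))) * ((partial 1 \<phi> x + \<i> * partial \<i> \<phi> x) / 2)) \<partial>lborel)"
    proof -
      have "c * a + \<i> * (c * b) = 2 * (c * ((a + \<i> * b) / 2))" for a b c :: complex
        by (simp add: field_simps)
      then show ?thesis
        unfolding cauchy_kernel_def by (intro Bochner_Integration.integral_cong refl)
    qed
    also have "\<dots> = 2 * - \<phi> y"
      by (subst integral_mult_right_zero) (simp only: cauchy_pompeiu[OF C1])
    finally show ?thesis by simp
  qed
  have "kernel_pairing cauchy_kernel f (partial 1 \<phi>) + \<i> * kernel_pairing cauchy_kernel f (partial \<i> \<phi>)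
    = (\<integral>y. f y * (\<integral>x. cauchy_kernel (x - y) * partial 1 \<phi> x \<partial>lborel) + \<i> * (f y * (\<integral>x. cauchy_kernel (x - y) * partial \<i> \<phi> x \<partial>lborel)) \<partial>lborel)"
    using int2 by (simp add: kernel_pairing_def)
  also have "\<dots> = (\<integral>y. - 2 * (f y * \<phi> y) \<partial>lborel)"
  proof (intro Bochner_Integration.integral_cong refl)
    fix y
    have alg: "a * b + \<i> * (a * c) = a * (b + \<i> * c)" for a b c :: complex
      by (simp add: algebra_simps)
    show "f y * (\<integral>x. cauchy_kernel (x - y) * partial 1 \<phi> x \<partial>lborel) + \<i> * (f y * (\<integral>x. cauchy_kernel (x - y) * partial \<i> \<phi> x \<partial>lborel)) = - 2 * (f y * \<phi> y)"
      unfolding alg cp by simp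
  qed
  finally show ?thesis
    by (simp only: integral_mult_right_zero)
qed

text \<open>
  Constants are invisible to derivatives. Since \<open>\<partial>\<close>bar is the outer derivative in the equation, constants solve the
  homogeneous equation with \<open>q = 0\<close>.
\<close>

lemma distr_of_affine_convolve:
  assumes G: "weakly_singular G" and f: "integrable lborel f" and e: "e = 1 \<or> e = \<i>" and \<psi>: "\<psi> \<in> test_functions"
  shows "distr_of (\<lambda>x. c + convolve G f x) (partial e \<psi>) = distr_of (convolve G f) (partial e \<psi>)"
proof -
  have [measurable]: "G \<in> borel_measurable borel" "f \<in> borel_measurable borel"
    using G f by (auto simp: weakly_singular_def)
  note \<psi>e = partial_test_function[OF \<psi> e]
  obtain R M where b: "\<And>x. norm (partial e \<psi> x) \<le> M" "\<forall>x. norm x > R \<longrightarrow> partial e \<psi> x = 0" and M: "M > 0"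
    using test_function_bounds[OF \<psi>e] by metis
  have i1: "integrable lborel (\<lambda>x. convolve G f x * partial e \<psi> x)"
    by (rule convolve_pairing(1)[OF G f test_function_measurable[OF \<psi>e] b])
  have i2: "integrable lborel (partial e \<psi>)"
  proof (rule integrableI_bounded_set[where A = "cball 0 (\<bar>R\<bar> + 1)" and B = M])
    show "emeasure lborel (cball (0::complex) (\<bar>R\<bar> + 1)) < \<infinity>"
      by (simp add: emeasure_cball_complex)
  qed (use b test_function_measurable[OF \<psi>e] in \<open>auto intro!: AE_I2\<close>)
  have "distr_of (\<lambda>x. c + convolve G f x) (partial e \<psi>) = (\<integral>x. c * partial e \<psi> x + convolve G f x * partial e \<psi> x \<partial>lborel)"
    by (subst distr_of_eq_lborel[OF _ \<psi>e]) (auto simp: distrib_right)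
  also have "\<dots> = (\<integral>x. convolve G f x * partial e \<psi> x \<partial>lborel)"
    using i1 i2 integral_partial_test_function[OF \<psi> e] by simp
  also have "\<dots> = distr_of (convolve G f) (partial e \<psi>)"
    by (subst distr_of_eq_lborel[OF _ \<psi>e]) auto
  finally show ?thesis .
qed

text \<open>
  Used with \<open>c = 0\<close> for injectivity and with \<open>c = 1\<close> for existence.
\<close>

theorem integral_equation_imp_solution:
  fixes q q0 m :: "complex \<Rightarrow> complex"
  assumes k: "k \<noteq> 0" and p12: "1 < p" "p < 2"
    and qm[measurable]: "q \<in> borel_measurable lebesgue" and ae: "AE x in lebesgue. q x = q0 x"
    and q0: "integrable lborel q0" "(\<integral>\<^sup>+x. ennreal (norm (q0 x) powr p) \<partial>lborel) < \<infinity>"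
    and m[measurable]: "m \<in> borel_measurable borel" and bdd: "\<And>x. norm (m x) \<le> M"
    and eq: "\<And>x. m x = c + convolve (faddeev_green k) (\<lambda>y. q0 y * m y) x"
  shows "(\<lambda>x. m x - c) \<in> W1 (sobolev_conj p)" "solves_eq q k m"
proof -
  interpret subcritical_kernel "faddeev_green k" q0 p
    by (rule subcritical_kernel_faddeev_green[OF k p12(1) q0])
  let ?G = "faddeev_green k"
  define f where "f y = q0 y * m y" for y
  have [measurable]: "f \<in> borel_measurable borel"
    unfolding f_def by measurable
  have M0: "M \<ge> 0"
    using order_trans[OF norm_ge_zero bdd[of 0]] .
  have f: "integrable lborel f"
  proof (rule Bochner_Integration.integrable_bound[OF integrable_mult_right[of M, OF integrable_norm[OF q0(1)]]])
    show "AE x in lborel. norm (f x) \<le> norm (M * norm (q0 x))"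
      using bdd M0 by (intro AE_I2) (simp add: f_def norm_mult mult.commute mult_right_mono)
  qed (auto)
  have fp: "(\<integral>\<^sup>+x. ennreal (norm (f x) powr p) \<partial>lborel) < \<infinity>"
  proof -
    have "(\<integral>\<^sup>+x. ennreal (norm (f x) powr p) \<partial>lborel) \<le> (\<integral>\<^sup>+x. ennreal (M powr p) * ennreal (norm (q0 x) powr p) \<partial>lborel)"
    proof (rule nn_integral_mono)
      fix x
      have "norm (f x) powr p \<le> (M * norm (q0 x)) powr p"
        using bdd[of x] p12(1) by (intro powr_mono2) (auto simp: f_def norm_mult mult.commute mult_right_mono)
      also have "\<dots> = M powr p * norm (q0 x) powr p"
        using M0 by (simp add: powr_mult)
      finally show "ennreal (norm (f x) powr p) \<le> ennreal (M powr p) * ennreal (norm (q0 x) powr p)"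
        using M0 by (simp flip: ennreal_mult)
    qed
    also have "\<dots> = ennreal (M powr p) * (\<integral>\<^sup>+x. ennreal (norm (q0 x) powr p) \<partial>lborel)"
      by (rule nn_integral_cmult) measurable
    also have "\<dots> < \<infinity>"
      using q0(2) by (simp add: ennreal_mult_less_top)
    finally show ?thesis .
  qed
  have cf: "convolve ?G (\<lambda>y. q0 y * m y) = convolve ?G f"
    by (simp add: f_def[abs_def])
  have mx: "m x = c + convolve ?G f x" for x
    using eq[of x] by (simp only: cf)
  have mc: "m = (\<lambda>x. c + convolve ?G f x)" "(\<lambda>x. m x - c) = convolve ?G f"
    by (rule ext, rule mx) (rule ext, simp add: mx)
  note ws = weakly_singular_green_partial[OF G_weakly_singular]
  show "(\<lambda>x. m x - c) \<in> W1 (sobolev_conj p)"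
    unfolding mc(2) W1_def
  proof (intro CollectI conjI ballI)
    show "convolve ?G f \<in> Lp_space (sobolev_conj p)"
      by (rule convolve_in_Lp[OF G_weakly_singular _ p12 fp]) measurable
    fix e assume "e \<in> {1, \<i>}"
    then have e: "e = 1 \<or> e = \<i>" by simp
    show "\<exists>g\<in>Lp_space (sobolev_conj p). \<forall>\<phi>\<in>test_functions. distr_partial e (distr_of (convolve ?G f)) \<phi> = distr_of g \<phi>"
    proof (intro bexI ballI)
      show "convolve (green_partial k e) f \<in> Lp_space (sobolev_conj p)"
        by (rule convolve_in_Lp[OF ws _ p12 fp]) measurable
      show "distr_partial e (distr_of (convolve ?G f)) \<phi> = distr_of (convolve (green_partial k e) f) \<phi>" if "\<phi> \<in> test_functions" for \<phi>
        by (rule distr_partial_convolve[OF G_weakly_singular ws f that e green_partial_derivative[OF k]])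
    qed
  qed
  have ae_f: "AE x in lebesgue. q x * m x = f x"
    using ae by eventually_elim (simp add: f_def)
  have [measurable]: "f \<in> borel_measurable lebesgue" "m \<in> borel_measurable lebesgue"
    by (auto intro!: measurable_completion)
  show "solves_eq q k m"
    unfolding solves_eq_def
  proof (intro conjI ballI)
    show "locally_integrable m"
      using locally_integrable_convolve[OF G_weakly_singular f, of c] by (simp add: mc(1)[symmetric])
    have "integrable lebesgue f"
      using f by (subst integrable_completion) auto
    moreover have "(\<lambda>x. q x * m x) \<in> borel_measurable lebesgue"
      by measurable
    ultimately have "integrable lebesgue (\<lambda>x. q x * m x)"
      using integrable_cong_AE[of "\<lambda>x. q x * m x" lebesgue f] ae_f by simp
    then show "locally_integrable (\<lambda>x. q x * m x)"
      by (auto simp: locally_integrable_def set_integrable_def intro!: integrable_mult_indicator borel_closed compact_imp_closed sets_completionI_sets)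
    fix \<phi> assume \<phi>: "\<phi> \<in> test_functions"
    have first: "distr_del (distr_of m) (partial e \<phi>) + \<i> * k * distr_of m (partial e \<phi>) = kernel_pairing cauchy_kernel f (partial e \<phi>)"
      if e: "e = 1 \<or> e = \<i>" for e
    proof -
      note \<phi>e = partial_test_function[OF \<phi> e]
      have "distr_del (distr_of m) (partial e \<phi>) + \<i> * k * distr_of m (partial e \<phi>)
         = distr_del (distr_of (convolve ?G f)) (partial e \<phi>) + \<i> * k * distr_of (convolve ?G f) (partial e \<phi>)"
        unfolding mc(1) distr_del_def distr_partial_def
          distr_of_affine_convolve[OF G_weakly_singular f disjI1[OF refl] \<phi>e]
          distr_of_affine_convolve[OF G_weakly_singular f disjI2[OF refl] \<phi>e]
          distr_of_affine_convolve[OF G_weakly_singular f e \<phi>] ..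
      also have "\<dots> = kernel_pairing cauchy_kernel f (partial e \<phi>)"
        by (rule green_first_order[OF G_weakly_singular k f \<phi>e])
      finally show ?thesis .
    qed
    have "distr_delbar (\<lambda>\<psi>. distr_del (distr_of m) \<psi> + \<i> * k * distr_of m \<psi>) \<phi>
      = - (kernel_pairing cauchy_kernel f (partial 1 \<phi>) + \<i> * kernel_pairing cauchy_kernel f (partial \<i> \<phi>)) / 2"
      unfolding distr_delbar_def distr_partial_def first[OF disjI1[OF refl]] first[OF disjI2[OF refl]] by simp
    also have "\<dots> = (\<integral>y. f y * \<phi> y \<partial>lborel)"
      unfolding cauchy_kernel_dbar[OF f \<phi>] by simp
    also have "\<dots> = distr_of f \<phi>"
      by (rule distr_of_eq_lborel[OF _ \<phi>, symmetric]) measurable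
    also have "\<dots> = distr_of (\<lambda>x. q x * m x) \<phi>"
    proof -
      have [measurable]: "\<phi> \<in> borel_measurable lebesgue"
        using test_function_measurable[OF \<phi>] by (auto intro!: measurable_completion)
      show ?thesis
        unfolding distr_of_def using ae_f by (intro integral_cong_AE) auto
    qed
    finally show "distr_delbar (\<lambda>\<psi>. distr_del (distr_of m) \<psi> + \<i> * k * distr_of m \<psi>) \<phi> = distr_of (\<lambda>x. q x * m x) \<phi>" .
  qed
qed

section \<open>Existence and uniqueness of the scattering solution\<close>

lemma integrable_times_test_function_of_locally_integrable:
  assumes h: "locally_integrable h" and \<psi>: "\<psi> \<in> test_functions"
  shows "integrable lebesgue (\<lambda>x. h x * \<psi> x)"
proof -
  obtain R M where R: "R > 0" and M: "M > 0" "\<And>x. norm (\<psi> x) \<le> M" and z: "\<And>x. norm x > R \<Longrightarrow> \<psi> x = 0"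
    using test_function_bounds[OF \<psi>] by metis
  have [measurable]: "\<psi> \<in> borel_measurable lebesgue"
    using test_function_measurable[OF \<psi>] by (auto intro!: measurable_completion)
  have int: "integrable lebesgue (\<lambda>x. indicator (cball 0 R) x *\<^sub>R h x)"
    by (rule h[unfolded locally_integrable_def set_integrable_def, rule_format, OF compact_cball])
  then have [measurable]: "(\<lambda>x. indicator (cball 0 R) x *\<^sub>R h x) \<in> borel_measurable lebesgue"
    by (rule borel_measurable_integrable)
  have eq: "(\<lambda>x. h x * \<psi> x) = (\<lambda>x. (indicator (cball 0 R) x *\<^sub>R h x) * \<psi> x)"
  proof
    fix x
    show "h x * \<psi> x = (indicator (cball 0 R) x *\<^sub>R h x) * \<psi> x"
      using z[of x] by (cases "norm x \<le> R") auto
  qed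
  show ?thesis
    unfolding eq
  proof (rule Bochner_Integration.integrable_bound[OF integrable_mult_right[of M, OF integrable_norm[OF int]]])
    show "(\<lambda>x. (indicator (cball 0 R) x *\<^sub>R h x) * \<psi> x) \<in> borel_measurable lebesgue"
      by measurable
    show "AE x in lebesgue. norm (indicator (cball 0 R) x *\<^sub>R h x * \<psi> x) \<le> norm (M * norm (indicator (cball 0 R) x *\<^sub>R h x))"
    proof (rule AE_I2)
      fix x
      have "norm (indicator (cball 0 R) x *\<^sub>R h x) * norm (\<psi> x) \<le> norm (indicator (cball 0 R) x *\<^sub>R h x) * M"
        by (intro mult_left_mono M) auto
      then show "norm (indicator (cball 0 R) x *\<^sub>R h x * \<psi> x) \<le> norm (M * norm (indicator (cball 0 R) x *\<^sub>R h x))"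
        using M(1) by (simp add: norm_mult mult_ac)
    qed
  qed
qed

lemma Lp_space_locally_integrable:
  assumes f: "f \<in> Lp_space s" and s: "s \<ge> 1"
  shows "locally_integrable f"
  unfolding locally_integrable_def
proof (intro allI impI)
  fix K :: "complex set" assume K: "compact K"
  have [measurable]: "f \<in> borel_measurable lebesgue" and int: "integrable lebesgue (\<lambda>x. norm (f x) powr s)"
    using f by (auto simp: Lp_space_def)
  have [measurable]: "K \<in> sets lebesgue"
    using K by (simp add: borel_compact)
  have "integrable lborel (indicator K :: complex \<Rightarrow> real)"
    using emeasure_compact_finite[OF K] K by (intro integrable_real_indicator) (auto simp: borel_compact)
  then have ind: "integrable lebesgue (indicator K :: complex \<Rightarrow> real)"
    using K by (subst integrable_completion) (auto intro!: borel_measurable_indicator simp: borel_compact)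
  show "set_integrable lebesgue K f"
    unfolding set_integrable_def
  proof (rule Bochner_Integration.integrable_bound[OF Bochner_Integration.integrable_add[OF ind int]])
    show "AE x in lebesgue. norm (indicator K x *\<^sub>R f x) \<le> norm (indicator K x + norm (f x) powr s)"
    proof (rule AE_I2)
      fix x
      have "norm (f x) \<le> 1 + norm (f x) powr s"
      proof (cases "norm (f x) \<le> 1")
        case False
        then have "norm (f x) powr 1 \<le> norm (f x) powr s"
          using s by (intro powr_mono) auto
        then show ?thesis
          using False by simp
      qed (simp add: add_increasing2)
      then show "norm (indicator K x *\<^sub>R f x) \<le> norm (indicator K x + norm (f x) powr s)"
        by (cases "x \<in> K") auto
    qed
  qed measurable
qed

lemma distr_of_diff:
  assumes "locally_integrable f" "locally_integrable g" "\<psi> \<in> test_functions"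
  shows "distr_of (\<lambda>x. f x - g x) \<psi> = distr_of f \<psi> - distr_of g \<psi>"
  using integrable_times_test_function_of_locally_integrable[OF assms(1,3)]
    integrable_times_test_function_of_locally_integrable[OF assms(2,3)]
  by (simp add: distr_of_def left_diff_distrib)

lemma locally_integrable_diff:
  "locally_integrable f \<Longrightarrow> locally_integrable g \<Longrightarrow> locally_integrable (\<lambda>x. f x - g x)"
  by (simp add: locally_integrable_def set_integral_diff)

lemma Lp_space_diff:
  assumes f: "f \<in> Lp_space s" and g: "g \<in> Lp_space s" and s: "s \<ge> 1"
  shows "(\<lambda>x. f x - g x) \<in> Lp_space s"
proof -
  have [measurable]: "f \<in> borel_measurable lebesgue" "g \<in> borel_measurable lebesgue"
    and int: "integrable lebesgue (\<lambda>x. norm (f x) powr s)" "integrable lebesgue (\<lambda>x. norm (g x) powr s)"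
    using f g by (auto simp: Lp_space_def)
  have "integrable lebesgue (\<lambda>x. norm (f x - g x) powr s)"
  proof (rule Bochner_Integration.integrable_bound[OF integrable_mult_right[of "2 powr s", OF Bochner_Integration.integrable_add[OF int]]])
    show "AE x in lebesgue. norm (norm (f x - g x) powr s) \<le> norm (2 powr s * (norm (f x) powr s + norm (g x) powr s))"
    proof (rule AE_I2)
      fix x
      let ?m = "max (norm (f x)) (norm (g x))"
      have "norm (f x - g x) \<le> 2 * ?m"
        using norm_triangle_ineq4[of "f x" "g x"] by (auto simp: max_def)
      then have "norm (f x - g x) powr s \<le> (2 * ?m) powr s"
        using s by (intro powr_mono2) auto
      also have "\<dots> = 2 powr s * ?m powr s"
        by (rule powr_mult)
      also have "?m powr s \<le> norm (f x) powr s + norm (g x) powr s"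
        by (cases "norm (f x) \<le> norm (g x)") (auto simp: max_def)
      finally show "norm (norm (f x - g x) powr s) \<le> norm (2 powr s * (norm (f x) powr s + norm (g x) powr s))"
        by (simp add: mult_left_mono)
    qed
  qed measurable
  then show ?thesis
    by (simp add: Lp_space_def)
qed

lemma W1_diff:
  assumes f: "f \<in> W1 s" and g: "g \<in> W1 s" and s: "s \<ge> 1"
  shows "(\<lambda>x. f x - g x) \<in> W1 s"
  unfolding W1_def
proof (intro CollectI conjI ballI)
  have fg: "f \<in> Lp_space s" "g \<in> Lp_space s"
    using f g by (auto simp: W1_def)
  then show "(\<lambda>x. f x - g x) \<in> Lp_space s"
    using s by (rule Lp_space_diff)
  note li = Lp_space_locally_integrable[OF _ s]
  fix e assume e: "e \<in> {1, \<i>}"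
  then obtain f' g' where f': "f' \<in> Lp_space s" "\<And>\<phi>. \<phi> \<in> test_functions \<Longrightarrow> distr_partial e (distr_of f) \<phi> = distr_of f' \<phi>"
    and g': "g' \<in> Lp_space s" "\<And>\<phi>. \<phi> \<in> test_functions \<Longrightarrow> distr_partial e (distr_of g) \<phi> = distr_of g' \<phi>"
    using f g unfolding W1_def by blast
  show "\<exists>h\<in>Lp_space s. \<forall>\<phi>\<in>test_functions. distr_partial e (distr_of (\<lambda>x. f x - g x)) \<phi> = distr_of h \<phi>"
  proof (intro bexI ballI)
    show "(\<lambda>x. f' x - g' x) \<in> Lp_space s"
      by (rule Lp_space_diff[OF f'(1) g'(1) s])
    fix \<phi> assume \<phi>: "\<phi> \<in> test_functions"
    have \<phi>e: "partial e \<phi> \<in> test_functions"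
      using e by (intro partial_test_function \<phi>) auto
    show "distr_partial e (distr_of (\<lambda>x. f x - g x)) \<phi> = distr_of (\<lambda>x. f' x - g' x) \<phi>"
      using f'(2)[OF \<phi>, symmetric] g'(2)[OF \<phi>, symmetric]
      by (simp add: distr_partial_def distr_of_diff[OF li[OF fg(1)] li[OF fg(2)] \<phi>e] distr_of_diff[OF li[OF f'(1)] li[OF g'(1)] \<phi>])
  qed
qed

lemma solves_eq_diff:
  assumes f: "solves_eq q k f" and g: "solves_eq q k g"
  shows "solves_eq q k (\<lambda>x. f x - g x)"
  unfolding solves_eq_def
proof (intro conjI ballI)
  have fl: "locally_integrable f" "locally_integrable (\<lambda>x. q x * f x)" and gl: "locally_integrable g" "locally_integrable (\<lambda>x. q x * g x)"
    using f g by (auto simp: solves_eq_def)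
  show "locally_integrable (\<lambda>x. f x - g x)"
    by (rule locally_integrable_diff[OF fl(1) gl(1)])
  show "locally_integrable (\<lambda>x. q x * (f x - g x))"
    unfolding right_diff_distrib by (rule locally_integrable_diff[OF fl(2) gl(2)])
  fix \<phi> assume \<phi>: "\<phi> \<in> test_functions"
  define T where "T h \<psi> = distr_del (distr_of h) \<psi> + \<i> * k * distr_of h \<psi>" for h \<psi>
  have T: "T (\<lambda>x. f x - g x) \<psi> = T f \<psi> - T g \<psi>" if \<psi>: "\<psi> \<in> test_functions" for \<psi>
    unfolding T_def distr_del_def distr_partial_def
      distr_of_diff[OF fl(1) gl(1) \<psi>] distr_of_diff[OF fl(1) gl(1) partial_test_function[OF \<psi> disjI1[OF refl]]]
      distr_of_diff[OF fl(1) gl(1) partial_test_function[OF \<psi> disjI2[OF refl]]]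
    by (simp add: field_simps)
  have "distr_delbar (T (\<lambda>x. f x - g x)) \<phi> = distr_delbar (T f) \<phi> - distr_delbar (T g) \<phi>"
    unfolding distr_delbar_def distr_partial_def T[OF partial_test_function[OF \<phi> disjI1[OF refl]]] T[OF partial_test_function[OF \<phi> disjI2[OF refl]]]
    by (simp add: field_simps)
  also have "\<dots> = distr_of (\<lambda>x. q x * f x) \<phi> - distr_of (\<lambda>x. q x * g x) \<phi>"
    using f g \<phi> by (simp add: solves_eq_def T_def[abs_def])
  also have "\<dots> = distr_of (\<lambda>x. q x * (f x - g x)) \<phi>"
    unfolding right_diff_distrib by (rule distr_of_diff[OF fl(2) gl(2) \<phi>, symmetric])
  finally show "distr_delbar (\<lambda>\<psi>. distr_del (distr_of (\<lambda>x. f x - g x)) \<psi> + \<i> * k * distr_of (\<lambda>x. f x - g x) \<psi>) \<phi>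
      = distr_of (\<lambda>x. q x * (f x - g x)) \<phi>"
    by (simp only: T_def[abs_def])
qed

lemma is_mu_unique:
  assumes "1 < p" "p < 2" "k \<noteq> 0" "\<not> exceptional_point p q k" "is_mu p q k \<mu>" "is_mu p q k \<nu>"
  shows "AE x in lebesgue. \<mu> x = \<nu> x"
proof -
  have s: "sobolev_conj p \<ge> 1"
  proof -
    have "1 / p - 1 / 2 > 0" "1 / p - 1 / 2 \<le> 1"
      using assms(1,2) by (simp_all add: field_simps)
    then show ?thesis
      by (simp add: sobolev_conj_def)
  qed
  have "(\<lambda>x. \<mu> x - 1) \<in> W1 (sobolev_conj p)" "(\<lambda>x. \<nu> x - 1) \<in> W1 (sobolev_conj p)"
    using assms(5,6) by (auto simp: is_mu_def)
  from W1_diff[OF this s] have "(\<lambda>x. \<mu> x - \<nu> x) \<in> W1 (sobolev_conj p)"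
    by simp
  moreover have "solves_eq q k (\<lambda>x. \<mu> x - \<nu> x)"
    using assms(5,6) by (intro solves_eq_diff) (auto simp: is_mu_def)
  ultimately have "AE x in lebesgue. \<mu> x - \<nu> x = 0"
    using assms(3,4) unfolding exceptional_point_def by blast
  then show ?thesis
    by simp
qed

lemma continuous_AE_zero:
  fixes v :: "complex \<Rightarrow> complex"
  assumes c: "continuous_on UNIV v" and ae: "AE x in lebesgue. v x = 0"
  shows "v x = 0"
proof (rule ccontr)
  assume "v x \<noteq> 0"
  moreover have op: "open {x. v x \<noteq> 0}"
    by (intro open_Collect_neq c continuous_on_const)
  ultimately have "\<not> negligible {x. v x \<noteq> 0}"
    by (intro open_not_negligible) auto
  moreover have S: "{x. v x \<noteq> 0} \<in> sets lebesgue"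
    using op by (simp add: borel_open)
  have "{x. v x \<noteq> 0} \<in> null_sets lebesgue"
    unfolding AE_iff_null_sets[OF S] using ae by simp
  ultimately show False
    by (simp add: negligible_iff_null_sets)
qed

text \<open>
  Injectivity of the integral equation comes from \<open>k\<close> not being exceptional, and the Fredholm alternative then
  solves it. The chosen function \<open>mu\<close> agrees with the solution almost everywhere by uniqueness.
\<close>

theorem faddeev_solution_exists:
  fixes q q0 :: "complex \<Rightarrow> complex"
  assumes k: "k \<noteq> 0" and p12: "1 < p" "p < 2" and nex: "\<not> exceptional_point p q k"
    and qm: "q \<in> borel_measurable lebesgue" and ae: "AE x in lebesgue. q x = q0 x"
    and q0: "integrable lborel q0" "(\<integral>\<^sup>+x. ennreal (norm (q0 x) powr p) \<partial>lborel) < \<infinity>"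
  obtains m where "continuous_on UNIV m" "bounded (range m)"
    "\<And>x. m x = 1 + convolve (faddeev_green k) (\<lambda>y. q0 y * m y) x"
    "AE x in lebesgue. mu p q k x = m x" "mu p q k \<in> borel_measurable lebesgue"
proof -
  interpret subcritical_kernel "faddeev_green k" q0 p
    by (rule subcritical_kernel_faddeev_green[OF k p12(1) q0])
  have bd: "\<exists>M. \<forall>x. norm (v x) \<le> M" if "bounded (range v)" for v :: "complex \<Rightarrow> complex"
    using that by (auto simp: bounded_iff)
  have inj: "\<forall>x. v x = 0"
    if v: "continuous_on UNIV v" "bounded (range v)" "\<And>x. v x = convolve (faddeev_green k) (\<lambda>y. q0 y * v y) x" for v
  proof -
    obtain M where M: "\<And>x. norm (v x) \<le> M"
      using bd[OF v(2)] by blast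
    have "v x = 0 + convolve (faddeev_green k) (\<lambda>y. q0 y * v y) x" for x
      using v(3)[of x] by (simp only: add_0_left)
    note sol = integral_equation_imp_solution[OF k p12 qm ae q0 borel_measurable_continuous_onI[OF v(1)] M this]
    have "v \<in> W1 (sobolev_conj p)"
      using sol(1) by simp
    then have "AE x in lebesgue. v x = 0"
      using sol(2) nex k unfolding exceptional_point_def by blast
    then show ?thesis
      using continuous_AE_zero[OF v(1)] by blast
  qed
  obtain m where m: "continuous_on UNIV m" "bounded (range m)" "\<And>x. m x = 1 + convolve (faddeev_green k) (\<lambda>y. q0 y * m y) x"
    by (rule lippmann_schwinger_solvable[OF inj]) blast+
  obtain M where M: "\<And>x. norm (m x) \<le> M"
    using bd[OF m(2)] by blast
  have ism: "is_mu p q k m"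
    unfolding is_mu_def
    using integral_equation_imp_solution[OF k p12 qm ae q0 borel_measurable_continuous_onI[OF m(1)] M m(3)] by blast
  then have mu: "is_mu p q k (mu p q k)"
    unfolding mu_def by (rule someI[of "is_mu p q k"])
  have "(\<lambda>x. mu p q k x - 1) \<in> borel_measurable lebesgue"
    using mu by (auto simp: is_mu_def W1_def Lp_space_def)
  then have "(\<lambda>x. (mu p q k x - 1) + 1) \<in> borel_measurable lebesgue"
    by (intro borel_measurable_add borel_measurable_const)
  then have "mu p q k \<in> borel_measurable lebesgue"
    by simp
  then show ?thesis
    using that[OF m is_mu_unique[OF p12 k nex mu ism]] by blast
qed

section \<open>The symmetry of the scattering data\<close>

lemma scattering_data_eq:
  fixes q q0 m :: "complex \<Rightarrow> complex"
  assumes [measurable]: "q \<in> borel_measurable lebesgue" and ae: "AE x in lebesgue. q x = q0 x"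
    and [measurable]: "q0 \<in> borel_measurable borel" "m \<in> borel_measurable borel"
    and mu: "AE x in lebesgue. mu p q k x = m x" "mu p q k \<in> borel_measurable lebesgue"
  shows "scattering_data p q k = (\<integral>x. e_osc k x * q0 x * m x \<partial>lborel)"
proof -
  note [measurable] = mu(2)
  have [measurable]: "e_osc k \<in> borel_measurable lebesgue" "q0 \<in> borel_measurable lebesgue" "m \<in> borel_measurable lebesgue"
    by (auto intro!: measurable_completion)
  have "scattering_data p q k = (\<integral>x. e_osc k x * q0 x * m x \<partial>lebesgue)"
    unfolding scattering_data_def
  proof (rule integral_cong_AE)
    show "AE x in lebesgue. e_osc k x * q x * mu p q k x = e_osc k x * q0 x * m x"
      using ae mu(1) by eventually_elim simp
  qed measurable
  also have "\<dots> = (\<integral>x. e_osc k x * q0 x * m x \<partial>lborel)"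
    by (rule integral_completion) measurable
  finally show ?thesis .
qed

lemma integrable_bounded_mult:
  fixes q g :: "complex \<Rightarrow> complex"
  assumes q: "integrable lborel q" and [measurable]: "g \<in> borel_measurable borel" and M: "\<And>x. norm (g x) \<le> M"
  shows "integrable lborel (\<lambda>x. q x * g x)"
proof (rule Bochner_Integration.integrable_bound[OF integrable_mult_right[of M, OF integrable_norm[OF q]]])
  have M0: "M \<ge> 0"
    using order_trans[OF norm_ge_zero M[of 0]] .
  show "AE x in lborel. norm (q x * g x) \<le> norm (M * norm (q x))"
    using M M0 by (intro AE_I2) (simp add: norm_mult mult.commute mult_right_mono)
qed (use q in auto)

lemma e_osc_diff: "e_osc k x * e_osc k (y - x) = e_osc k y"
  by (simp add: e_osc_def algebra_simps flip: exp_add)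

context subcritical_kernel
begin

lemma potential_quadratic_integrable:
  assumes [measurable]: "a \<in> borel_measurable borel" "b \<in> borel_measurable borel"
    and A: "\<And>x. norm (a x) \<le> A" and B: "\<And>x. norm (b x) \<le> B"
  shows "integrable (lborel \<Otimes>\<^sub>M lborel) (\<lambda>(x, y). (q x * a x) * (G (x - y) * (q y * b y)))"
proof (rule integrableI_bounded)
  obtain C where C: "C \<ge> 0" "\<And>x. abs_potential x \<le> ennreal C"
    using potential_bounded by blast
  have A0: "A \<ge> 0" and B0: "B \<ge> 0"
    using order_trans[OF norm_ge_zero A[of 0]] order_trans[OF norm_ge_zero B[of 0]] .
  show "(\<lambda>(x, y). (q x * a x) * (G (x - y) * (q y * b y))) \<in> borel_measurable (lborel \<Otimes>\<^sub>M lborel)"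
    by measurable
  have "(\<integral>\<^sup>+ z. norm (case z of (x, y) \<Rightarrow> (q x * a x) * (G (x - y) * (q y * b y))) \<partial>(lborel \<Otimes>\<^sub>M lborel))
     = (\<integral>\<^sup>+ x. (\<integral>\<^sup>+ y. norm ((q x * a x) * (G (x - y) * (q y * b y))) \<partial>lborel) \<partial>lborel)"
    by (subst lborel.nn_integral_fst[symmetric]) auto
  also have "\<dots> \<le> (\<integral>\<^sup>+ x. ennreal (norm (q x)) * ennreal (A * B * C) \<partial>lborel)"
  proof (rule nn_integral_mono)
    fix x :: complex
    have "(\<integral>\<^sup>+ y. norm ((q x * a x) * (G (x - y) * (q y * b y))) \<partial>lborel)
      \<le> (\<integral>\<^sup>+ y. ennreal (norm (q x) * (A * B)) * ennreal (norm (G (x - y)) * norm (q y)) \<partial>lborel)"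
    proof (rule nn_integral_mono)
      fix y :: complex
      have "(norm (q x) * (norm (a x) * norm (b y))) \<le> norm (q x) * (A * B)"
        using A[of x] B[of y] A0 by (intro mult_left_mono mult_mono) auto
      then have "ennreal ((norm (q x) * (norm (a x) * norm (b y))) * (norm (G (x - y)) * norm (q y)))
          \<le> ennreal (norm (q x) * (A * B)) * ennreal (norm (G (x - y)) * norm (q y))"
        using A0 B0 by (intro ennreal_mult_bound) auto
      then show "ennreal (norm ((q x * a x) * (G (x - y) * (q y * b y)))) \<le> ennreal (norm (q x) * (A * B)) * ennreal (norm (G (x - y)) * norm (q y))"
        by (simp add: norm_mult mult_ac)
    qed
    also have "\<dots> = ennreal (norm (q x) * (A * B)) * abs_potential x"
      by (rule nn_integral_cmult) measurable
    also have "\<dots> \<le> ennreal (norm (q x) * (A * B)) * ennreal C"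
      by (intro mult_left_mono C(2)) simp
    also have "\<dots> = ennreal (norm (q x)) * ennreal (A * B * C)"
      using A0 B0 C(1) by (simp add: mult_ac flip: ennreal_mult)
    finally show "(\<integral>\<^sup>+ y. norm ((q x * a x) * (G (x - y) * (q y * b y))) \<partial>lborel) \<le> ennreal (norm (q x)) * ennreal (A * B * C)" .
  qed
  also have "\<dots> = (\<integral>\<^sup>+ x. ennreal (norm (q x)) \<partial>lborel) * ennreal (A * B * C)"
    by (rule nn_integral_multc) measurable
  also have "\<dots> < \<infinity>"
    using q_nn_finite by (simp add: ennreal_mult_less_top)
  finally show "(\<integral>\<^sup>+ z. norm (case z of (x, y) \<Rightarrow> (q x * a x) * (G (x - y) * (q y * b y))) \<partial>(lborel \<Otimes>\<^sub>M lborel)) < \<infinity>" .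
qed

end

text \<open>
  Both iterated integrals of \<open>H x y = e\<^sub>k(x) q(x) n'(x) G\<^sub>k(x - y) q(y) m(y)\<close> can be evaluated: the inner one in \<open>y\<close> by the
  equation for \<open>m\<close>, the inner one in \<open>x\<close> by the symmetry of the kernel and the conjugated equation for \<open>n\<close>.
\<close>

lemma lippmann_schwinger_reciprocity:
  fixes r :: "complex \<Rightarrow> real"
  defines "q \<equiv> (\<lambda>x. complex_of_real (r x))"
  assumes k: "k \<noteq> 0" and p1: "1 < p"
    and q: "integrable lborel q" "(\<integral>\<^sup>+x. ennreal (norm (q x) powr p) \<partial>lborel) < \<infinity>"
    and m: "m \<in> borel_measurable borel" "\<And>x. norm (m x) \<le> A" "\<And>x. m x = 1 + convolve (faddeev_green k) (\<lambda>y. q y * m y) x"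
    and n: "n \<in> borel_measurable borel" "\<And>x. norm (n x) \<le> B" "\<And>x. n x = 1 + convolve (faddeev_green (- k)) (\<lambda>y. q y * n y) x"
  shows "(\<integral>x. e_osc k x * q x * m x \<partial>lborel) = cnj (\<integral>x. e_osc (- k) x * q x * n x \<partial>lborel)"
proof -
  have "- k \<noteq> 0" using k by simp
  interpret G: subcritical_kernel "faddeev_green k" q p
    by (rule subcritical_kernel_faddeev_green[OF k p1 q])
  define n' where "n' x = cnj (n x)" for x
  have [measurable]: "m \<in> borel_measurable borel" "q \<in> borel_measurable borel"
    using m(1) q(1) by auto
  have "cnj \<in> borel_measurable borel"
    by (intro borel_measurable_continuous_onI continuous_intros)
  then have [measurable]: "n' \<in> borel_measurable borel"
    unfolding n'_def[abs_def] using n(1) by measurable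
  have n'B: "norm (n' x) \<le> B" for x
    using n(2) by (simp add: n'_def)
  have cq: "cnj (q x) = q x" for x
    by (simp add: q_def)
  have kern: "cnj (faddeev_green (- k) (x - y)) = e_osc k (y - x) * faddeev_green k (y - x)" for x y
    using faddeev_green_symmetry[of k "y - x"] by simp
  have n'_eq: "n' x = 1 + (\<integral>y. e_osc k (y - x) * faddeev_green k (y - x) * (q y * n' y) \<partial>lborel)" for x
  proof -
    have "n' x = 1 + cnj (\<integral>y. faddeev_green (- k) (x - y) * (q y * n y) \<partial>lborel)"
      unfolding n'_def by (subst n(3)) (simp add: convolve_def)
    also have "cnj (\<integral>y. faddeev_green (- k) (x - y) * (q y * n y) \<partial>lborel)
        = (\<integral>y. cnj (faddeev_green (- k) (x - y) * (q y * n y)) \<partial>lborel)"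
      by (rule Bochner_Integration.integral_cnj[symmetric])
    also have "\<dots> = (\<integral>y. e_osc k (y - x) * faddeev_green k (y - x) * (q y * n' y) \<partial>lborel)"
      by (simp add: kern cq n'_def)
    finally show ?thesis .
  qed
  define H where "H x y = (q x * (e_osc k x * n' x)) * (faddeev_green k (x - y) * (q y * m y))" for x y
  have H: "integrable (lborel \<Otimes>\<^sub>M lborel) (\<lambda>(x, y). H x y)"
    unfolding H_def
  proof (rule G.potential_quadratic_integrable[where A = B and B = A])
    show "norm (e_osc k x * n' x) \<le> B" for x
      by (simp add: norm_mult n'B)
  qed (measurable, rule m(2))
  have H1: "(\<integral>y. H x y \<partial>lborel) = e_osc k x * q x * n' x * m x - e_osc k x * q x * n' x" for x
  proof -
    have "(\<integral>y. H x y \<partial>lborel) = (q x * (e_osc k x * n' x)) * convolve (faddeev_green k) (\<lambda>y. q y * m y) x"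
      by (simp add: H_def convolve_def)
    also have "convolve (faddeev_green k) (\<lambda>y. q y * m y) x = m x - 1"
      using m(3)[of x] by (simp only: add_diff_cancel_left')
    finally show ?thesis
      by (simp add: algebra_simps)
  qed
  have H2: "(\<integral>x. H x y \<partial>lborel) = e_osc k y * q y * n' y * m y - e_osc k y * q y * m y" for y
  proof -
    have "H x y = (e_osc k y * q y * m y) * (e_osc k (x - y) * faddeev_green k (x - y) * (q x * n' x))" for x
      unfolding H_def e_osc_diff[of k y x, symmetric] by (simp only: mult_ac)
    then have "(\<integral>x. H x y \<partial>lborel) = (e_osc k y * q y * m y) * (\<integral>x. e_osc k (x - y) * faddeev_green k (x - y) * (q x * n' x) \<partial>lborel)"
      by simp
    also have "(\<integral>x. e_osc k (x - y) * faddeev_green k (x - y) * (q x * n' x) \<partial>lborel) = n' y - 1"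
      using n'_eq[of y] by (simp only: add_diff_cancel_left')
    finally show ?thesis
      by (simp add: algebra_simps)
  qed
  have i0: "integrable lborel (\<lambda>x. e_osc k x * q x * n' x * m x)"
  proof -
    have "norm (e_osc k x * n' x * m x) \<le> B * A" for x
      using mult_mono[OF n'B[of x] m(2)[of x]] order_trans[OF norm_ge_zero n'B] by (simp add: norm_mult)
    then have "integrable lborel (\<lambda>x. q x * (e_osc k x * n' x * m x))"
      by (intro integrable_bounded_mult[OF q(1), where M = "B * A"]) auto
    then show ?thesis
      by (simp add: mult_ac)
  qed
  have i1: "integrable lborel (\<lambda>x. e_osc k x * q x * n' x)"
  proof -
    have "integrable lborel (\<lambda>x. q x * (e_osc k x * n' x))"
      by (intro integrable_bounded_mult[OF q(1), where M = B]) (auto simp: norm_mult n'B)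
    then show ?thesis
      by (simp add: mult_ac)
  qed
  have i2: "integrable lborel (\<lambda>x. e_osc k x * q x * m x)"
  proof -
    have "integrable lborel (\<lambda>x. q x * (e_osc k x * m x))"
      by (intro integrable_bounded_mult[OF q(1), where M = A]) (auto simp: norm_mult m(2))
    then show ?thesis
      by (simp add: mult_ac)
  qed
  have "(\<integral>y. (\<integral>x. H x y \<partial>lborel) \<partial>lborel) = (\<integral>x. (\<integral>y. H x y \<partial>lborel) \<partial>lborel)"
    by (rule lborel_pair.Fubini_integral[OF H])
  then have "(\<integral>x. e_osc k x * q x * m x \<partial>lborel) = (\<integral>x. e_osc k x * q x * n' x \<partial>lborel)"
    unfolding H1 H2 using i0 i1 i2 by simp
  also have "\<dots> = (\<integral>x. cnj (e_osc (- k) x * q x * n x) \<partial>lborel)"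
  proof -
    have "cnj (e_osc (- k) x) = e_osc k x" for x
      by (simp add: e_osc_def exp_cnj algebra_simps)
    then show ?thesis
      by (simp add: n'_def cq)
  qed
  also have "\<dots> = cnj (\<integral>x. e_osc (- k) x * q x * n x \<partial>lborel)"
    by (rule Bochner_Integration.integral_cnj)
  finally show ?thesis .
qed

theorem lemma5p1:
  fixes p p' \<rho> :: real and q :: "complex \<Rightarrow> complex" and k :: complex
  assumes "1 < p" and "p < 2" and "1 / p + 1 / p' = 1"
    and "\<rho> > 2 / p'"
    and "q \<in> weighted_Lp p \<rho>"
    and "AE x in lebesgue. q x \<in> \<real>"
    and "k \<noteq> 0"
    and "\<not> exceptional_point p q k" and "\<not> exceptional_point p q (- k)"
  shows "scattering_data p q k = cnj (scattering_data p q (- k))"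
proof -
  obtain r where r: "AE x in lebesgue. q x = of_real (r x)"
    "integrable lborel (\<lambda>x. complex_of_real (r x))" "(\<integral>\<^sup>+x. ennreal (norm (complex_of_real (r x)) powr p) \<partial>lborel) < \<infinity>"
    by (rule real_potential_representative[OF assms(1,3,4,5,6)]) blast
  have qm: "q \<in> borel_measurable lebesgue"
    using assms(5) by (simp add: weighted_Lp_def)
  have k': "- k \<noteq> 0"
    using assms(7) by simp
  obtain m where m: "continuous_on UNIV m" "bounded (range m)"
    "\<And>x. m x = 1 + convolve (faddeev_green k) (\<lambda>y. of_real (r y) * m y) x"
    "AE x in lebesgue. mu p q k x = m x" "mu p q k \<in> borel_measurable lebesgue"
    by (rule faddeev_solution_exists[OF assms(7,1,2,8) qm r]) blast
  obtain n where n: "continuous_on UNIV n" "bounded (range n)"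
    "\<And>x. n x = 1 + convolve (faddeev_green (- k)) (\<lambda>y. of_real (r y) * n y) x"
    "AE x in lebesgue. mu p q (- k) x = n x" "mu p q (- k) \<in> borel_measurable lebesgue"
    by (rule faddeev_solution_exists[OF k' assms(1,2,9) qm r]) blast
  note mm = borel_measurable_continuous_onI[OF m(1)] and nm = borel_measurable_continuous_onI[OF n(1)]
  obtain A B where AB: "\<And>x. norm (m x) \<le> A" "\<And>x. norm (n x) \<le> B"
    using m(2) n(2) unfolding bounded_iff by blast
  have rm: "(\<lambda>x. complex_of_real (r x)) \<in> borel_measurable borel"
    using r(2) by auto
  have "scattering_data p q k = (\<integral>x. e_osc k x * of_real (r x) * m x \<partial>lborel)"
    by (rule scattering_data_eq[OF qm r(1) rm mm m(4,5)])
  also have "\<dots> = cnj (\<integral>x. e_osc (- k) x * of_real (r x) * n x \<partial>lborel)"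
    by (rule lippmann_schwinger_reciprocity[OF assms(7,1) r(2,3) mm AB(1) m(3) nm AB(2) n(3)])
  also have "(\<integral>x. e_osc (- k) x * of_real (r x) * n x \<partial>lborel) = scattering_data p q (- k)"
    by (rule scattering_data_eq[OF qm r(1) rm nm n(4,5), symmetric])
  finally show ?thesis .
qed

end
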